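(* Let $\prec$ be the degrevlex term order in $S$. If $V$ and $V'$ are two $K$-points of $\mathbf{Hilb}_{p(t)}^{n}$ such that $J:=I_V$ and $I:=I_{V'}$ are Borel-fixed ideals, then $$V\prec\!\!\prec V'\ \Rightarrow\ \dim_K(J^{\mathrm{sat}})_t\ge\dim_K(I^{\mathrm{sat}})_t\quad\text{for all } t\ge 0.$$ In particular, if $Y$ is a $GL$-stable subset of $\mathbf{Hilb}_{p(t)}^{n}$, the Hilbert function of $\mathrm{Proj}(S/\mathbf G_Y)$ is the maximum among the Hilbert functions of $\mathrm{Proj}(S/H)$, where $H$ varies among the saturated ideals defining points of $Y$.
   Context: $K$ is an infinite field, $S=K[x_0,\dots,x_n]$ with the standard grading, $S_m$ is its degree $m$ component, a term is a monic monomial. Degrevlex: for terms $\tau=x_0^{\alpha_0}\cdots x_n^{\alpha_n}$, $\sigma=x_0^{\beta_0}\cdots x_n^{\beta_n}$ of the same degree, $\tau\prec\sigma$ iff $\alpha_k>\beta_k$ where $k=\min\{i:\alpha_i\ne\beta_i\}$ (so $x_0\prec\dots\prec x_n$). $\mathbf{Hilb}_{p(t)}^{n}$ is the Hilbert scheme of closed subschemes of $\mathbb P^n_K$ with Hilbert polynomial $p(t)$; $r$ is the Gotzmann number of $p(t)$ (the smallest integer such that the saturated ideals of all such subschemes are $r$-regular). Fix $m\ge r$, $q=\binom{n+m}{n}-p(m)$. $\mathbf{Hilb}_{p(t)}^{n}$ is regarded as a closed subscheme of the Grassmannian $\mathbf{Gr}_{S_m}^{q}$ of $q$-dimensional subspaces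 of $S_m$ by sending a subscheme with saturated ideal $I$ to $I_m$; the Grassmannian is embedded in $\mathbb P(\wedge^qS_m)$ by Plücker. A $K$-point of $\mathbf{Gr}_{S_m}^{q}$ is a subspace $V\subseteq S_m$, and $I_V$ is the ideal of $S$ generated by $V$. $I^{\mathrm{sat}}=\bigcup_k(I:(x_0,\dots,x_n)^k)$. A point with residue field $k$ is defined by a saturated ideal in $S\otimes_Kk$. The Hilbert function of $\mathrm{Proj}(S/H)$, $H$ saturated, is $t\mapsto\dim (S/H)_t$ (over the relevant field); numerical functions are compared by $f\ge g$ iff $f(t)\ge g(t)$ for every $t\in\mathbb N$. $\mathrm{GL}=\mathrm{GL}_K(n+1)$ acts on $S$ by $g(f)=f(\sum_j g_{0j}x_j,\dots,\sum_j g_{nj}x_j)$ and correspondingly on $\mathbf{Gr}_{S_m}^{q}$. An ideal is Borel-fixed if it is fixed by all upper-triangular invertible matrices (hence it is monomial). For subspaces $V,V'\subseteq S_m$ spanned by sets $A,B$ of $q$ terms, $V\prec\!\!\prec V'$ means that there is a bijection $\omega:A\to B$ with $a\preceq\omega(a)$ for all $a\in A$. A $GL$-stable subset of $\mathbf{Hilb}_{p(t)}^{n}$ is a non-empty closed irreducible subset stable under the action of $\mathrm{GL}$. $\mathbf T_{S_m}^{q}$ is the set of $\tau_1\wedge\dots\wedge\tau_q$, $\tau_i$ terms in $S_m$, $\tau_1\succ\dots\succ\tau_q$, totally ordered lexicographically: $\tau_1\wedge\dots\wedge\tau_q\prec\sigma_1\wedge\dots\wedge\sigma_q$ iff for some $j$,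 $\tau_i=\sigma_i$ for $i<j$ and $\tau_j\prec\sigma_j$. For $L=\tau_1\wedge\dots\wedge\tau_q$, $U_L$ is the open set of $\mathbf{Gr}_{S_m}^{q}$ where the Plücker coordinate $\Delta_L$ is invertible and $\mathrm{vs}(L)=\langle\tau_1,\dots,\tau_q\rangle$. With $\mathcal O(Y)=\{g(V):V\in Y,g\in\mathrm{GL}\}$, $\mathbf{gin}(Y):=\max_\prec\{L\in\mathbf T_{S_m}^{q}:U_L\cap\mathcal O(Y)\ne\emptyset\}$, and the double-generic initial ideal of $Y$ is $\mathbf G_Y:=(I_{\mathrm{vs}(\mathbf{gin}(Y))})^{\mathrm{sat}}$, which does not depend on the choice of $m\ge r$. *)

theory Defs
  imports
    "HOL-Library.Poly_Mapping"
    "HOL-Computational_Algebra.Fraction_Field"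
    "HOL-Computational_Algebra.Polynomial"
    "HOL-Algebra.Algebraic_Closure_Type"
    "HOL-Analysis.Cartesian_Space"
    "Jordan_Normal_Form.Determinant"
begin

section \<open>Polynomial rings\<close>

text \<open>
  The ring $K[x_0,\dots,x_n]$ is the type of polynomials over \<open>'a\<close> with variables indexed by a
  finite linearly ordered type \<open>'n\<close> with $n + 1$ elements; the least element of \<open>'n\<close> is the
  index 0.
\<close>

type_synonym 'v pterm = "'v \<Rightarrow>\<^sub>0 nat"
type_synonym ('v, 'a) mpoly = "'v pterm \<Rightarrow>\<^sub>0 'a"

definition Const :: "'a::zero \<Rightarrow> ('v, 'a) mpoly" where
  "Const c = Poly_Mapping.single 0 c"

definition monomial :: "'v pterm \<Rightarrow> ('v, 'a::zero_neq_one) mpoly" where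
  "monomial u = Poly_Mapping.single u 1"

definition Var :: "'v \<Rightarrow> ('v, 'a::zero_neq_one) mpoly" where
  "Var v = monomial (Poly_Mapping.single v 1)"

definition tdeg :: "'v pterm \<Rightarrow> nat" where
  "tdeg u = (\<Sum>v\<in>Poly_Mapping.keys u. Poly_Mapping.lookup u v)"

definition forms :: "nat \<Rightarrow> ('v, 'a::zero) mpoly set" where
  "forms d = {f. \<forall>u\<in>Poly_Mapping.keys f. tdeg u = d}"

definition hcomponent :: "nat \<Rightarrow> ('v, 'a::comm_monoid_add) mpoly \<Rightarrow> ('v, 'a) mpoly" where
  "hcomponent d f =
     (\<Sum>u\<in>{u\<in>Poly_Mapping.keys f. tdeg u = d}. Poly_Mapping.single u (Poly_Mapping.lookup f u))"

text \<open>Evaluation at the point \<open>c\<close>, the coefficients being mapped by \<open>h\<close>.\<close>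

definition meval :: "('a::zero \<Rightarrow> 'r::comm_ring_1) \<Rightarrow> ('v \<Rightarrow> 'r) \<Rightarrow> ('v, 'a) mpoly \<Rightarrow> 'r" where
  "meval h c f =
     (\<Sum>u\<in>Poly_Mapping.keys f. h (Poly_Mapping.lookup f u) *
        (\<Prod>v\<in>Poly_Mapping.keys u. c v ^ Poly_Mapping.lookup u v))"

definition mscale :: "'a::comm_ring_1 \<Rightarrow> ('v, 'a) mpoly \<Rightarrow> ('v, 'a) mpoly" where
  "mscale c f = Const c * f"

global_interpretation mpoly: vector_space "mscale :: 'a::field \<Rightarrow> ('v, 'a) mpoly \<Rightarrow> ('v, 'a) mpoly"
proof
  fix a b :: 'a and x y :: "('v, 'a) mpoly"
  show "mscale a (x + y) = mscale a x + mscale a y"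
    by (simp add: mscale_def algebra_simps)
  show "mscale (a + b) x = mscale a x + mscale b x"
    by (simp add: mscale_def Const_def single_add algebra_simps)
  show "mscale a (mscale b x) = mscale (a * b) x"
    by (simp add: mscale_def Const_def mult_single flip: mult.assoc)
  show "mscale 1 x = x"
    by (simp add: mscale_def Const_def)
qed

section \<open>Ideals\<close>

text \<open>The ideals are the submodules of the polynomial ring over itself.\<close>

global_interpretation mideal:
  Modules.module "(*) :: ('v, 'a::comm_ring_1) mpoly \<Rightarrow> ('v, 'a) mpoly \<Rightarrow> ('v, 'a) mpoly"
  by standard (simp_all add: algebra_simps)

definition homogeneous_ideal :: "('v, 'a::comm_ring_1) mpoly set \<Rightarrow> bool" where
  "homogeneous_ideal I \<longleftrightarrow> mideal.subspace I \<and> mideal.span (\<Union>d. I \<inter> forms d) = I"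

definition ideal_mult :: "('v, 'a::comm_ring_1) mpoly set \<Rightarrow> ('v, 'a) mpoly set \<Rightarrow> ('v, 'a) mpoly set"
  where "ideal_mult I J = mideal.span {f * g | f g. f \<in> I \<and> g \<in> J}"

primrec ideal_pow :: "('v, 'a::comm_ring_1) mpoly set \<Rightarrow> nat \<Rightarrow> ('v, 'a) mpoly set" where
  "ideal_pow I 0 = UNIV"
| "ideal_pow I (Suc k) = ideal_mult I (ideal_pow I k)"

definition irrelevant_ideal :: "('v, 'a::comm_ring_1) mpoly set" where
  "irrelevant_ideal = mideal.span (range Var)"

definition colon :: "('v, 'a::comm_ring_1) mpoly set \<Rightarrow> ('v, 'a) mpoly set \<Rightarrow> ('v, 'a) mpoly set" where
  "colon I J = {f. \<forall>g\<in>J. f * g \<in> I}"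

definition saturation :: "('v, 'a::comm_ring_1) mpoly set \<Rightarrow> ('v, 'a) mpoly set" where
  "saturation I = (\<Union>k. colon I (ideal_pow irrelevant_ideal k))"

section \<open>Hilbert functions and Hilbert polynomials\<close>

text \<open>$\dim (S/I)_t$, as the codimension of $I_t$ in the finite-dimensional space $S_t$.\<close>

definition hilbert_function :: "('n::finite, 'a::field) mpoly set \<Rightarrow> nat \<Rightarrow> nat" where
  "hilbert_function I t = mpoly.dim (forms t :: ('n, 'a) mpoly set) - mpoly.dim (I \<inter> forms t)"

text \<open>
  Closed subschemes of $\mathbb{P}^n_k$ correspond to homogeneous saturated ideals (the unit ideal
  being the one of the empty subscheme).
\<close>

definition subscheme_ideals :: "rat poly \<Rightarrow> ('n::finite, 'a::field) mpoly set set" where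
  "subscheme_ideals p =
     {I. homogeneous_ideal I \<and> saturation I = I \<and>
         (\<exists>t0. \<forall>t\<ge>t0. rat_of_nat (hilbert_function I t) = poly p (rat_of_nat t))}"

section \<open>Castelnuovo--Mumford regularity and the Gotzmann number\<close>

text \<open>
  \<open>I\<close> is \<open>r\<close>-regular if it has a graded free resolution
  $0 \to F_n \to \dots \to F_0 \to I \to 0$ with $F_i = \bigoplus_j S(-e_{ij})$ and
  $e_{ij} \le r + i$ for all $i, j$.  (It is enough to allow length at most $n$, because
  the minimal resolution has this property by Hilbert's syzygy theorem.)
  The resolution is continued by $F_0 \to S$, so \<open>e (Suc i)\<close> lists the degrees of the generators
  of $F_i$ and \<open>e 0 = [0]\<close> belongs to \<open>S\<close>; \<open>e (Suc CARD('n)) = []\<close> is the zero module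
  on the left.
\<close>

definition mumford_regular :: "nat \<Rightarrow> ('n::finite, 'a::field) mpoly set \<Rightarrow> bool" where
  "mumford_regular r I \<longleftrightarrow>
     (\<exists>(e :: nat \<Rightarrow> nat list) (d :: nat \<Rightarrow> ('n, 'a) mpoly Matrix.mat).
        e 0 = [0] \<and> e (Suc CARD('n)) = [] \<and>
        (\<forall>i<CARD('n). \<forall>s\<in>set (e (Suc i)). s \<le> r + i) \<and>
        (\<forall>i\<le>CARD('n). d i \<in> carrier_mat (length (e i)) (length (e (Suc i))) \<and>
           (\<forall>j<length (e i). \<forall>k<length (e (Suc i)).
              \<forall>u\<in>Poly_Mapping.keys (d i $$ (j, k)). tdeg u + e i ! j = e (Suc i) ! k)) \<and>
        (\<lambda>v. vec_index (d 0 *\<^sub>v v) 0) ` carrier_vec (length (e 1)) = I \<and>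
        (\<forall>i<CARD('n).
           {v \<in> carrier_vec (length (e (Suc i))). d i *\<^sub>v v = 0\<^sub>v (length (e i))} =
           (\<lambda>v. d (Suc i) *\<^sub>v v) ` carrier_vec (length (e (Suc (Suc i))))))"

text \<open>
  To be used with \<open>II\<close> the set of saturated ideals over $K$ with Hilbert polynomial $p$. The minimum
  is taken among the non-negative integers: this makes a difference only for the zero ideal,
  which is \<open>r\<close>-regular for all integers \<open>r\<close>.
\<close>

definition is_gotzmann_number :: "('n::finite, 'a::field) mpoly set set \<Rightarrow> nat \<Rightarrow> bool" where
  "is_gotzmann_number II r \<longleftrightarrow>
     (\<forall>I\<in>II. mumford_regular r I) \<and> (\<forall>s. (\<forall>I\<in>II. mumford_regular s I) \<longrightarrow> r \<le> s)"

section \<open>Degrevlex order\<close>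

definition drl_less :: "('n::linorder) pterm \<Rightarrow> 'n pterm \<Rightarrow> bool" where
  "drl_less a b \<longleftrightarrow> tdeg a = tdeg b \<and>
     (\<exists>k. Poly_Mapping.lookup a k > Poly_Mapping.lookup b k \<and>
          (\<forall>i<k. Poly_Mapping.lookup a i = Poly_Mapping.lookup b i))"

definition drl_le :: "('n::linorder) pterm \<Rightarrow> 'n pterm \<Rightarrow> bool" where
  "drl_le a b \<longleftrightarrow> drl_less a b \<or> a = b"

text \<open>The relation $V \prec\!\!\prec V'$ for subspaces of $S_m$.\<close>

definition term_dominated ::
  "nat \<Rightarrow> nat \<Rightarrow> ('n::{finite,linorder}, 'a::field) mpoly set \<Rightarrow> ('n, 'a) mpoly set \<Rightarrow> bool" where
  "term_dominated q m V V' \<longleftrightarrow>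
     (\<exists>A B. A \<subseteq> {u. tdeg u = m} \<and> B \<subseteq> {u. tdeg u = m} \<and>
        finite A \<and> finite B \<and> card A = q \<and> card B = q \<and>
        V = mpoly.span (monomial ` A) \<and> V' = mpoly.span (monomial ` B) \<and>
        (\<exists>\<omega>. bij_betw \<omega> A B \<and> (\<forall>a\<in>A. drl_le a (\<omega> a))))"

text \<open>
  $\tau_1 \wedge \dots \wedge \tau_q$ with $\tau_1 \succ \dots \succ \tau_q$ is represented by
  the list of the $\tau_i$.
\<close>

type_synonym 'n eterm = "'n pterm list"

definition eterms :: "nat \<Rightarrow> nat \<Rightarrow> ('n::linorder) eterm set" where
  "eterms q m =
     {L. length L = q \<and> (\<forall>u\<in>set L. tdeg u = m) \<and> sorted_wrt (\<lambda>a b. drl_less b a) L}"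

definition eterm_less :: "('n::linorder) eterm \<Rightarrow> 'n eterm \<Rightarrow> bool" where
  "eterm_less L M \<longleftrightarrow> length L = length M \<and>
     (\<exists>j<length L. (\<forall>i<j. L ! i = M ! i) \<and> drl_less (L ! j) (M ! j))"

definition vs :: "'n eterm \<Rightarrow> ('n, 'a::field) mpoly set" where
  "vs L = mpoly.span (monomial ` set L)"

section \<open>The action of the general linear group\<close>

definition field_embedding :: "('a::field \<Rightarrow> 'k::field) \<Rightarrow> bool" where
  "field_embedding \<iota> \<longleftrightarrow> \<iota> 1 = 1 \<and> (\<forall>x y. \<iota> (x + y) = \<iota> x + \<iota> y) \<and> (\<forall>x y. \<iota> (x * y) = \<iota> x * \<iota> y)"

text \<open>Matrices over $K$ act on polynomials over an extension field $\iota : K \to k$.\<close>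

type_synonym ('a, 'n) sqmat = "(('a, 'n) Finite_Cartesian_Product.vec, 'n) Finite_Cartesian_Product.vec"

definition gl_act ::
  "('a::field \<Rightarrow> 'k::field) \<Rightarrow> ('a, 'n) sqmat \<Rightarrow> ('n::finite, 'k) mpoly \<Rightarrow> ('n, 'k) mpoly" where
  "gl_act \<iota> g f = meval Const (\<lambda>i. \<Sum>j\<in>UNIV. Const (\<iota> (vec_nth (vec_nth g i) j)) * Var j) f"

definition borel_fixed :: "('n::{finite,linorder}, 'a::field) mpoly set \<Rightarrow> bool" where
  "borel_fixed I \<longleftrightarrow>
     (\<forall>g :: ('a, 'n) sqmat.
        invertible g \<and> (\<forall>i j. j < i \<longrightarrow> vec_nth (vec_nth g i) j = 0) \<longrightarrow> gl_act id g ` I = I)"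

section \<open>Grassmannian and Hilbert scheme\<close>

text \<open>The points with values in a field.\<close>

definition grassmannian :: "nat \<Rightarrow> nat \<Rightarrow> ('n::finite, 'a::field) mpoly set set" where
  "grassmannian q m = {V. mpoly.subspace V \<and> V \<subseteq> forms m \<and> mpoly.dim V = q}"

definition hilb :: "rat poly \<Rightarrow> nat \<Rightarrow> nat \<Rightarrow> ('n::finite, 'a::field) mpoly set set" where
  "hilb p q m = {V \<in> grassmannian q m. \<exists>I\<in>subscheme_ideals p. V = I \<inter> forms m}"

text \<open>
  The points of the scheme $\mathbb{P}(\wedge^q S_m)$ are the homogeneous prime ideals (not
  containing all variables) of the ring $K[\Delta_L]$, where $L$ runs through the elements of
  \<open>eterms q m\<close>.  If $k$ is an extension field of $K$, a point with values in $k$ and homogeneous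
  coordinates $c$ lies over the homogeneous prime ideal generated by the forms over $K$ which
  vanish at $c$.  For a \<open>q\<close>-dimensional subspace of $S_m \otimes k$ this does not depend on the basis
  used to compute the Pluecker coordinates, which only matters up to a common factor.
\<close>

definition pluecker_ring :: "nat \<Rightarrow> nat \<Rightarrow> ('n::linorder eterm, 'a::field) mpoly set" where
  "pluecker_ring q m = {F. \<forall>u\<in>Poly_Mapping.keys F. Poly_Mapping.keys u \<subseteq> eterms q m}"

definition pluecker :: "nat \<Rightarrow> (nat \<Rightarrow> ('n, 'k::field) mpoly) \<Rightarrow> 'n eterm \<Rightarrow> 'k" where
  "pluecker q b L = Determinant.det (Matrix.mat q q (\<lambda>(i, j). Poly_Mapping.lookup (b i) (L ! j)))"

definition pluecker_point ::
  "('a::field \<Rightarrow> 'k::field) \<Rightarrow> nat \<Rightarrow> nat \<Rightarrow> ('n::{finite,linorder}, 'k) mpoly set \<Rightarrow>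
   ('n eterm, 'a) mpoly set" where
  "pluecker_point \<iota> q m V =
     {F \<in> pluecker_ring q m.
        \<forall>b. inj_on b {..<q} \<and> mpoly.independent (b ` {..<q}) \<and> mpoly.span (b ` {..<q}) = V \<longrightarrow>
          (\<forall>d. meval \<iota> (pluecker q b) (hcomponent d F) = 0)}"

text \<open>
  A universal domain over $K$: an algebraically closed extension of infinite transcendence
  degree, which therefore contains (a copy of) the residue field of every point of a scheme of
  finite type over $K$.  It is used to enumerate the points of a scheme inside a fixed type.
\<close>

type_synonym 'a univ_domain = "(nat, 'a) mpoly fract alg_closure"

definition univ_embed :: "'a::field \<Rightarrow> 'a univ_domain" where
  "univ_embed c = to_ac (Fract (Const c) 1)"

text \<open>The set of all points (not only the closed or the rational ones) of the Hilbert scheme.\<close>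

definition hilb_points ::
  "rat poly \<Rightarrow> nat \<Rightarrow> nat \<Rightarrow> ('n::{finite,linorder} eterm, 'a::field) mpoly set set" where
  "hilb_points p q m =
     pluecker_point univ_embed q m ` (hilb p q m :: ('n, 'a univ_domain) mpoly set set)"

text \<open>The saturated ideal \<open>H\<close> over the extension field $\iota : K \to k$ defines the point \<open>y\<close>.\<close>

definition defines_point ::
  "('a::field \<Rightarrow> 'k::field) \<Rightarrow> rat poly \<Rightarrow> nat \<Rightarrow> nat \<Rightarrow> ('n::{finite,linorder}, 'k) mpoly set \<Rightarrow>
   ('n eterm, 'a) mpoly set \<Rightarrow> bool" where
  "defines_point \<iota> p q m H y \<longleftrightarrow>
     H \<in> subscheme_ideals p \<and> H \<inter> forms m \<in> grassmannian q m \<and>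
     pluecker_point \<iota> q m (H \<inter> forms m) = y"

section \<open>GL-stable subsets\<close>

definition hilb_closed ::
  "rat poly \<Rightarrow> nat \<Rightarrow> nat \<Rightarrow> ('n::{finite,linorder} eterm, 'a::field) mpoly set set \<Rightarrow> bool" where
  "hilb_closed p q m Y \<longleftrightarrow>
     (\<exists>E \<subseteq> pluecker_ring q m \<inter> (\<Union>d. forms d). Y = {y \<in> hilb_points p q m. E \<subseteq> y})"

text \<open>
  $\{g(V) : V \in Y, g \in GL\}$, where $V$ varies among the geometric points lying over
  points of \<open>Y\<close>.
\<close>

definition gl_orbit ::
  "nat \<Rightarrow> nat \<Rightarrow> ('n::{finite,linorder} eterm, 'a::field) mpoly set set \<Rightarrow>
   ('n eterm, 'a) mpoly set set" where
  "gl_orbit q m Y =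
     {pluecker_point univ_embed q m (gl_act univ_embed g ` V) | (g :: ('a, 'n) sqmat) V.
        invertible g \<and> V \<in> grassmannian q m \<and> pluecker_point univ_embed q m V \<in> Y}"

definition gl_stable_subset ::
  "rat poly \<Rightarrow> nat \<Rightarrow> nat \<Rightarrow> ('n::{finite,linorder} eterm, 'a::field) mpoly set set \<Rightarrow> bool" where
  "gl_stable_subset p q m Y \<longleftrightarrow>
     Y \<noteq> {} \<and> hilb_closed p q m Y \<and>
     (\<forall>A B. hilb_closed p q m A \<and> hilb_closed p q m B \<and> Y = A \<union> B \<longrightarrow> Y = A \<or> Y = B) \<and>
     gl_orbit q m Y \<subseteq> Y"

text \<open>The point \<open>y\<close> lies in the open subset $U_L$ iff $\Delta_L$ does not belong to the prime ideal \<open>y\<close>.\<close>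

definition open_chart :: "'n eterm \<Rightarrow> ('n eterm, 'a::field) mpoly set set" where
  "open_chart L = {y. Var L \<notin> y}"

definition gin ::
  "nat \<Rightarrow> nat \<Rightarrow> ('n::{finite,linorder} eterm, 'a::field) mpoly set set \<Rightarrow> 'n eterm" where
  "gin q m Y =
     (let T = {L \<in> eterms q m. open_chart L \<inter> gl_orbit q m Y \<noteq> {}}
      in THE L. L \<in> T \<and> (\<forall>M\<in>T. M = L \<or> eterm_less M L))"

definition double_gin ::
  "nat \<Rightarrow> nat \<Rightarrow> ('n::{finite,linorder} eterm, 'a::field) mpoly set set \<Rightarrow> ('n, 'a) mpoly set" where
  "double_gin q m Y = saturation (mideal.span (vs (gin q m Y)))"

end

theory Submission
  imports Defs
begin

text \<open>
  Let \<open>J\<close> be a saturated ideal with the given Hilbert polynomial such that $x_0$ is a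
  nonzerodivisor modulo \<open>J\<close>, for instance the saturation of a Borel-fixed ideal. Multiplication by
  $x_0^{m-t}$ identifies $J_t$ with the forms of $J_m$ divisible by $x_0^{m-t}$, and in degrevlex a
  form is divisible by a power of $x_0$ as soon as its leading term is. Hence $\dim J_t$ is the
  number of leading terms of $J_m$ whose exponent of $x_0$ is at least $m-t$; without the
  hypothesis on $x_0$ this number is an upper bound. It can only decrease if terms are replaced by
  larger ones. For $t \ge m$ the dimension is given by the Hilbert polynomial, by regularity.

  For a GL-stable \<open>Y\<close>, a given point can be moved by a matrix over the infinite field $K$ so that
  $x_0$ becomes a nonzerodivisor in the relevant degrees. The list \<open>M\<close> of its leading terms gives a
  Pluecker coordinate $\Delta_M$ that does not vanish at some point of \<open>Y\<close>. By irreducibility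
  $\Delta_M$ and $\Delta_L$, where \<open>L = gin(Y)\<close>, are both nonzero at some point of \<open>Y\<close>; the leading terms
  of that point are those of \<open>L\<close> by maximality, and therefore \<open>L\<close> has at most as many terms divisible by
  $x_0^{m-t}$ as \<open>M\<close>. Applied to a point with leading terms \<open>L\<close>, the same inequality forces its
  Hilbert function to be that of the double-generic initial ideal.
\<close>

text \<open>The regularity hypothesis speaks of ideals over K only, while the points of Y live over
  arbitrary extensions. For such points it is applied to the saturation of the initial ideal, a
  monomial ideal whose terms make sense over K. The resolution in the definition of regularity
  serves through two consequences: the Hilbert function is polynomial from degree r on, and the part
  of degree m generates everything above it.

  A second obstacle is that one point may be defined by an ideal over k and by another over the
  universal domain, with no map between the two fields at hand. What both share is the prime ideal
  of forms over K that vanish at their Pluecker coordinates, so a property passes from one to the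
  other once it is the nonvanishing of a single form over K. For that reason, and because GL is
  taken over K, the coordinate change must have entries in K. The candidates come from the moment
  curve, where Vandermonde replaces an argument with associated primes: it is enough to treat
  polynomials of degree below m, and these form a finite-dimensional space.\<close>

abbreviation lookup :: "('b \<Rightarrow>\<^sub>0 'c::zero) \<Rightarrow> 'b \<Rightarrow> 'c" where
  "lookup \<equiv> Poly_Mapping.lookup"

abbreviation keys :: "('b \<Rightarrow>\<^sub>0 'c::zero) \<Rightarrow> 'b set" where
  "keys \<equiv> Poly_Mapping.keys"

abbreviation single :: "'b \<Rightarrow> 'c \<Rightarrow> 'b \<Rightarrow>\<^sub>0 'c::zero" where
  "single \<equiv> Poly_Mapping.single"

section \<open>Linear algebra of monomials\<close>

text \<open>\<open>dim\<close> is the cardinality of a basis and therefore 0 for an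
  infinite-dimensional space, so monotonicity is available only inside a finite-dimensional
  one.\<close>

lemma (in vector_space) dim_mono_finite:
  assumes "A \<subseteq> B" "finite S" "B \<subseteq> span S"
  shows "dim A \<le> dim B"
proof -
  obtain C where C: "C \<subseteq> B" "independent C" "B \<subseteq> span C" "card C = dim B"
    by (rule basis_exists)
  have "finite C"
    using independent_span_bound[OF assms(2) C(2)] C(1) assms(3) by auto
  then show ?thesis using dim_le_card[of A C] C assms(1) by auto
qed

lemma (in vector_space) finite_basis_exists:
  assumes "finite S" "U \<subseteq> span S" "subspace U"
  obtains B where "B \<subseteq> U" "independent B" "finite B" "span B = U" "card B = dim U"
proof -
  obtain C where C: "C \<subseteq> U" "independent C" "U \<subseteq> span C" "card C = dim U"
    by (rule basis_exists)
  have "finite C"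
    using independent_span_bound[OF assms(1) C(2)] C(1) assms(2) by auto
  moreover have "span C = U" using C span_minimal assms(3) by blast
  ultimately show ?thesis using that C by blast
qed

lemma (in vector_space) subspace_eq_of_dim_le:
  assumes "subspace A" "subspace B" "A \<subseteq> B" "finite S" "B \<subseteq> span S" "dim B \<le> dim A"
  shows "A = B"
proof (rule ccontr)
  assume "A \<noteq> B"
  then obtain x where x: "x \<in> B" "x \<notin> A" using assms(3) by blast
  obtain C where C: "C \<subseteq> A" "independent C" "finite C" "span C = A" "card C = dim A"
    using finite_basis_exists[OF assms(4) _ assms(1)] assms(3,5) by blast
  have xC: "x \<notin> span C" using C(4) x by simp
  then have "independent (insert x C)" using C by (simp add: independent_insertI)
  moreover have "insert x C \<subseteq> span S" using C(1) assms(3,5) x by blast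
  moreover have "x \<notin> C" using xC span_base by blast
  ultimately have "card (insert x C) = dim A + 1" "dim (insert x C) = card (insert x C)"
    using C by (simp_all add: dim_eq_card_independent)
  moreover have "dim (insert x C) \<le> dim B"
    by (rule dim_mono_finite[OF _ assms(4,5)]) (use C(1) assms(3) x in blast)
  ultimately show False using assms(6) by simp
qed

text \<open>Relations are indexed by \<open>P\<close>, so a vector that occurs twice gives the
  relation with coefficients 1 and -1. This is why injectivity comes out together with
  independence.\<close>

lemma (in vector_space) independent_family:
  assumes "finite P" "\<And>u. (\<Sum>i\<in>P. scale (u i) (b i)) = 0 \<Longrightarrow> \<forall>i\<in>P. u i = 0"
  shows "inj_on b P" "independent (b ` P)"
proof -
  show inj: "inj_on b P"
  proof (rule inj_onI, rule ccontr)
    fix i j assume ij: "i \<in> P" "j \<in> P" "b i = b j" "i \<noteq> j"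
    let ?u = "\<lambda>k. if k = i then 1 :: 'a else if k = j then - 1 else 0"
    have "(\<Sum>k\<in>P. scale (?u k) (b k)) = (\<Sum>k\<in>{i,j}. scale (?u k) (b k))"
      by (rule sum.mono_neutral_right) (use assms(1) ij in auto)
    also have "\<dots> = 0" using ij by simp
    finally have "\<forall>k\<in>P. ?u k = 0" using assms(2)[of ?u] by simp
    then show False using ij by auto
  qed
  show "independent (b ` P)"
  proof (rule independent_if_scalars_zero)
    fix f x assume h: "(\<Sum>x\<in>b ` P. scale (f x) x) = 0" "x \<in> b ` P"
    have "(\<Sum>i\<in>P. scale (f (b i)) (b i)) = 0" using h(1) by (simp add: sum.reindex[OF inj])
    from assms(2)[of "\<lambda>i. f (b i)", OF this] show "f x = 0" using h(2) by auto
  qed (use assms(1) in auto)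
qed

text \<open>A basis of the kernel inside \<open>U\<close> is extended to a basis of
  \<open>U\<close>, and the added vectors map to a basis of the image. The form relative to
  \<open>U\<close> suits graded pieces of infinite-dimensional spaces.\<close>

lemma (in vector_space_pair) rank_nullity:
  assumes f: "Vector_Spaces.linear s1 s2 f" and "finite S" "U \<subseteq> vs1.span S" "vs1.subspace U"
  shows "vs1.dim U = vs1.dim {x\<in>U. f x = 0} + vs2.dim (f ` U)"
proof -
  interpret f: Vector_Spaces.linear s1 s2 f by fact
  let ?K = "{x\<in>U. f x = 0}"
  have sK: "vs1.subspace ?K" using assms(4)
    by (auto simp: vs1.subspace_def f.add f.scale)
  obtain C where C: "C \<subseteq> ?K" "vs1.independent C" "finite C" "vs1.span C = ?K" "card C = vs1.dim ?K"
    using vs1.finite_basis_exists[OF assms(2) _ sK] assms(3) by blast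
  obtain B where B: "C \<subseteq> B" "B \<subseteq> U" "vs1.independent B" "U \<subseteq> vs1.span B"
    using vs1.maximal_independent_subset_extend[of C U] C by blast
  have finB: "finite B"
    using vs1.independent_span_bound[OF assms(2) B(3)] B(2) assms(3) by auto
  have dU: "vs1.dim U = card B" using vs1.basis_card_eq_dim B by metis
  have spB: "vs1.span B = U" using B assms(4) vs1.span_minimal by blast
  let ?D = "B - C"
  have ind: "u i = 0" if h: "(\<Sum>x\<in>?D. s2 (u x) (f x)) = 0" and i: "i \<in> ?D" for u i
  proof -
    let ?x = "\<Sum>x\<in>?D. s1 (u x) x"
    have "f ?x = 0" using h by (simp add: f.sum f.scale)
    moreover have "?x \<in> U"
      using B(2) assms(4) by (intro vs1.subspace_sum vs1.subspace_scale) auto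
    ultimately have "?x \<in> vs1.span C" using C(4) by simp
    then obtain v where v: "?x = (\<Sum>x\<in>C. s1 (v x) x)"
      using vs1.span_finite[OF C(3)] by auto
    let ?w = "\<lambda>x. if x \<in> C then - v x else u x"
    have "(\<Sum>x\<in>B. s1 (?w x) x) = (\<Sum>x\<in>?D. s1 (?w x) x) + (\<Sum>x\<in>C. s1 (?w x) x)"
      using B(1) finB by (rule sum.subset_diff)
    also have "(\<Sum>x\<in>?D. s1 (?w x) x) = ?x" by (rule sum.cong) auto
    also have "(\<Sum>x\<in>C. s1 (?w x) x) = - (\<Sum>x\<in>C. s1 (v x) x)"
      by (simp add: sum_negf)
    finally have "(\<Sum>x\<in>B. s1 (?w x) x) = 0" by (simp only: v add.right_inverse)
    from vs1.independentD[OF B(3) finB subset_refl this, of i] have "?w i = 0"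
      using i by simp
    then show ?thesis using i by auto
  qed
  have inj: "inj_on f ?D" and indf: "vs2.independent (f ` ?D)"
    using vs2.independent_family[of ?D f] ind finB by (metis finite_Diff)+
  have "f ` U \<subseteq> vs2.span (f ` ?D)"
  proof -
    have "f ` U = vs2.span (f ` B)" using spB f.span_image by metis
    moreover have "f ` B \<subseteq> insert 0 (f ` ?D)" using C(1) by auto
    ultimately show ?thesis by (metis vs2.span_insert_0 vs2.span_mono)
  qed
  moreover have "f ` ?D \<subseteq> f ` U" using B(2) by auto
  ultimately have "vs2.dim (f ` U) = card (f ` ?D)"
    using indf vs2.basis_card_eq_dim by metis
  also have "\<dots> = card B - card C" using inj B(1) finB C(3)
    by (simp add: card_image card_Diff_subset)
  finally show ?thesis using dU C(5) card_mono[OF finB B(1)] by simp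
qed

lemma (in vector_space_pair) dim_image_inj:
  assumes f: "Vector_Spaces.linear s1 s2 f" and "finite S" "U \<subseteq> vs1.span S" "vs1.subspace U"
    and "\<And>x. x \<in> U \<Longrightarrow> f x = 0 \<Longrightarrow> x = 0"
  shows "vs2.dim (f ` U) = vs1.dim U"
proof -
  interpret f: Vector_Spaces.linear s1 s2 f by fact
  have "{x\<in>U. f x = 0} = {0}" using assms(4,5) f.zero by (auto simp: vs1.subspace_def)
  then have "vs1.dim {x\<in>U. f x = 0} = 0"
    using vs1.dim_eq_card[of "{}" "{0}"] by (simp add: vs1.independent_empty)
  then show ?thesis using rank_nullity[OF assms(1-4)] by simp
qed

section \<open>Terms, their degrees, and coefficients of products\<close>

lemma tdeg_eq_sum:
  fixes u :: "'n::finite pterm"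
  shows "tdeg u = (\<Sum>v\<in>UNIV. lookup u v)"
  unfolding tdeg_def by (rule sum.mono_neutral_left) (auto simp: in_keys_iff)

lemma tdeg_add [simp]: "tdeg (u + v) = tdeg u + tdeg v"
proof -
  let ?K = "keys u \<union> keys v"
  have *: "tdeg w = (\<Sum>i\<in>?K. lookup w i)" if "keys w \<subseteq> ?K" for w :: "'a pterm"
    unfolding tdeg_def by (rule sum.mono_neutral_left) (use that in \<open>auto simp: in_keys_iff\<close>)
  show ?thesis
    by (subst (1 2 3) *) (auto simp: lookup_add sum.distrib in_keys_iff)
qed

lemma tdeg_zero [simp]: "tdeg 0 = 0" by (simp add: tdeg_def)

lemma tdeg_single [simp]: "tdeg (single v k) = k" by (simp add: tdeg_def)

lemma lookup_le_tdeg: "lookup u v \<le> tdeg u"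
proof (cases "v \<in> keys u")
  case True
  then show ?thesis unfolding tdeg_def
    by (intro member_le_sum) auto
qed (simp add: in_keys_iff)

lemma tdeg_eq_0_iff [simp]: "tdeg u = 0 \<longleftrightarrow> u = 0"
  by (metis le_zero_eq lookup_le_tdeg lookup_zero poly_mapping_eqI tdeg_zero)

lemma pterm_eq_add_minus:
  assumes "\<And>i. lookup w i \<le> lookup v i"
  shows "v = w + (v - w :: 'n pterm)"
  by (rule poly_mapping_eqI) (use assms in \<open>simp add: lookup_add lookup_minus\<close>)

lemma finite_tdeg [simp]: "finite {u :: 'n::finite pterm. tdeg u = d}"
proof -
  have "finite {f :: 'n \<Rightarrow> nat. f \<in> UNIV \<rightarrow> {..d}}"
    using finite_PiE[of "UNIV :: 'n set" "\<lambda>_. {..d}"] by (simp add: PiE_def)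
  moreover have "lookup ` {u :: 'n pterm. tdeg u = d} \<subseteq> {f. f \<in> UNIV \<rightarrow> {..d}}"
    using lookup_le_tdeg by fastforce
  ultimately show ?thesis
    by (metis (no_types, lifting) finite_imageD finite_subset inj_onI poly_mapping_eqI)
qed

lemma finite_tdeg_less [simp]: "finite {u :: 'n::finite pterm. tdeg u < d}"
proof -
  have "{u :: 'n::finite pterm. tdeg u < d} = (\<Union>k<d. {u. tdeg u = k})" by auto
  then show ?thesis by simp
qed

lemma lookup_Const_mult [simp]:
  "lookup (Const c * f) u = (c :: 'a::comm_ring_1) * lookup f u"
  unfolding Const_def lookup_mult
  by (simp add: lookup_single when_mult)

lemma lookup_mscale [simp]: "lookup (mscale c f) u = c * lookup f u"
  by (simp add: mscale_def)

lemma lookup_monomial: "lookup (monomial u) v = (if u = v then 1 else 0)"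
  by (simp add: monomial_def lookup_single when_def)

lemma lookup_monomial_mult:
  fixes f :: "('v, 'a::comm_ring_1) mpoly"
  shows "lookup (monomial w * f) v = (if \<exists>u. v = w + u then lookup f (v - w) else 0)"
proof -
  have "lookup (monomial w * f) v = (\<Sum>q. lookup f q when v = w + q)"
    unfolding monomial_def lookup_mult by (simp add: lookup_single when_mult)
  also have "\<dots> = (if \<exists>u. v = w + u then lookup f (v - w) else 0)"
  proof (cases "\<exists>u. v = w + u")
    case True
    then obtain u where u: "v = w + u" by blast
    have "(\<lambda>q. lookup f q when v = w + q) = (\<lambda>q. lookup f q when q = u)"
      using u by (auto simp: when_def)
    then show ?thesis using u by auto
  qed auto
  finally show ?thesis .
qed

lemma lookup_monomial_mult_add [simp]:
  fixes f :: "('v, 'a::comm_ring_1) mpoly"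
  shows "lookup (monomial w * f) (w + u) = lookup f u"
  by (auto simp: lookup_monomial_mult)

lemma keys_monomial_mult:
  fixes f :: "('v, 'a::comm_ring_1) mpoly"
  shows "keys (monomial w * f) = (+) w ` keys f"
  by (force simp: in_keys_iff lookup_monomial_mult split: if_splits)

lemma monomial_mult: "monomial u * monomial v = (monomial (u + v) :: ('v, 'a::comm_ring_1) mpoly)"
  by (simp add: monomial_def mult_single)

lemma monomial_0 [simp]: "monomial 0 = (1 :: ('v, 'a::comm_ring_1) mpoly)"
  by (simp add: monomial_def)

lemma monomial_mult_eq_0 [simp]:
  fixes f :: "('v, 'a::comm_ring_1) mpoly"
  shows "monomial w * f = 0 \<longleftrightarrow> f = 0"
proof
  assume "monomial w * f = 0"
  then have "lookup f u = 0" for u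
    by (metis lookup_monomial_mult_add lookup_zero)
  then show "f = 0" by (simp add: poly_mapping_eqI)
qed simp

lemma mscale_monomial: "mscale c (monomial u) = single u (c :: 'a::comm_ring_1)"
  by (simp add: mscale_def Const_def monomial_def mult_single)

lemma sum_single_lookup:
  assumes "finite A" "keys f \<subseteq> A"
  shows "(\<Sum>u\<in>A. single u (lookup f u)) = f"
proof (rule poly_mapping_eqI)
  fix k
  have "lookup (\<Sum>u\<in>A. single u (lookup f u)) k =
      (\<Sum>u\<in>A. if u = k then lookup f u else 0)"
    by (simp add: lookup_sum lookup_single when_def)
  also have "\<dots> = lookup f k"
    using assms by (auto simp: in_keys_iff)
  finally show "lookup (\<Sum>u\<in>A. single u (lookup f u)) k = lookup f k" .
qed

lemma sum_mscale_monomial: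
  fixes f :: "('v, 'a::comm_ring_1) mpoly"
  assumes "finite A" "keys f \<subseteq> A"
  shows "(\<Sum>u\<in>A. mscale (lookup f u) (monomial u)) = f"
  using sum_single_lookup[OF assms] by (simp add: mscale_monomial)

lemma keys_mscale: "keys (mscale c f) \<subseteq> keys f"
  by (auto simp: in_keys_iff)

text \<open>Spans of terms and monomial ideals (\<open>A\<close> closed under multiples) both have
  this form, so inclusions and dimensions become inclusions and cardinalities of sets of
  terms.\<close>

definition supported :: "'v pterm set \<Rightarrow> ('v, 'a::zero) mpoly set" where
  "supported A = {f. keys f \<subseteq> A}"

lemma forms_eq_supported: "forms d = supported {u. tdeg u = d}"
  by (auto simp: forms_def supported_def)

lemma supported_Int: "supported A \<inter> supported B = supported (A \<inter> B)"
  by (auto simp: supported_def)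

lemma supported_mono: "A \<subseteq> B \<Longrightarrow> supported A \<subseteq> supported B"
  by (auto simp: supported_def)

lemma subspace_supported [simp]: "mpoly.subspace (supported A :: ('v, 'a::field) mpoly set)"
proof -
  have "keys (x + y) \<subseteq> A"
    if "keys x \<subseteq> A" "keys y \<subseteq> A" for x y :: "('v, 'a) mpoly"
    using keys_add[of x y] that by blast
  moreover have "keys (mscale c x) \<subseteq> A"
    if "keys x \<subseteq> A" for c and x :: "('v, 'a) mpoly"
    using keys_mscale[of c x] that by blast
  ultimately show ?thesis by (auto simp: mpoly.subspace_def supported_def)
qed

lemma subspace_forms [simp]: "mpoly.subspace (forms d :: ('v, 'a::field) mpoly set)"
  by (simp add: forms_eq_supported)

lemma monomial_in_supported [simp]:
  "(monomial u :: ('v, 'a::zero_neq_one) mpoly) \<in> supported A \<longleftrightarrow> u \<in> A"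
  by (simp add: supported_def monomial_def)

lemma span_monomials: "mpoly.span (monomial ` A) = (supported A :: ('v, 'a::field) mpoly set)"
proof
  show "mpoly.span (monomial ` A) \<subseteq> (supported A :: ('v, 'a::field) mpoly set)"
    by (rule mpoly.span_minimal) auto
  show "(supported A :: ('v, 'a::field) mpoly set) \<subseteq> mpoly.span (monomial ` A)"
  proof
    fix f :: "('v, 'a) mpoly" assume f: "f \<in> supported A"
    have "(\<Sum>u\<in>keys f. mscale (lookup f u) (monomial u)) \<in> mpoly.span (monomial ` A)"
      using f by (intro mpoly.span_sum mpoly.span_scale mpoly.span_base) (auto simp: supported_def)
    then show "f \<in> mpoly.span (monomial ` A)" by (simp add: sum_mscale_monomial)
  qed
qed

lemma independent_monomials:
  assumes "finite A"
  shows "inj_on (monomial :: _ \<Rightarrow> ('v, 'a::field) mpoly) A"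
    "mpoly.independent (monomial ` A :: ('v, 'a::field) mpoly set)"
proof -
  have *: "\<forall>i\<in>A. c i = 0" if "(\<Sum>i\<in>A. mscale (c i) (monomial i :: ('v, 'a) mpoly)) = 0" for c
  proof
    fix i assume "i \<in> A"
    have "lookup (\<Sum>i\<in>A. mscale (c i) (monomial i :: ('v, 'a) mpoly)) i
       = (\<Sum>j\<in>A. if j = i then c j else 0)"
      by (simp add: lookup_sum lookup_monomial if_distrib cong: if_cong)
    then show "c i = 0" using that \<open>i \<in> A\<close> assms by simp
  qed
  show "inj_on (monomial :: _ \<Rightarrow> ('v, 'a::field) mpoly) A"
    "mpoly.independent (monomial ` A :: ('v, 'a::field) mpoly set)"
    using mpoly.independent_family[OF assms, of monomial] * by metis+
qed

lemma dim_supported [simp]: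
  assumes "finite A"
  shows "mpoly.dim (supported A :: ('v, 'a::field) mpoly set) = card A"
  using independent_monomials[OF assms, where 'a='a]
  by (metis card_image mpoly.dim_span_eq_card_independent span_monomials)

lemma dim_forms: "mpoly.dim (forms d :: ('n::finite, 'a::field) mpoly set) = card {u :: 'n pterm. tdeg u = d}"
  by (simp add: forms_eq_supported)

lemma dim_mono_supported:
  fixes U V :: "('v, 'a::field) mpoly set"
  assumes "U \<subseteq> V" "V \<subseteq> supported A" "finite A"
  shows "mpoly.dim U \<le> mpoly.dim V"
  using mpoly.dim_mono_finite[OF assms(1), of "monomial ` A"] assms by (simp add: span_monomials)

lemma dim_mono_forms:
  fixes U V :: "('n::finite, 'a::field) mpoly set"
  assumes "U \<subseteq> V" "V \<subseteq> forms d"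
  shows "mpoly.dim U \<le> mpoly.dim V"
  using dim_mono_supported[OF assms(1)] assms(2) by (simp add: forms_eq_supported)

lemma subspace_eq_supported:
  fixes U V :: "('v, 'a::field) mpoly set"
  assumes "U \<subseteq> V" "V \<subseteq> supported A" "finite A" "mpoly.subspace U" "mpoly.subspace V"
    "mpoly.dim V \<le> mpoly.dim U"
  shows "U = V"
  using mpoly.subspace_eq_of_dim_le[OF assms(4,5,1), of "monomial ` A"] assms by (simp add: span_monomials)

lemma vector_space_pair_mscale: "vector_space_pair (mscale :: 'a::field \<Rightarrow> ('v, 'a) mpoly \<Rightarrow> _) (mscale :: 'a \<Rightarrow> ('w, 'a) mpoly \<Rightarrow> _)"
  by (simp add: vector_space_pair_def mpoly.vector_space_axioms)

lemma linear_mscaleI: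
  assumes "\<And>x y. f (x + y) = f x + f y" "\<And>c x. f (mscale c x) = mscale c (f x)"
  shows "Vector_Spaces.linear mscale mscale (f :: ('v, 'a::field) mpoly \<Rightarrow> ('w, 'a) mpoly)"
  by (intro Vector_Spaces.linear.intro module_hom.intro module_hom_axioms.intro
      mpoly.vector_space_axioms mpoly.module_axioms assms)

lemma dim_image_inj_supported:
  fixes U :: "('v, 'a::field) mpoly set"
  assumes "Vector_Spaces.linear mscale mscale f" "U \<subseteq> supported A" "finite A" "mpoly.subspace U"
    "\<And>x. x \<in> U \<Longrightarrow> f x = 0 \<Longrightarrow> x = 0"
  shows "mpoly.dim (f ` U) = mpoly.dim U"
proof (rule vector_space_pair.dim_image_inj[OF vector_space_pair_mscale assms(1)])
  show "finite (monomial ` A :: ('v, 'a) mpoly set)" using assms(3) by simp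
  show "U \<subseteq> mpoly.span (monomial ` A)" using assms(2) by (simp only: span_monomials)
qed (use assms(4,5) in auto)

section \<open>Saturation and monomial ideals\<close>

\<comment> \<open>loops together with \<open>algebra_simps\<close>, which associates products the other way\<close>
declare mideal.scale_scale [simp del]

lemma ideal_subspace:
  fixes I :: "('v, 'a::field) mpoly set"
  assumes "mideal.subspace I"
  shows "mpoly.subspace I"
  using assms by (auto simp: mpoly.subspace_def mideal.subspace_def mscale_def)

lemma tdeg_split:
  assumes "tdeg u = k + l"
  obtains v w where "u = v + w" "tdeg v = k" "tdeg w = l"
proof -
  have "\<exists>v w. u = v + w \<and> tdeg v = k \<and> tdeg w = l"
    using assms
  proof (induction k arbitrary: u)
    case 0
    then show ?case by (intro exI[of _ 0] exI[of _ u]) auto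
  next
    case (Suc k)
    then have "u \<noteq> 0" by auto
    then obtain i where i: "lookup u i \<noteq> 0" by (metis lookup_zero poly_mapping_eqI)
    let ?e = "single i (1::nat)"
    have u: "u = ?e + (u - ?e)"
      by (rule pterm_eq_add_minus) (use i in \<open>auto simp: lookup_single when_def\<close>)
    then have "tdeg u = 1 + tdeg (u - ?e)" by (metis tdeg_add tdeg_single)
    then have "tdeg (u - ?e) = k + l" using Suc.prems by simp
    from Suc.IH[OF this] obtain v w where vw: "u - ?e = v + w" "tdeg v = k" "tdeg w = l" by blast
    then have "u = (?e + v) + w" using u by (simp add: add.assoc)
    then show ?case using vw by (intro exI[of _ "?e + v"] exI[of _ w]) auto
  qed
  then show ?thesis using that by blast
qed

lemma ideal_generated_mult:
  fixes A B :: "('v, 'a::comm_ring_1) mpoly set"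
  shows "ideal_mult (mideal.span A) (mideal.span B) = mideal.span {a * b | a b. a \<in> A \<and> b \<in> B}"
    (is "_ = mideal.span ?C")
proof
  have *: "f * g \<in> mideal.span ?C" if f: "f \<in> mideal.span A" and g: "g \<in> mideal.span B" for f g
    using f
  proof (induction rule: mideal.span_induct_alt)
    case (step c x y)
    have "x * g \<in> mideal.span ?C"
      using g
    proof (induction rule: mideal.span_induct_alt)
      case (step d y z)
      have "x * y \<in> mideal.span ?C" using step(1) \<open>x \<in> A\<close> by (intro mideal.span_base) auto
      then have "d * (x * y) + x * z \<in> mideal.span ?C"
        by (rule mideal.span_add[OF mideal.span_scale step(2)])
      moreover have "x * (d * y + z) = d * (x * y) + x * z" by (simp add: algebra_simps)
      ultimately show ?case by (simp only:)
    qed (simp add: mideal.span_zero)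
    then have "c * (x * g) + y * g \<in> mideal.span ?C"
      by (rule mideal.span_add[OF mideal.span_scale step(2)])
    moreover have "(c * x + y) * g = c * (x * g) + y * g" by (simp add: algebra_simps)
    ultimately show ?case by (simp only:)
  qed (simp add: mideal.span_zero)
  show "ideal_mult (mideal.span A) (mideal.span B) \<subseteq> mideal.span ?C"
    unfolding ideal_mult_def by (rule mideal.span_minimal) (use * in \<open>auto simp: mideal.subspace_span\<close>)
  show "mideal.span ?C \<subseteq> ideal_mult (mideal.span A) (mideal.span B)"
    unfolding ideal_mult_def by (rule mideal.span_mono) (auto intro: mideal.span_base)
qed

text \<open>With these generators, membership in a saturation becomes a condition on products with
  the terms of a single degree, see \<open>in_saturation_iff\<close>.\<close>

lemma irrelevant_pow:
  "ideal_pow irrelevant_ideal k =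
     (mideal.span (monomial ` {u. tdeg u = k}) :: ('v, 'a::comm_ring_1) mpoly set)"
proof (induction k)
  case 0
  have "f \<in> mideal.span {1}" for f :: "('v, 'a) mpoly"
    using mideal.span_scale[OF mideal.span_base, of 1 "{1}" f] by simp
  moreover have "monomial ` {u :: 'v pterm. tdeg u = 0} = {1 :: ('v, 'a) mpoly}" by auto
  ultimately show ?case by (simp only: ideal_pow.simps) auto
next
  case (Suc k)
  have "{a * b | a b. a \<in> range Var \<and> b \<in> monomial ` {u. tdeg u = k}} =
      (monomial ` {u :: 'v pterm. tdeg u = Suc k} :: ('v, 'a) mpoly set)" (is "?L = ?R")
  proof (rule equalityI; rule subsetI)
    fix f assume "f \<in> ?L"
    then show "f \<in> ?R" by (auto simp: Var_def monomial_mult)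
  next
    fix f assume "f \<in> ?R"
    then obtain u where u: "f = monomial u" "tdeg u = 1 + k" by auto
    obtain v w where vw: "u = v + w" "tdeg v = 1" "tdeg w = k"
      using tdeg_split[OF u(2)] by blast
    then obtain i where i: "lookup v i \<noteq> 0"
      by (metis lookup_zero poly_mapping_eqI tdeg_zero zero_neq_one)
    have v: "v = single i 1 + (v - single i 1)"
      by (rule pterm_eq_add_minus) (use i in \<open>auto simp: lookup_single when_def\<close>)
    then have "tdeg v = 1 + tdeg (v - single i 1)" by (metis tdeg_add tdeg_single)
    then have "v = single i 1" using vw v by simp
    then have "f = Var i * monomial w" using u vw by (simp add: Var_def monomial_mult)
    then show "f \<in> ?L" using vw by blast
  qed
  then show ?case
    unfolding ideal_pow.simps Suc.IH by (simp add: ideal_generated_mult irrelevant_ideal_def)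
qed

lemma in_saturation_iff:
  assumes I: "mideal.subspace (I :: ('v, 'a::comm_ring_1) mpoly set)"
  shows "f \<in> saturation I \<longleftrightarrow> (\<exists>k. \<forall>w. tdeg w = k \<longrightarrow> f * monomial w \<in> I)"
proof -
  have "f \<in> colon I (ideal_pow irrelevant_ideal k) \<longleftrightarrow> (\<forall>w. tdeg w = k \<longrightarrow> f * monomial w \<in> I)" for k
  proof
    assume h: "\<forall>w. tdeg w = k \<longrightarrow> f * monomial w \<in> I"
    have "f * g \<in> I" if "g \<in> mideal.span (monomial ` {u. tdeg u = k})" for g
      using that
    proof (induction rule: mideal.span_induct_alt)
      case base
      then show ?case using mideal.subspace_0[OF I] by simp
    next
      case (step c x y)
      have "f * x \<in> I" using step(1) h by auto
      then have "c * (f * x) + f * y \<in> I"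
        by (rule mideal.subspace_add[OF I mideal.subspace_scale[OF I] step(2)])
      moreover have "f * (c * x + y) = c * (f * x) + f * y" by (simp add: algebra_simps)
      ultimately show ?case by (simp only:)
    qed
    then show "f \<in> colon I (ideal_pow irrelevant_ideal k)" by (simp add: colon_def irrelevant_pow)
  qed (auto simp: colon_def irrelevant_pow intro: mideal.span_base)
  then show ?thesis by (simp add: saturation_def)
qed

lemma saturation_mono:
  assumes "mideal.subspace I" "mideal.subspace J" "I \<subseteq> J"
  shows "saturation I \<subseteq> saturation J"
  using assms by (simp add: in_saturation_iff subset_iff) blast

section \<open>Monomial ideals as up-closed sets of terms\<close>

definition upclosed :: "'v pterm set \<Rightarrow> bool" where
  "upclosed T \<longleftrightarrow> (\<forall>u\<in>T. \<forall>w. u + w \<in> T)"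

text \<open>Saturation of a monomial ideal expressed through its terms. No coefficient field occurs,
  which allows an initial ideal over an extension field to be reread over the ground field.\<close>

definition satT :: "'v pterm set \<Rightarrow> 'v pterm set" where
  "satT T = {u. \<exists>k. \<forall>w. tdeg w = k \<longrightarrow> u + w \<in> T}"

lemma upclosed_mult_of_degree_ge:
  assumes "upclosed T" "\<forall>w. tdeg w = k \<longrightarrow> u + w \<in> T" "k \<le> tdeg v"
  shows "u + v \<in> T"
proof -
  obtain x y where "v = x + y" "tdeg x = k"
    using tdeg_split[of v k "tdeg v - k"] assms(3) by auto
  then show ?thesis using assms(1,2) by (metis add.assoc upclosed_def)
qed

lemma keys_mult_subset_upclosed:
  fixes f g :: "('v, 'a::comm_ring_1) mpoly"
  assumes "upclosed T" "keys f \<subseteq> T"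
  shows "keys (g * f) \<subseteq> T"
  using keys_mult[of f g] assms by (fastforce simp: upclosed_def mult.commute)

lemma ideal_supported:
  assumes "upclosed T"
  shows "mideal.subspace (supported T :: ('v, 'a::comm_ring_1) mpoly set)"
  unfolding mideal.subspace_def supported_def mem_Collect_eq
proof (intro conjI ballI allI)
  fix x y :: "('v, 'a) mpoly" assume "x \<in> {f. keys f \<subseteq> T}" "y \<in> {f. keys f \<subseteq> T}"
  then show "keys (x + y) \<subseteq> T" using keys_add[of x y] by blast
next
  fix c x :: "('v, 'a) mpoly" assume "x \<in> {f. keys f \<subseteq> T}"
  then show "keys (c * x) \<subseteq> T" using keys_mult_subset_upclosed[OF assms] by simp
qed simp

lemma ideal_generated_monomials:
  "mideal.span (monomial ` A) =
     (supported {a + w | a w. a \<in> A} :: ('v, 'a::comm_ring_1) mpoly set)" (is "?L = supported ?U")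
proof
  have up: "upclosed ?U" by (force simp: upclosed_def add.assoc)
  have "a \<in> ?U" if "a \<in> A" for a using that by (metis (mono_tags, lifting) add.right_neutral mem_Collect_eq)
  then show "?L \<subseteq> supported ?U"
    by (intro mideal.span_minimal ideal_supported up) auto
  show "supported ?U \<subseteq> ?L"
  proof
    fix f :: "('v, 'a) mpoly" assume f: "f \<in> supported ?U"
    have "monomial u \<in> ?L" if u: "u \<in> keys f" for u
    proof -
      obtain a w where "u = w + a" "a \<in> A" using f u by (auto simp: supported_def add.commute)
      then show ?thesis
        by (metis image_eqI mideal.span_base mideal.span_scale monomial_mult)
    qed
    then have "(\<Sum>u\<in>keys f. mscale (lookup f u) (monomial u)) \<in> ?L"
      unfolding mscale_def by (intro mideal.span_sum mideal.span_scale)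
    then show "f \<in> ?L" by (simp add: sum_mscale_monomial)
  qed
qed

lemma ideal_generated_supported:
  "mideal.span (supported A) =
     (supported {a + w | a w. a \<in> A} :: ('v, 'a::comm_ring_1) mpoly set)" (is "_ = supported ?U")
proof
  have up: "upclosed ?U" by (force simp: upclosed_def add.assoc)
  have "A \<subseteq> ?U" by (force intro: exI[of _ 0])
  then show "mideal.span (supported A) \<subseteq> (supported ?U :: ('v, 'a) mpoly set)"
    by (intro mideal.span_minimal ideal_supported up supported_mono)
  have "mideal.span (monomial ` A) \<subseteq> mideal.span (supported A :: ('v, 'a) mpoly set)"
    by (rule mideal.span_mono) auto
  then show "(supported ?U :: ('v, 'a) mpoly set) \<subseteq> mideal.span (supported A)"
    by (simp only: ideal_generated_monomials)
qed

lemma saturation_supported: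
  assumes T: "upclosed T"
  shows "saturation (supported T) = (supported (satT T) :: ('v, 'a::comm_ring_1) mpoly set)"
proof (rule equalityI; rule subsetI)
  fix f :: "('v, 'a) mpoly"
  assume "f \<in> saturation (supported T)"
  then obtain k where k: "\<And>w. tdeg w = k \<Longrightarrow> f * monomial w \<in> supported T"
    using in_saturation_iff[OF ideal_supported[OF T]] by blast
  then have "u + w \<in> T" if "u \<in> keys f" "tdeg w = k" for u w
    using that by (fastforce simp: supported_def keys_monomial_mult mult.commute[of f] add.commute[of u])
  then show "f \<in> supported (satT T)" by (auto simp: supported_def satT_def)
next
  fix f :: "('v, 'a) mpoly"
  assume f: "f \<in> supported (satT T)"
  then have "\<forall>u\<in>keys f. \<exists>k. \<forall>w. tdeg w = k \<longrightarrow> u + w \<in> T" by (auto simp: supported_def satT_def)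
  then obtain k where k: "\<forall>u\<in>keys f. \<forall>w. tdeg w = k u \<longrightarrow> u + w \<in> T" by metis
  \<comment> \<open>The sum serves as a common upper bound of the finitely many exponents; enlarging
    an exponent is harmless by \<open>upclosed_mult_of_degree_ge\<close>.\<close>
  let ?k = "\<Sum>u\<in>keys f. k u"
  have "u + w \<in> T" if "u \<in> keys f" "tdeg w = ?k" for u w
    by (rule upclosed_mult_of_degree_ge[OF T, of "k u"]) (use k that in \<open>auto intro: member_le_sum\<close>)
  then have "f * monomial w \<in> supported T" if "tdeg w = ?k" for w
    using that by (auto simp: supported_def keys_monomial_mult mult.commute[of f] add.commute[of w])
  then show "f \<in> saturation (supported T)"
    using in_saturation_iff[OF ideal_supported[OF T]] by blast
qed

lemma upclosed_satT: "upclosed T \<Longrightarrow> upclosed (satT T)"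
proof -
  assume T: "upclosed T"
  have "u + v + w \<in> T" if "u + w \<in> T" for u v w
  proof -
    have "(u + w) + v \<in> T" using T that by (auto simp: upclosed_def)
    then show ?thesis by (simp add: add.assoc add.commute add.left_commute)
  qed
  then show ?thesis unfolding upclosed_def satT_def by blast
qed

lemma subset_satT: "upclosed T \<Longrightarrow> T \<subseteq> satT T"
  by (auto simp: upclosed_def satT_def)

text \<open>Only finitely many terms have degree k, so their individual exponents have a common
  bound, again the sum. A term of degree k plus this bound is split accordingly.\<close>

lemma satT_satT:
  assumes T: "upclosed (T :: 'n::finite pterm set)"
  shows "satT (satT T) = satT T"
proof
  show "satT T \<subseteq> satT (satT T)" by (rule subset_satT[OF upclosed_satT[OF T]])
  show "satT (satT T) \<subseteq> satT T"
  proof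
    fix u assume "u \<in> satT (satT T)"
    then obtain k where "\<forall>w. tdeg w = k \<longrightarrow> u + w \<in> satT T" by (auto simp: satT_def)
    then have "\<forall>w. \<exists>l. tdeg w = k \<longrightarrow> (\<forall>v. tdeg v = l \<longrightarrow> (u + w) + v \<in> T)" by (auto simp: satT_def)
    then obtain l where l: "\<And>w v. tdeg w = k \<Longrightarrow> tdeg v = l w \<Longrightarrow> (u + w) + v \<in> T" by metis
    let ?l = "\<Sum>w\<in>{w. tdeg w = k}. l w"
    have "u + w \<in> T" if w: "tdeg w = k + ?l" for w
    proof -
      obtain x y where xy: "w = x + y" "tdeg x = k" "tdeg y = ?l" by (rule tdeg_split[OF w])
      have "(u + x) + y \<in> T"
        by (rule upclosed_mult_of_degree_ge[OF T, of "l x"]) (use xy l in \<open>auto intro: member_le_sum\<close>)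
      then show ?thesis using xy by (simp add: add.assoc)
    qed
    then show "u \<in> satT T" by (auto simp: satT_def)
  qed
qed

section \<open>Homogeneous components\<close>

lemma lookup_hcomponent: "lookup (hcomponent d f) u = (if tdeg u = d then lookup f u else 0)"
proof -
  have "lookup (hcomponent d f) u = (\<Sum>v\<in>{v\<in>keys f. tdeg v = d}. if v = u then lookup f v else 0)"
    by (simp add: hcomponent_def lookup_sum lookup_single when_def)
  then show ?thesis by (auto simp: in_keys_iff)
qed

lemma hcomponent_add: "hcomponent d (f + g) = hcomponent d f + hcomponent d g"
  by (rule poly_mapping_eqI) (simp add: lookup_hcomponent lookup_add)

lemma hcomponent_forms [simp]: "hcomponent d f \<in> forms d"
  by (auto simp: forms_def in_keys_iff lookup_hcomponent split: if_splits)

lemma hcomponent_of_form: "f \<in> forms e \<Longrightarrow> hcomponent d f = (if d = e then f else 0)"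
  by (rule poly_mapping_eqI) (auto simp: forms_def lookup_hcomponent in_keys_iff)

lemma sum_hcomponents: "(\<Sum>d\<in>tdeg ` keys f. hcomponent d f) = f"
proof (rule poly_mapping_eqI)
  fix u
  have "lookup (\<Sum>d\<in>tdeg ` keys f. hcomponent d f) u =
    (\<Sum>d\<in>tdeg ` keys f. if d = tdeg u then lookup f u else 0)"
    unfolding lookup_sum by (rule sum.cong) (auto simp: lookup_hcomponent)
  also have "\<dots> = lookup f u" by (auto simp: in_keys_iff)
  finally show "lookup (\<Sum>d\<in>tdeg ` keys f. hcomponent d f) u = lookup f u" .
qed

lemma hcomponent_Const_mult:
  fixes f :: "('v, 'a::comm_ring_1) mpoly"
  shows "hcomponent d (Const c * f) = Const c * hcomponent d f"
  by (rule poly_mapping_eqI) (simp add: lookup_hcomponent)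

lemma hcomponent_monomial_mult:
  fixes f :: "('v, 'a::comm_ring_1) mpoly"
  shows "hcomponent d (monomial w * f) = (if tdeg w \<le> d then monomial w * hcomponent (d - tdeg w) f else 0)"
  by (rule poly_mapping_eqI) (auto simp: lookup_hcomponent lookup_monomial_mult)

text \<open>In the span induction the coefficient \<open>c\<close> is expanded into its terms:
  multiplication by a single term only shifts degrees, so the components of each product are again
  multiples of forms in \<open>I\<close>.\<close>

lemma hcomponent_in_ideal:
  fixes I :: "('v, 'a::comm_ring_1) mpoly set"
  assumes "homogeneous_ideal I" "f \<in> I"
  shows "hcomponent d f \<in> I"
proof -
  have I: "mideal.subspace I" and sp: "mideal.span (\<Union>d. I \<inter> forms d) = I"
    using assms(1) by (auto simp: homogeneous_ideal_def)
  have "f \<in> mideal.span (\<Union>d. I \<inter> forms d)" using assms(2) sp by simp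
  then have "\<forall>d. hcomponent d f \<in> I"
  proof (induction rule: mideal.span_induct_alt)
    case base
    have "hcomponent d (0 :: ('v, 'a) mpoly) = 0" for d by (simp add: hcomponent_def)
    then show ?case using mideal.subspace_0[OF I] by simp
  next
    case (step c x y)
    have x: "hcomponent d x \<in> I" for d
      using step(1) hcomponent_of_form mideal.subspace_0[OF I] by (metis (no_types, lifting) IntE UN_E)
    have "hcomponent d (Const a * (monomial w * x)) \<in> I" for d a w
      unfolding hcomponent_Const_mult hcomponent_monomial_mult
      using x I by (auto intro!: mideal.subspace_scale mideal.subspace_0)
    then have "hcomponent d (mscale a (monomial w) * x) \<in> I" for d a w
      by (simp add: mscale_def mult.assoc)
    moreover have "hcomponent d (sum g A) = (\<Sum>i\<in>A. hcomponent d (g i))" for d A and g :: "'v pterm \<Rightarrow> ('v, 'a) mpoly"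
      by (rule poly_mapping_eqI) (simp add: lookup_hcomponent lookup_sum)
    ultimately have "hcomponent d ((\<Sum>u\<in>keys c. mscale (lookup c u) (monomial u)) * x) \<in> I" for d
      by (auto simp: sum_distrib_right intro!: mideal.subspace_sum[OF I])
    then show ?case
      using step(2) mideal.subspace_add[OF I] by (simp add: hcomponent_add sum_mscale_monomial)
  qed
  then show ?thesis by blast
qed

lemma homogeneous_ideal_supported:
  assumes "upclosed T"
  shows "homogeneous_ideal (supported T :: ('v, 'a::comm_ring_1) mpoly set)"
proof -
  have I: "mideal.subspace (supported T :: ('v, 'a) mpoly set)" by (rule ideal_supported[OF assms])
  have "f \<in> mideal.span (\<Union>d. supported T \<inter> forms d)" if "f \<in> supported T" for f :: "('v, 'a) mpoly"
  proof -
    have "hcomponent d f \<in> supported T \<inter> forms d" for d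
      using that by (auto simp: supported_def in_keys_iff lookup_hcomponent subset_iff split: if_splits)
    then have "(\<Sum>d\<in>tdeg ` keys f. hcomponent d f) \<in> mideal.span (\<Union>d. supported T \<inter> forms d)"
      by (intro mideal.span_sum mideal.span_base) blast
    then show ?thesis by (simp only: sum_hcomponents)
  qed
  moreover have "mideal.span (\<Union>d. supported T \<inter> forms d) \<subseteq> (supported T :: ('v, 'a) mpoly set)"
    by (rule mideal.span_minimal[OF _ I]) auto
  ultimately show ?thesis using I unfolding homogeneous_ideal_def by (simp add: subset_antisym subsetI)
qed

section \<open>Dickson's lemma and high degrees of a saturation\<close>

lemma nat_seq_mono_subseq:
  fixes g :: "nat \<Rightarrow> nat"
  obtains r :: "nat \<Rightarrow> nat" where "strict_mono r" "mono (\<lambda>n. g (r n))"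
proof -
  obtain r :: "nat \<Rightarrow> nat" where r: "strict_mono r" "monoseq (\<lambda>n. g (r n))" using seq_monosub[of g] by auto
  show ?thesis
  proof (cases "mono (\<lambda>n. g (r n))")
    case False
    \<comment> \<open>A nonincreasing sequence of naturals is constant, hence nondecreasing, once it
      has reached its minimum.\<close>
    then have dec: "\<And>m n. m \<le> n \<Longrightarrow> g (r n) \<le> g (r m)" using r(2) by (auto simp: monoseq_def mono_def)
    obtain N where N: "\<And>n. g (r N) \<le> g (r n)"
      using ex_has_least_nat[of "\<lambda>_. True" 0 "\<lambda>n. g (r n)"] by auto
    have "g (r (N + n)) = g (r N)" for n using N dec[of N "N + n"] by (simp add: le_antisym)
    then have "mono (\<lambda>n. g (r (N + n)))" by (simp add: mono_def)
    moreover have "strict_mono (\<lambda>n. r (N + n))" using r(1) by (simp add: strict_mono_def)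
    ultimately show ?thesis using that[of "\<lambda>n. r (N + n)"] by simp
  qed (use r that in blast)
qed

text \<open>A subsequence is extracted for one variable after another until all exponents are
  nondecreasing; its first two members then divide each other in order.\<close>

lemma pterm_seq_good:
  fixes f :: "nat \<Rightarrow> 'n::finite pterm"
  shows "\<exists>i j. i < j \<and> (\<exists>w. f j = f i + w)"
proof -
  have "\<exists>r :: nat \<Rightarrow> nat. strict_mono r \<and> (\<forall>v\<in>Z. mono (\<lambda>n. lookup (f (r n)) v))" if "finite Z" for Z
    using that
  proof (induction Z)
    case empty
    show ?case by (intro exI[of _ "\<lambda>n. n"]) (simp add: strict_mono_def)
  next
    case (insert x Z)
    then obtain r :: "nat \<Rightarrow> nat" where r: "strict_mono r" "\<forall>v\<in>Z. mono (\<lambda>n. lookup (f (r n)) v)" by blast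
    obtain s :: "nat \<Rightarrow> nat" where s: "strict_mono s" "mono (\<lambda>n. lookup (f (r (s n))) x)"
      using nat_seq_mono_subseq[of "\<lambda>n. lookup (f (r n)) x"] by blast
    have "strict_mono (\<lambda>n. r (s n))" using r(1) s(1) by (simp add: strict_mono_def)
    moreover have "mono (\<lambda>n. lookup (f (r (s n))) v)" if "v \<in> Z" for v
      using r(2) that s(1) by (simp add: mono_def strict_mono_less_eq)
    ultimately show ?case using s(2) by (intro exI[of _ "\<lambda>n. r (s n)"]) auto
  qed
  from this[of UNIV] obtain r :: "nat \<Rightarrow> nat" where r: "strict_mono r"
    "\<And>v. mono (\<lambda>n. lookup (f (r n)) v)" by auto
  have "f (r 1) = f (r 0) + (f (r 1) - f (r 0))"
    by (rule pterm_eq_add_minus) (use r(2) in \<open>simp add: mono_def\<close>)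
  moreover have "r 0 < r 1" using r(1) by (simp add: strict_mono_def)
  ultimately show ?thesis by blast
qed

text \<open>The terms of \<open>T\<close> that are minimal for divisibility generate it, and
  infinitely many of them would contradict \<open>pterm_seq_good\<close>.\<close>

lemma dickson:
  fixes T :: "'n::finite pterm set"
  obtains B where "finite B" "B \<subseteq> T" "\<And>u. u \<in> T \<Longrightarrow> \<exists>b\<in>B. \<exists>w. u = b + w"
proof -
  let ?B = "{u\<in>T. \<forall>v\<in>T. \<forall>w. u = v + w \<longrightarrow> v = u}"
  have "finite ?B"
  proof (rule ccontr)
    assume "infinite ?B"
    then obtain f :: "nat \<Rightarrow> _" where f: "inj f" "range f \<subseteq> ?B"
      using infinite_countable_subset by blast
    obtain i j w where ij: "i < j" "f j = f i + w" using pterm_seq_good[of f] by blast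
    have "f i \<in> ?B" "f j \<in> ?B" using f(2) by auto
    then have "f i = f j" using ij(2) by blast
    then show False using f(1) ij(1) by (simp add: inj_eq)
  qed
  moreover have "\<exists>b\<in>?B. \<exists>w. u = b + w" if "u \<in> T" for u
    using that
  proof (induction "tdeg u" arbitrary: u rule: less_induct)
    case less
    show ?case
    proof (cases "u \<in> ?B")
      case True
      then show ?thesis by (intro bexI[of _ u] exI[of _ 0]) auto
    next
      case False
      then obtain v w where vw: "v \<in> T" "u = v + w" "v \<noteq> u" using less.prems by blast
      then have "w \<noteq> 0" by auto
      then have "tdeg v < tdeg u" using vw(2) by (simp add: zero_less_iff_neq_zero)
      from less.hyps[OF this vw(1)] obtain b x where "b \<in> ?B" "v = b + x" by blast
      moreover from this have "u = b + (x + w)" using vw(2) by (simp add: add.assoc)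
      ultimately show ?thesis by blast
    qed
  qed
  ultimately show ?thesis using that[of ?B] by blast
qed

text \<open>Each of the finitely many generators of \<open>satT T\<close> enters \<open>T\<close>
  after multiplication by terms of some fixed degree. Past the sum of all degrees involved, every
  multiple of a generator has a cofactor of that degree.\<close>

lemma satT_eventually:
  assumes T: "upclosed (T :: 'n::finite pterm set)"
  obtains d where "\<And>u. u \<in> satT T \<Longrightarrow> d \<le> tdeg u \<Longrightarrow> u \<in> T"
proof -
  obtain B where B: "finite B" "B \<subseteq> satT T" "\<And>u. u \<in> satT T \<Longrightarrow> \<exists>b\<in>B. \<exists>w. u = b + w"
    using dickson[of "satT T"] by blast
  then have "\<forall>b\<in>B. \<exists>k. \<forall>w. tdeg w = k \<longrightarrow> b + w \<in> T" by (auto simp: satT_def)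
  then obtain k where k: "\<And>b w. b \<in> B \<Longrightarrow> tdeg w = k b \<Longrightarrow> b + w \<in> T" by metis
  have "u \<in> T" if u: "u \<in> satT T" "(\<Sum>b\<in>B. tdeg b + k b) \<le> tdeg u" for u
  proof -
    obtain b w where bw: "b \<in> B" "u = b + w" using B(3)[OF u(1)] by blast
    have "tdeg b + k b \<le> (\<Sum>b\<in>B. tdeg b + k b)" using bw(1) B(1) by (intro member_le_sum) auto
    then have "k b \<le> tdeg w" using u(2) bw(2) by simp
    then show ?thesis using upclosed_mult_of_degree_ge[OF T, of "k b" b w] k bw by blast
  qed
  then show ?thesis using that by blast
qed

definition tslice :: "'v pterm set \<Rightarrow> nat \<Rightarrow> 'v pterm set" where
  "tslice T t = {u\<in>T. tdeg u = t}"

lemma finite_tslice [simp]: "finite (tslice (T :: 'n::finite pterm set) t)"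
  using finite_subset[OF _ finite_tdeg[of t]] by (auto simp: tslice_def)

lemma supported_Int_forms: "supported T \<inter> forms t = supported (tslice T t)"
  by (auto simp: forms_eq_supported supported_Int tslice_def supported_def)

lemma dim_supported_Int_forms:
  "mpoly.dim (supported T \<inter> forms t :: ('n::finite, 'a::field) mpoly set) = card (tslice T t)"
  by (simp add: supported_Int_forms)

lemma hilbert_function_supported:
  "hilbert_function (supported T :: ('n::finite, 'a::field) mpoly set) t =
     card {u :: 'n pterm. tdeg u = t} - card (tslice T t)"
  by (simp add: hilbert_function_def dim_forms dim_supported_Int_forms)

text \<open>Saturating leaves all high degrees unchanged, hence also the Hilbert polynomial.\<close>

lemma supported_satT_in_subscheme_ideals:
  assumes T: "upclosed (T :: 'n::finite pterm set)"
    and p: "\<And>t. t \<ge> t0 \<Longrightarrow> rat_of_nat (card {u :: 'n pterm. tdeg u = t} - card (tslice T t)) = poly p (rat_of_nat t)"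
  shows "(supported (satT T) :: ('n, 'a::field) mpoly set) \<in> subscheme_ideals p"
proof -
  obtain d where d: "\<And>u. u \<in> satT T \<Longrightarrow> d \<le> tdeg u \<Longrightarrow> u \<in> T" using satT_eventually[OF T] by blast
  have "tslice (satT T) t = tslice T t" if "t \<ge> d" for t
    using d subset_satT[OF T] that by (auto simp: tslice_def)
  then have "rat_of_nat (hilbert_function (supported (satT T) :: ('n, 'a) mpoly set) t) = poly p (rat_of_nat t)"
    if "t \<ge> max d t0" for t using that p by (simp add: hilbert_function_supported)
  then have "\<exists>t0. \<forall>t\<ge>t0. rat_of_nat (hilbert_function (supported (satT T) :: ('n, 'a) mpoly set) t) = poly p (rat_of_nat t)"
    by blast
  then show ?thesis
    unfolding subscheme_ideals_def
    using homogeneous_ideal_supported[OF upclosed_satT[OF T]]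
      saturation_supported[OF upclosed_satT[OF T]] satT_satT[OF T] by auto
qed

text \<open>Multiplying by a term of degree \<open>m\<close> pushes all homogeneous components of an
  element of \<open>I\<close> into degrees at least \<open>m\<close>, where the forms of degree
  \<open>m\<close> generate \<open>I\<close>.\<close>

lemma saturation_truncation:
  fixes I :: "('v, 'a::field) mpoly set"
  assumes I: "homogeneous_ideal I" "saturation I = I"
    and gen: "\<And>t. m \<le> t \<Longrightarrow> I \<inter> forms t \<subseteq> mideal.span (I \<inter> forms m)"
  shows "saturation (mideal.span (I \<inter> forms m)) = I"
proof
  have sI: "mideal.subspace I" using I(1) by (simp add: homogeneous_ideal_def)
  have "mideal.span (I \<inter> forms m) \<subseteq> I" using sI by (intro mideal.span_minimal) auto
  then show "saturation (mideal.span (I \<inter> forms m)) \<subseteq> I"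
    using saturation_mono[OF mideal.subspace_span sI] I(2) by blast
  show "I \<subseteq> saturation (mideal.span (I \<inter> forms m))"
  proof
    fix f assume f: "f \<in> I"
    have "f * monomial w \<in> mideal.span (I \<inter> forms m)" if w: "tdeg w = m" for w
    proof -
      let ?g = "monomial w * f"
      have g: "?g \<in> I" using f sI by (simp add: mideal.subspace_scale)
      have "hcomponent d ?g \<in> mideal.span (I \<inter> forms m)" if "d \<in> tdeg ` keys ?g" for d
      proof -
        have "m \<le> d" using that w by (auto simp: keys_monomial_mult)
        then show ?thesis using gen hcomponent_in_ideal[OF I(1) g] hcomponent_forms by blast
      qed
      then have "(\<Sum>d\<in>tdeg ` keys ?g. hcomponent d ?g) \<in> mideal.span (I \<inter> forms m)"
        by (rule mideal.span_sum)
      then show ?thesis by (simp only: sum_hcomponents mult.commute[of f])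
    qed
    then show "f \<in> saturation (mideal.span (I \<inter> forms m))"
      by (auto simp: in_saturation_iff[OF mideal.subspace_span])
  qed
qed

section \<open>Hilbert functions of regular ideals\<close>

lemma card_tdeg_eq:
  "card {u :: 'n::finite pterm. tdeg u = d} = (d + CARD('n) - 1) choose (CARD('n) - 1)"
proof -
  obtain xs :: "'n list" where xs: "set xs = UNIV" "distinct xs"
    using finite_distinct_list[of "UNIV :: 'n set"] by auto
  then have len: "length xs = CARD('n)" by (metis distinct_card)
  let ?F = "\<lambda>u :: 'n pterm. map (lookup u) xs"
  have "bij_betw ?F {u. tdeg u = d} {l. length l = CARD('n) \<and> sum_list l = d}"
  proof (rule bij_betw_imageI)
    show "inj_on ?F {u. tdeg u = d}"
      by (rule inj_onI, rule poly_mapping_eqI) (use xs(1) in auto)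
    have deg: "sum_list (?F u) = tdeg u" for u
      by (simp add: tdeg_eq_sum sum_list_distinct_conv_sum_set[OF xs(2)] xs(1))
    show "?F ` {u. tdeg u = d} = {l. length l = CARD('n) \<and> sum_list l = d}"
    proof (rule equalityI; rule subsetI)
      fix l assume "l \<in> ?F ` {u. tdeg u = d}"
      then show "l \<in> {l. length l = CARD('n) \<and> sum_list l = d}" using deg len by auto
    next
      fix l :: "nat list" assume l: "l \<in> {l. length l = CARD('n) \<and> sum_list l = d}"
      define u where "u = Abs_poly_mapping (\<lambda>v. l ! (THE i. i < length xs \<and> xs ! i = v))"
      have lu: "lookup u v = l ! (THE i. i < length xs \<and> xs ! i = v)" for v
        by (simp add: u_def)
      have "lookup u (xs ! i) = l ! i" if "i < length xs" for i
      proof -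
        have "(THE j. j < length xs \<and> xs ! j = xs ! i) = i"
          using that xs(2) by (intro the_equality) (auto simp: nth_eq_iff_index_eq)
        then show ?thesis by (simp add: lu)
      qed
      then have "?F u = l" using l len by (intro nth_equalityI) auto
      then show "l \<in> ?F ` {u. tdeg u = d}" using deg[of u] l by auto
    qed
  qed
  then have "card {u :: 'n pterm. tdeg u = d} = (d + CARD('n) - 1) choose d"
    using card_length_sum_list[of "CARD('n)" d] by (simp add: bij_betw_same_card)
  also have "\<dots> = (d + CARD('n) - 1) choose (CARD('n) - 1)"
    by (subst binomial_symmetric) (auto simp: Suc_le_eq)
  finally show ?thesis .
qed

lemma choose_polynomial: "\<exists>P :: rat poly. \<forall>n. poly P (rat_of_nat n) = rat_of_nat (n choose k)"
proof
  let ?P = "smult (1 / fact k) (\<Prod>i<k. [: - rat_of_nat i, 1 :])"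
  have "poly ?P (rat_of_nat n) = rat_of_nat (n choose k)" for n
    by (simp add: poly_prod binomial_gbinomial gbinomial_prod_rev atLeast0LessThan)
  then show "\<forall>n. poly ?P (rat_of_nat n) = rat_of_nat (n choose k)" by blast
qed

text \<open>The polynomial is the binomial coefficient of t - s + n over n, with n =
  \<open>CARD('n) - 1\<close>. It vanishes for t - s from -n to -1, where there are no terms either,
  so it is correct already for t >= s - n. This slack absorbs the shift i in the degree bound r + i
  of a resolution.\<close>

lemma card_shifted_degree_polynomial:
  "\<exists>P :: rat poly. \<forall>t. s \<le> t + CARD('n) - 1 \<longrightarrow>
     rat_of_nat (card {u :: 'n::finite pterm. tdeg u + s = t}) = poly P (rat_of_nat t)"
proof -
  let ?M = "CARD('n)"
  obtain P :: "rat poly" where P: "\<And>n. poly P (rat_of_nat n) = rat_of_nat (n choose (?M - 1))"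
    using choose_polynomial by blast
  let ?Q = "pcompose P [: rat_of_nat (?M - 1) - rat_of_nat s, 1 :]"
  have "rat_of_nat (card {u :: 'n pterm. tdeg u + s = t}) = poly ?Q (rat_of_nat t)"
    if "s \<le> t + ?M - 1" for t
  proof -
    have "card {u :: 'n pterm. tdeg u + s = t} = (t + (?M - 1) - s) choose (?M - 1)"
    proof (cases "s \<le> t")
      case True
      then have "{u :: 'n pterm. tdeg u + s = t} = {u. tdeg u = t - s}" by auto
      then show ?thesis using True by (simp add: card_tdeg_eq Suc_le_eq)
    next
      case False
      then have "{u :: 'n pterm. tdeg u + s = t} = {}" by auto
      moreover have "t + (?M - 1) - s < ?M - 1" using False that by linarith
      ultimately show ?thesis by (simp add: binomial_eq_0)
    qed
    moreover have "rat_of_nat (?M - 1) - rat_of_nat s + rat_of_nat t = rat_of_nat (t + (?M - 1) - s)"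
    proof -
      have "s \<le> t + (?M - 1)" using that zero_less_card_finite[where 'a='n] by linarith
      from of_nat_diff[OF this, where 'a=rat] show ?thesis unfolding of_nat_add by linarith
    qed
    moreover have "poly [:a, 1:] x = a + x" for a x :: rat by simp
    ultimately show ?thesis by (simp only: poly_pcompose P)
  qed
  then show ?thesis by blast
qed

section \<open>Graded free modules and the degreewise form of a resolution\<close>

type_synonym ('n, 'a) mvector = "nat \<Rightarrow>\<^sub>0 ('n, 'a) mpoly"

text \<open>Multiplication of finitely supported functions on the naturals is convolution, so a
  factor concentrated at index 0 acts entrywise.\<close>

definition vscale :: "'a::comm_ring_1 \<Rightarrow> ('n, 'a) mvector \<Rightarrow> ('n, 'a) mvector" where
  "vscale c f = single 0 (Const c) * f"

lemma lookup_vscale [simp]: "lookup (vscale c f) k = mscale c (lookup f k)"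
  unfolding vscale_def lookup_mult
  by (simp add: lookup_single when_mult mscale_def)

global_interpretation mvec: vector_space "vscale :: 'a::field \<Rightarrow> ('n, 'a) mvector \<Rightarrow> ('n, 'a) mvector"
  by unfold_locales
    (auto intro!: poly_mapping_eqI simp: lookup_add mpoly.scale_right_distrib mpoly.scale_left_distrib)

text \<open>The degree \<open>t\<close> part of the sum of the S(-e) for e in \<open>es\<close>.
  Entries beyond the rank are 0, so modules of all ranks share one type and one vector space
  structure.\<close>

definition graded_part :: "nat list \<Rightarrow> nat \<Rightarrow> ('n, 'a::zero) mvector set" where
  "graded_part es t = {f. (\<forall>k<length es. \<forall>u\<in>keys (lookup f k). tdeg u + es ! k = t) \<and>
     (\<forall>k\<ge>length es. lookup f k = 0)}"

definition matmap :: "('n, 'a::comm_ring_1) mpoly Matrix.mat \<Rightarrow> ('n, 'a) mvector \<Rightarrow> ('n, 'a) mvector" where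
  "matmap A f = (\<Sum>j<dim_row A. single j (\<Sum>k<dim_col A. A $$ (j, k) * lookup f k))"

lemma lookup_matmap:
  "lookup (matmap A f) j =
     (if j < dim_row A then \<Sum>k<dim_col A. A $$ (j, k) * lookup f k else 0)"
  by (simp add: matmap_def lookup_sum lookup_single when_def)

definition vec_to_mvector :: "('n, 'a::comm_ring_1) mpoly Matrix.vec \<Rightarrow> ('n, 'a) mvector" where
  "vec_to_mvector v = (\<Sum>k<dim_vec v. single k (vec_index v k))"

lemma lookup_vec_to_mvector:
  "lookup (vec_to_mvector v) k = (if k < dim_vec v then vec_index v k else 0)"
  by (simp add: vec_to_mvector_def lookup_sum lookup_single when_def)

lemma vec_to_mvector_mult:
  assumes "dim_vec v = dim_col A"
  shows "vec_to_mvector (A *\<^sub>v v) = matmap A (vec_to_mvector v)"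
  by (rule poly_mapping_eqI)
    (use assms in \<open>auto simp: lookup_vec_to_mvector lookup_matmap scalar_prod_def atLeast0LessThan\<close>)

lemma matmap_linear: "Vector_Spaces.linear vscale vscale (matmap (A :: ('n, 'a::field) mpoly Matrix.mat))"
  unfolding Vector_Spaces.linear_iff
proof (intro conjI allI mvec.vector_space_axioms)
  fix x y :: "('n, 'a) mvector"
  show "matmap A (x + y) = matmap A x + matmap A y"
    by (rule poly_mapping_eqI) (simp add: lookup_matmap lookup_add distrib_left sum.distrib)
  fix c
  show "matmap A (vscale c x) = vscale c (matmap A x)"
    by (rule poly_mapping_eqI)
      (simp add: lookup_matmap mscale_def sum_distrib_left mult.left_commute)
qed

lemma subspace_graded_part: "mvec.subspace (graded_part es t :: ('n, 'a::field) mvector set)"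
  unfolding mvec.subspace_def
proof (intro conjI ballI allI)
  fix x y :: "('n, 'a) mvector" and c
  assume x: "x \<in> graded_part es t"
  show "vscale c x \<in> graded_part es t"
    using x keys_mscale unfolding graded_part_def by fastforce
  assume y: "y \<in> graded_part es t"
  show "x + y \<in> graded_part es t"
    using x y keys_add unfolding graded_part_def by (fastforce simp: lookup_add)
qed (simp add: graded_part_def)

lemma graded_part_lookup_eq_0:
  assumes "f \<in> graded_part es t" "\<not> (k < length es \<and> tdeg u + es ! k = t)"
  shows "lookup (lookup f k) u = 0"
proof (cases "k < length es")
  case True
  then show ?thesis using assms by (auto simp: graded_part_def simp flip: not_in_keys_iff_lookup_eq_zero)
qed (use assms in \<open>auto simp: graded_part_def\<close>)

definition graded_basis_index :: "nat list \<Rightarrow> nat \<Rightarrow> (nat \<times> 'n pterm) set" where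
  "graded_basis_index es t = (SIGMA k:{..<length es}. {u. tdeg u + es ! k = t})"

lemma finite_tdeg_shift [simp]: "finite {u :: 'n::finite pterm. tdeg u + s = t}"
  by (rule finite_subset[OF _ finite_tdeg[of "t - s"]]) auto

lemma finite_graded_basis_index [simp]: "finite (graded_basis_index es t :: (nat \<times> 'n::finite pterm) set)"
  by (simp add: graded_basis_index_def)

definition basis_mvector :: "nat \<times> 'n pterm \<Rightarrow> ('n, 'a::zero_neq_one) mvector" where
  "basis_mvector ku = single (fst ku) (monomial (snd ku))"

lemma lookup_sum_basis_mvector:
  fixes c :: "nat \<times> 'n::finite pterm \<Rightarrow> 'a::field"
  assumes "finite P"
  shows "lookup (lookup (\<Sum>i\<in>P. vscale (c i) (basis_mvector i)) k) u =
    (if (k, u) \<in> P then c (k, u) else 0)"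
proof -
  have "lookup (lookup (\<Sum>i\<in>P. vscale (c i) (basis_mvector i)) k) u =
     (\<Sum>i\<in>P. if i = (k, u) then c i else 0)"
    unfolding lookup_sum
    by (rule sum.cong) (auto simp: basis_mvector_def lookup_single when_def lookup_monomial prod_eq_iff)
  then show ?thesis using assms by simp
qed

lemma graded_part_span:
  "mvec.span (basis_mvector ` graded_basis_index es t) = (graded_part es t :: ('n::finite, 'a::field) mvector set)"
proof
  show "mvec.span (basis_mvector ` graded_basis_index es t) \<subseteq> (graded_part es t :: ('n, 'a) mvector set)"
    by (rule mvec.span_minimal[OF _ subspace_graded_part])
      (auto simp: graded_basis_index_def basis_mvector_def graded_part_def lookup_single when_def monomial_def split: if_splits)
  show "(graded_part es t :: ('n, 'a) mvector set) \<subseteq> mvec.span (basis_mvector ` graded_basis_index es t)"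
  proof
    fix f :: "('n, 'a) mvector" assume f: "f \<in> graded_part es t"
    let ?g = "\<Sum>i\<in>graded_basis_index es t. vscale (lookup (lookup f (fst i)) (snd i)) (basis_mvector i)"
    have "f = ?g"
    proof (rule poly_mapping_eqI, rule poly_mapping_eqI)
      fix k u
      show "lookup (lookup f k) u = lookup (lookup ?g k) u"
        using graded_part_lookup_eq_0[OF f, of k u]
        by (auto simp: lookup_sum_basis_mvector graded_basis_index_def)
    qed
    moreover have "?g \<in> mvec.span (basis_mvector ` graded_basis_index es t)"
      by (intro mvec.span_sum mvec.span_scale mvec.span_base) auto
    ultimately show "f \<in> mvec.span (basis_mvector ` graded_basis_index es t)" by simp
  qed
qed

lemma dim_graded_part:
  "mvec.dim (graded_part es t :: ('n::finite, 'a::field) mvector set) =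
     (\<Sum>k<length es. card {u :: 'n pterm. tdeg u + es ! k = t})"
proof -
  let ?P = "graded_basis_index es t :: (nat \<times> 'n pterm) set"
  have *: "\<forall>i\<in>?P. c i = 0" if "(\<Sum>i\<in>?P. vscale (c i) (basis_mvector i :: ('n, 'a) mvector)) = 0" for c
  proof
    fix i assume "i \<in> ?P"
    then show "c i = 0"
      using lookup_sum_basis_mvector[of ?P c "fst i" "snd i"] that by simp
  qed
  have "inj_on (basis_mvector :: _ \<Rightarrow> ('n, 'a) mvector) ?P"
    "mvec.independent (basis_mvector ` ?P :: ('n, 'a) mvector set)"
    using mvec.independent_family[of ?P basis_mvector] * by auto
  then have "mvec.dim (mvec.span (basis_mvector ` ?P) :: ('n, 'a) mvector set) = card ?P"
    by (simp add: mvec.dim_eq_card_independent card_image)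
  then show ?thesis by (simp add: graded_part_span) (simp add: graded_basis_index_def)
qed

text \<open>The projection of S(-e) to degree t. The case e > t is separate because truncated
  subtraction would select the constant component there.\<close>

definition hpart :: "nat \<Rightarrow> nat \<Rightarrow> ('v, 'a::comm_monoid_add) mpoly \<Rightarrow> ('v, 'a) mpoly" where
  "hpart e t f = (if e \<le> t then hcomponent (t - e) f else 0)"

lemma lookup_hpart: "lookup (hpart e t f) u = (if tdeg u + e = t then lookup f u else 0)"
  by (auto simp: hpart_def lookup_hcomponent)

lemma hpart_sum: "hpart e t (sum f A) = (\<Sum>i\<in>A. hpart e t (f i))"
  by (rule poly_mapping_eqI) (simp add: lookup_hpart lookup_sum)

lemma hpart_mult:
  fixes a f :: "('v, 'a::comm_ring_1) mpoly"
  assumes "\<forall>u\<in>keys a. tdeg u + e = e'"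
  shows "hpart e t (a * f) = a * hpart e' t f"
proof -
  have *: "hpart e t (mscale c (monomial w) * f) = mscale c (monomial w) * hpart e' t f"
    if "tdeg w + e = e'" for c w
    by (rule poly_mapping_eqI)
      (use that in \<open>auto simp: lookup_hpart lookup_monomial_mult mscale_def mult.assoc\<close>)
  have "hpart e t ((\<Sum>u\<in>keys a. mscale (lookup a u) (monomial u)) * f) =
      (\<Sum>u\<in>keys a. mscale (lookup a u) (monomial u)) * hpart e' t f"
    using assms by (simp add: sum_distrib_right hpart_sum *)
  then show ?thesis by (simp add: sum_mscale_monomial)
qed

definition trunc :: "nat list \<Rightarrow> nat \<Rightarrow> ('n, 'a::comm_monoid_add) mvector \<Rightarrow> ('n, 'a) mvector" where
  "trunc es t f = (\<Sum>k<length es. single k (hpart (es ! k) t (lookup f k)))"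

lemma lookup_trunc:
  "lookup (trunc es t f) k =
     (if k < length es then hpart (es ! k) t (lookup f k) else 0)"
  by (simp add: trunc_def lookup_sum lookup_single when_def)

lemma trunc_in_graded_part: "trunc es t f \<in> graded_part es t"
  by (auto simp: graded_part_def lookup_trunc in_keys_iff lookup_hpart split: if_splits)

lemma trunc_of_graded_part: "f \<in> graded_part es t \<Longrightarrow> trunc es t f = f"
  by (rule poly_mapping_eqI, rule poly_mapping_eqI)
    (auto simp: lookup_trunc lookup_hpart graded_part_lookup_eq_0)

definition graded_mat :: "nat list \<Rightarrow> nat list \<Rightarrow> ('n, 'a::zero) mpoly Matrix.mat \<Rightarrow> bool" where
  "graded_mat es es' A \<longleftrightarrow> A \<in> carrier_mat (length es) (length es') \<and>
     (\<forall>j<length es. \<forall>k<length es'. \<forall>u\<in>keys (A $$ (j, k)). tdeg u + es ! j = es' ! k)"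

text \<open>An entry of a graded matrix is homogeneous of the degree by which the two shifts differ,
  so it carries degree t parts to degree t parts.\<close>

lemma matmap_trunc:
  assumes "graded_mat es es' A"
  shows "matmap A (trunc es' t f) = trunc es t (matmap A f)"
proof (rule poly_mapping_eqI)
  fix j
  have "(\<Sum>k<length es'. A $$ (j, k) * hpart (es' ! k) t (lookup f k)) =
      hpart (es ! j) t (\<Sum>k<length es'. A $$ (j, k) * lookup f k)" if "j < length es"
    unfolding hpart_sum
    by (rule sum.cong[OF refl], rule hpart_mult[symmetric]) (use assms that in \<open>auto simp: graded_mat_def\<close>)
  then show "lookup (matmap A (trunc es' t f)) j = lookup (trunc es t (matmap A f)) j"
    using assms by (auto simp: lookup_matmap lookup_trunc graded_mat_def)
qed

lemma matmap_graded_part: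
  assumes "graded_mat es es' A" "f \<in> graded_part es' t"
  shows "matmap A f \<in> graded_part es t"
  using matmap_trunc[OF assms(1), of t f] trunc_of_graded_part[OF assms(2)]
    trunc_in_graded_part[of es t "matmap A f"] by simp

definition mvector_to_vec :: "nat \<Rightarrow> ('n, 'a::comm_ring_1) mvector \<Rightarrow> ('n, 'a) mpoly Matrix.vec" where
  "mvector_to_vec n f = Matrix.vec n (lookup f)"

lemma vec_to_mvector_to_vec:
  assumes "f \<in> graded_part es t"
  shows "vec_to_mvector (mvector_to_vec (length es) f) = f"
  by (rule poly_mapping_eqI)
    (use assms in \<open>auto simp: mvector_to_vec_def lookup_vec_to_mvector graded_part_def\<close>)

lemma dim_mvector_to_vec [simp]: "dim_vec (mvector_to_vec n f) = n"
  by (simp add: mvector_to_vec_def)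

lemma mvector_to_vec_carrier [simp]: "mvector_to_vec n f \<in> carrier_vec n"
  by (simp add: mvector_to_vec_def)

lemma vec_to_mvector_0 [simp]: "vec_to_mvector (0\<^sub>v n) = 0"
  by (rule poly_mapping_eqI) (simp add: lookup_vec_to_mvector)

lemma vec_to_mvector_eq_0:
  assumes "vec_to_mvector v = 0" "v \<in> carrier_vec n"
  shows "v = 0\<^sub>v n"
proof (rule eq_vecI)
  fix i assume "i < dim_vec (0\<^sub>v n :: ('a, 'b) mpoly Matrix.vec)"
  then show "vec_index v i = vec_index (0\<^sub>v n) i"
    using lookup_vec_to_mvector[of v i] assms by simp
qed (use assms in simp)

text \<open>A preimage of an element of degree t may have parts of other degrees. Its truncation is
  still a preimage, because truncation commutes with graded matrices.\<close>

lemma graded_exact: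
  assumes A: "graded_mat es0 es1 A" and B: "graded_mat es1 es2 B"
    and exact: "{v \<in> carrier_vec (length es1). A *\<^sub>v v = 0\<^sub>v (length es0)} =
      (\<lambda>v. B *\<^sub>v v) ` carrier_vec (length es2)"
  shows "{f \<in> graded_part es1 t. matmap A f = 0} = matmap B ` graded_part es2 t"
proof (rule equalityI; rule subsetI)
  fix f assume f: "f \<in> {f \<in> graded_part es1 t. matmap A f = 0}"
  let ?v = "mvector_to_vec (length es1) f"
  have cA: "dim_row A = length es0" "dim_col A = length es1" "dim_row B = length es1" "dim_col B = length es2"
    using A B by (auto simp: graded_mat_def)
  have "vec_to_mvector (A *\<^sub>v ?v) = 0"
    using f cA vec_to_mvector_to_vec[of f es1 t] by (simp add: vec_to_mvector_mult)
  then have "A *\<^sub>v ?v = 0\<^sub>v (length es0)" 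
    by (rule vec_to_mvector_eq_0) (rule carrier_vecI, simp only: dim_mult_mat_vec cA)
  then have "?v \<in> {v \<in> carrier_vec (length es1). A *\<^sub>v v = 0\<^sub>v (length es0)}" by simp
  then have "?v \<in> (\<lambda>v. B *\<^sub>v v) ` carrier_vec (length es2)" by (simp only: exact)
  then obtain w where w: "w \<in> carrier_vec (length es2)" "?v = B *\<^sub>v w" by blast
  then have "f = matmap B (vec_to_mvector w)"
    using f cA vec_to_mvector_mult[of w B] vec_to_mvector_to_vec[of f es1 t] by auto
  then have "f = matmap B (trunc es2 t (vec_to_mvector w))"
    using matmap_trunc[OF B] trunc_of_graded_part[of f es1 t] f by auto
  then show "f \<in> matmap B ` graded_part es2 t" using trunc_in_graded_part by blast
next
  fix f assume "f \<in> matmap B ` graded_part es2 t"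
  then obtain g where g: "g \<in> graded_part es2 t" "f = matmap B g" by blast
  have cA: "dim_row A = length es0" "dim_col A = length es1" "dim_row B = length es1" "dim_col B = length es2"
    using A B by (auto simp: graded_mat_def)
  let ?w = "mvector_to_vec (length es2) g"
  have f: "f = vec_to_mvector (B *\<^sub>v ?w)"
    using g cA vec_to_mvector_to_vec[of g es2 t] by (simp add: vec_to_mvector_mult)
  have "B *\<^sub>v ?w \<in> {v \<in> carrier_vec (length es1). A *\<^sub>v v = 0\<^sub>v (length es0)}"
    unfolding exact by (rule imageI) simp
  then have "matmap A f = 0"
    using f cA vec_to_mvector_mult[of "B *\<^sub>v ?w" A] by auto
  then show "f \<in> {f \<in> graded_part es1 t. matmap A f = 0}"
    using matmap_graded_part[OF B g(1)] g(2) by simp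
qed

lemma span_graded_part:
  "graded_part es t \<subseteq> mvec.span (basis_mvector ` graded_basis_index es t :: ('n::finite, 'a::field) mvector set)"
  by (simp add: graded_part_span)

lemma matmap_rank_nullity:
  fixes A :: "('n::finite, 'a::field) mpoly Matrix.mat"
  shows "mvec.dim (graded_part es t :: ('n, 'a) mvector set) =
     mvec.dim {f \<in> graded_part es t. matmap A f = 0} + mvec.dim (matmap A ` graded_part es t)"
proof -
  have "vector_space_pair (vscale :: 'a \<Rightarrow> ('n, 'a) mvector \<Rightarrow> _) (vscale :: 'a \<Rightarrow> ('n, 'a) mvector \<Rightarrow> _)"
    by (simp add: vector_space_pair_def mvec.vector_space_axioms)
  then show ?thesis
    by (rule vector_space_pair.rank_nullity[OF _ matmap_linear _ span_graded_part subspace_graded_part]) simp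
qed

section \<open>Hilbert functions and generators from a resolution\<close>

locale graded_resolution =
  fixes r :: nat and I :: "('n::finite, 'a::field) mpoly set"
    and e :: "nat \<Rightarrow> nat list" and d :: "nat \<Rightarrow> ('n, 'a) mpoly Matrix.mat"
  assumes e0: "e 0 = [0]" and e_last: "e (Suc CARD('n)) = []"
    and degree_bound: "i < CARD('n) \<Longrightarrow> s \<in> set (e (Suc i)) \<Longrightarrow> s \<le> r + i"
    and graded: "i \<le> CARD('n) \<Longrightarrow> graded_mat (e i) (e (Suc i)) (d i)"
    and image_0: "(\<lambda>v. vec_index (d 0 *\<^sub>v v) 0) ` carrier_vec (length (e 1)) = I"
    and exact: "i < CARD('n) \<Longrightarrow>
      {v \<in> carrier_vec (length (e (Suc i))). d i *\<^sub>v v = 0\<^sub>v (length (e i))} =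
      (\<lambda>v. d (Suc i) *\<^sub>v v) ` carrier_vec (length (e (Suc (Suc i))))"

lemma mumford_regular_iff:
  "mumford_regular r I \<longleftrightarrow> (\<exists>e d. graded_resolution r I e d)"
  unfolding mumford_regular_def graded_resolution_def graded_mat_def by (intro ex_cong1) blast

context graded_resolution
begin

definition phi :: "('n, 'a) mvector \<Rightarrow> ('n, 'a) mpoly" where
  "phi f = lookup (matmap (d 0) f) 0"

lemma phi_eq: "phi f = (\<Sum>k<length (e 1). d 0 $$ (0, k) * lookup f k)"
  using graded[of 0] e0 by (auto simp: phi_def lookup_matmap graded_mat_def)

lemma dim_d0: "dim_row (d 0) = 1" "dim_col (d 0) = length (e 1)"
  using graded[of 0] e0 by (auto simp: graded_mat_def)

lemma phi_in_I: "phi f \<in> I"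
proof -
  have "vec_index (d 0 *\<^sub>v mvector_to_vec (length (e 1)) f) 0 = phi f"
    by (simp add: phi_eq dim_d0 scalar_prod_def mvector_to_vec_def atLeast0LessThan)
  moreover have "vec_index (d 0 *\<^sub>v mvector_to_vec (length (e 1)) f) 0 \<in> I"
    unfolding image_0[symmetric] by (rule imageI) simp
  ultimately show ?thesis by simp
qed

lemma I_forms: "I \<inter> forms t = phi ` graded_part (e 1) t"
proof (rule equalityI; rule subsetI)
  fix f assume f: "f \<in> I \<inter> forms t"
  then obtain v where v: "v \<in> carrier_vec (length (e 1))" "f = vec_index (d 0 *\<^sub>v v) 0"
    using image_0 by blast
  have "f = phi (vec_to_mvector v)"
    using v by (simp add: phi_eq dim_d0 scalar_prod_def lookup_vec_to_mvector atLeast0LessThan)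
  moreover have "f = hpart 0 t f" using f hcomponent_of_form[of f t t] by (simp add: hpart_def)
  ultimately have "f = lookup (trunc (e 0) t (matmap (d 0) (vec_to_mvector v))) 0"
    using e0 by (simp add: lookup_trunc phi_def)
  then have "f = phi (trunc (e 1) t (vec_to_mvector v))"
    using matmap_trunc[OF graded[of 0]] by (simp add: phi_def)
  then show "f \<in> phi ` graded_part (e 1) t" using trunc_in_graded_part by blast
next
  fix f assume "f \<in> phi ` graded_part (e 1) t"
  then obtain g where g: "g \<in> graded_part (e 1) t" "f = phi g" by blast
  have "matmap (d 0) g \<in> graded_part (e 0) t"
    using matmap_graded_part[OF graded[of 0]] g(1) by simp
  then have "f \<in> forms t" using g(2) e0 by (auto simp: graded_part_def phi_def forms_def)
  then show "f \<in> I \<inter> forms t" using phi_in_I g(2) by simp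
qed

text \<open>The generators given by the columns of \<open>d 0\<close> have degree at most r, hence
  at most m. Every term of a coefficient therefore has a factor of degree t - m that can be split
  off, leaving an element of degree m.\<close>

lemma generators:
  assumes "r \<le> m" "m \<le> t" and sub: "mideal.subspace I"
  shows "I \<inter> forms t \<subseteq> mideal.span (I \<inter> forms m)"
proof
  fix f assume "f \<in> I \<inter> forms t"
  then obtain g where g: "g \<in> graded_part (e 1) t" "f = phi g" using I_forms by blast
  have d0: "d 0 $$ (0, k) \<in> I \<inter> forms (e 1 ! k)" if "k < length (e 1)" for k
  proof -
    have "phi (single k 1) = (\<Sum>l<length (e 1). if l = k then d 0 $$ (0, l) else 0)"
      unfolding phi_eq by (rule sum.cong) (auto simp: lookup_single when_def)
    then have "d 0 $$ (0, k) \<in> I" using that phi_in_I[of "single k 1"] by simp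
    moreover have "d 0 $$ (0, k) \<in> forms (e 1 ! k)"
      using graded[of 0] that e0 by (fastforce simp: graded_mat_def forms_def)
    ultimately show ?thesis by blast
  qed
  have "d 0 $$ (0, k) * lookup g k \<in> mideal.span (I \<inter> forms m)"
    if k: "k < length (e 1)" for k
  proof -
    have le: "e 1 ! k \<le> m" using degree_bound[of 0 "e 1 ! k"] k assms(1) by (auto simp: zero_less_card_finite)
    let ?gk = "lookup g k"
    have "mscale (lookup ?gk u) (monomial u) * d 0 $$ (0, k) \<in> mideal.span (I \<inter> forms m)"
      if u: "u \<in> keys ?gk" for u
    proof -
      have "tdeg u = (m - e 1 ! k) + (t - m)"
      proof -
        have "tdeg u + e 1 ! k = t" using g(1) k u unfolding graded_part_def by blast
        then show ?thesis using le assms(2) by linarith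
      qed
      then obtain v w where vw: "u = v + w" "tdeg v = m - e 1 ! k" "tdeg w = t - m"
        by (rule tdeg_split)
      let ?h = "monomial v * d 0 $$ (0, k)"
      have "?h \<in> I" using d0[OF k] sub by (simp add: mideal.subspace_scale)
      moreover have "?h \<in> forms m"
        using d0[OF k] vw le by (auto simp: forms_def keys_monomial_mult)
      ultimately have "(Const (lookup ?gk u) * monomial w) * ?h \<in> mideal.span (I \<inter> forms m)"
        by (intro mideal.span_scale mideal.span_base) simp
      moreover have "(Const (lookup ?gk u) * monomial w) * ?h =
          mscale (lookup ?gk u) (monomial u) * d 0 $$ (0, k)"
        by (simp add: mscale_def vw(1) monomial_mult[symmetric] algebra_simps)
      ultimately show ?thesis by (simp only:)
    qed
    then have "(\<Sum>u\<in>keys ?gk. mscale (lookup ?gk u) (monomial u) * d 0 $$ (0, k))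
       \<in> mideal.span (I \<inter> forms m)"
      by (rule mideal.span_sum)
    then have "(\<Sum>u\<in>keys ?gk. mscale (lookup ?gk u) (monomial u)) * d 0 $$ (0, k)
       \<in> mideal.span (I \<inter> forms m)"
      by (simp only: sum_distrib_right)
    then show ?thesis by (simp add: sum_mscale_monomial mult.commute[of "d 0 $$ (0, k)"])
  qed
  then have "(\<Sum>k<length (e 1). d 0 $$ (0, k) * lookup g k) \<in> mideal.span (I \<inter> forms m)"
    by (intro mideal.span_sum) simp
  then show "f \<in> mideal.span (I \<inter> forms m)" using g(2) phi_eq by simp
qed

text \<open>The dimension of the degree \<open>t\<close> part of the image of the
  \<open>i\<close>-th map, taken in the integers because the recursion along the resolution
  subtracts.\<close>

definition idim :: "nat \<Rightarrow> nat \<Rightarrow> int" where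
  "idim t i = int (mvec.dim (matmap (d i) ` graded_part (e (Suc i)) t))"

lemma idim_step:
  assumes "i < CARD('n)"
  shows "idim t i = int (mvec.dim (graded_part (e (Suc i)) t :: ('n, 'a) mvector set)) - idim t (Suc i)"
proof -
  have "{f \<in> graded_part (e (Suc i)) t. matmap (d i) f = 0} = matmap (d (Suc i)) ` graded_part (e (Suc (Suc i))) t"
    by (rule graded_exact[OF graded graded exact]) (use assms in auto)
  then show ?thesis
    using matmap_rank_nullity[of "e (Suc i)" t "d i"] by (simp add: idim_def)
qed

lemma idim_last: "idim t CARD('n) = 0"
proof -
  have "(graded_part [] t :: ('n, 'a) mvector set) = {0}"
    by (auto simp: graded_part_def intro: poly_mapping_eqI)
  moreover have "matmap (d CARD('n)) 0 = 0"
    by (rule poly_mapping_eqI) (simp add: lookup_matmap)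
  ultimately show ?thesis
    using mvec.dim_eq_card[of "{}" "{0}"] by (simp add: idim_def e_last mvec.independent_empty)
qed

text \<open>Descending induction from the zero module at the left end. The generators of the module
  with index \<open>Suc i\<close> have degree at most r + i with i < \<open>CARD('n)\<close>, which
  for t >= r is just the range where \<open>card_shifted_degree_polynomial\<close> applies.\<close>

lemma idim_polynomial:
  assumes "i \<le> CARD('n)"
  shows "\<exists>P :: rat poly. \<forall>t\<ge>r. rat_of_int (idim t i) = poly P (rat_of_nat t)"
  using assms
proof (induction i rule: inc_induct)
  case base
  show ?case by (rule exI[of _ 0]) (simp add: idim_last)
next
  case (step i)
  then obtain P :: "rat poly" where P: "\<forall>t\<ge>r. rat_of_int (idim t (Suc i)) = poly P (rat_of_nat t)" by blast
  have "\<forall>s. \<exists>P :: rat poly. \<forall>t. s \<le> t + CARD('n) - 1 \<longrightarrow>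
     rat_of_nat (card {u :: 'n pterm. tdeg u + s = t}) = poly P (rat_of_nat t)"
    using card_shifted_degree_polynomial by blast
  then obtain Q :: "nat \<Rightarrow> rat poly" where Q: "\<And>s t. s \<le> t + CARD('n) - 1 \<Longrightarrow>
     rat_of_nat (card {u :: 'n pterm. tdeg u + s = t}) = poly (Q s) (rat_of_nat t)" by metis
  have "rat_of_int (idim t i) = poly ((\<Sum>k<length (e (Suc i)). Q (e (Suc i) ! k)) - P) (rat_of_nat t)"
    if t: "t \<ge> r" for t
  proof -
    have "rat_of_nat (card {u :: 'n pterm. tdeg u + e (Suc i) ! k = t}) = poly (Q (e (Suc i) ! k)) (rat_of_nat t)"
      if "k < length (e (Suc i))" for k
      by (rule Q) (use degree_bound[OF step(2), of "e (Suc i) ! k"] that t step(2) in auto)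
    then show ?thesis
      using P t step(2) by (simp add: idim_step dim_graded_part poly_sum)
  qed
  then show ?case by blast
qed

text \<open>The target of \<open>d 0\<close> has rank one, so reading off entry 0 is injective on
  the image.\<close>

lemma dim_I_forms: "int (mpoly.dim (I \<inter> forms t)) = idim t 0"
proof -
  have lin: "Vector_Spaces.linear vscale mscale (\<lambda>f :: ('n, 'a) mvector. lookup f 0)"
    unfolding Vector_Spaces.linear_iff
    by (simp add: mvec.vector_space_axioms mpoly.vector_space_axioms lookup_add)
  have pair: "vector_space_pair (vscale :: 'a \<Rightarrow> ('n, 'a) mvector \<Rightarrow> _) (mscale :: 'a \<Rightarrow> ('n, 'a) mpoly \<Rightarrow> _)"
    by (simp add: vector_space_pair_def mvec.vector_space_axioms mpoly.vector_space_axioms)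
  let ?U = "matmap (d 0) ` graded_part (e 1) t"
  have sub: "?U \<subseteq> graded_part (e 0) t" using matmap_graded_part[OF graded[of 0]] by auto
  have "mpoly.dim ((\<lambda>f. lookup f 0) ` ?U) = mvec.dim ?U"
  proof (rule vector_space_pair.dim_image_inj[OF pair lin])
    show "finite (basis_mvector ` graded_basis_index (e 0) t :: ('n, 'a) mvector set)" by simp
    show "?U \<subseteq> mvec.span (basis_mvector ` graded_basis_index (e 0) t)"
      using sub span_graded_part by blast
    show "mvec.subspace ?U"
      using module_hom.subspace_image[OF _ subspace_graded_part, of vscale "matmap (d 0)"]
        matmap_linear[of "d 0"] by (simp add: module_hom_iff_linear)
    fix f assume f: "f \<in> ?U" "lookup f 0 = 0"
    show "f = 0"
    proof (rule poly_mapping_eqI)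
      fix k show "lookup f k = lookup 0 k"
        using f sub e0 by (cases k) (auto simp: graded_part_def)
    qed
  qed
  then show ?thesis by (simp add: I_forms idim_def image_image phi_def)
qed

end

lemma poly_eq_of_eventually_eq:
  fixes P Q :: "rat poly"
  assumes "\<And>t. t \<ge> t0 \<Longrightarrow> poly P (rat_of_nat t) = poly Q (rat_of_nat t)"
  shows "P = Q"
proof (rule ccontr)
  assume "P \<noteq> Q"
  then have "finite {x. poly (P - Q) x = 0}" using poly_roots_finite[of "P - Q"] by simp
  moreover have "rat_of_nat ` {t0..} \<subseteq> {x. poly (P - Q) x = 0}" using assms by auto
  ultimately have "finite (rat_of_nat ` {t0..})" by (rule finite_subset[rotated])
  then have "finite {t0..}" by (rule finite_imageD) (simp add: inj_on_def)
  then show False by (simp add: infinite_Ici)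
qed

lemma rat_hilbert_function:
  fixes I :: "('n::finite, 'a::field) mpoly set"
  shows "rat_of_nat (hilbert_function I t) =
    rat_of_nat (card {u :: 'n pterm. tdeg u = t}) - rat_of_nat (mpoly.dim (I \<inter> forms t))"
  using dim_mono_forms[of "I \<inter> forms t" "forms t" t]
  by (simp add: hilbert_function_def dim_forms of_nat_diff)

text \<open>The resolution yields some polynomial valid from r on. It agrees with \<open>p\<close>
  at all large integers and is therefore equal to \<open>p\<close>.\<close>

lemma hilbert_function_regular:
  fixes I :: "('n::finite, 'a::field) mpoly set"
  assumes "mumford_regular r I" "I \<in> subscheme_ideals p" "r \<le> t"
  shows "rat_of_nat (hilbert_function I t) = poly p (rat_of_nat t)"
proof -
  obtain e d where "graded_resolution r I e d" using assms(1) mumford_regular_iff by blast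
  then interpret graded_resolution r I e d .
  obtain P :: "rat poly" where P: "\<forall>t\<ge>r. rat_of_int (idim t 0) = poly P (rat_of_nat t)"
    using idim_polynomial[of 0] by blast
  obtain Q :: "rat poly" where Q: "\<And>t. rat_of_nat (card {u :: 'n pterm. tdeg u + 0 = t}) = poly Q (rat_of_nat t)"
    using card_shifted_degree_polynomial[of 0, where 'n='n] by auto
  have dimI: "rat_of_nat (mpoly.dim (I \<inter> forms t)) = poly P (rat_of_nat t)" if "t \<ge> r" for t
    using P that dim_I_forms[of t] by (metis of_int_of_nat_eq)
  have *: "rat_of_nat (hilbert_function I t) = poly (Q - P) (rat_of_nat t)" if "t \<ge> r" for t
    using Q[of t] dimI[OF that] by (simp add: rat_hilbert_function)
  obtain t0 where t0: "\<And>t. t \<ge> t0 \<Longrightarrow> rat_of_nat (hilbert_function I t) = poly p (rat_of_nat t)"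
    using assms(2) by (auto simp: subscheme_ideals_def)
  have "Q - P = p"
  proof (rule poly_eq_of_eventually_eq)
    fix t assume "t \<ge> max t0 r"
    then show "poly (Q - P) (rat_of_nat t) = poly p (rat_of_nat t)" using *[of t] t0[of t] by simp
  qed
  then show ?thesis using * assms(3) by simp
qed

lemma regular_generators:
  fixes I :: "('n::finite, 'a::field) mpoly set"
  assumes "mumford_regular r I" "I \<in> subscheme_ideals p" "r \<le> m" "m \<le> t"
  shows "I \<inter> forms t \<subseteq> mideal.span (I \<inter> forms m)"
proof -
  obtain e d where "graded_resolution r I e d" using assms(1) mumford_regular_iff by blast
  then interpret graded_resolution r I e d .
  show ?thesis
    using generators[OF assms(3,4)] assms(2) by (simp add: subscheme_ideals_def homogeneous_ideal_def)
qed

lemma regular_saturation_truncation: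
  fixes I :: "('n::finite, 'a::field) mpoly set"
  assumes "mumford_regular r I" "I \<in> subscheme_ideals p" "r \<le> m"
  shows "saturation (mideal.span (I \<inter> forms m)) = I"
  using assms regular_generators[OF assms]
  by (intro saturation_truncation) (auto simp: subscheme_ideals_def)

section \<open>Leading terms and initial ideals\<close>

lemma drl_less_irrefl [simp]: "\<not> drl_less a a"
  by (auto simp: drl_less_def)

lemma drl_le_tdeg: "drl_le a b \<Longrightarrow> tdeg a = tdeg b"
  by (auto simp: drl_le_def drl_less_def)

lemma drl_less_trans:
  assumes "drl_less a b" "drl_less b c"
  shows "drl_less a c"
proof -
  obtain k where k: "lookup a k > lookup b k"
    "\<And>i. i < k \<Longrightarrow> lookup a i = lookup b i"
    using assms(1) by (auto simp: drl_less_def)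
  obtain l where l: "lookup b l > lookup c l"
    "\<And>i. i < l \<Longrightarrow> lookup b i = lookup c i"
    using assms(2) by (auto simp: drl_less_def)
  have "lookup a (min k l) > lookup c (min k l)"
    using k l by (cases k l rule: linorder_cases) (auto simp: min_def)
  moreover have "lookup a i = lookup c i" if "i < min k l" for i
    using that k(2) l(2) by simp
  ultimately show ?thesis using assms by (auto simp: drl_less_def)
qed

lemma drl_less_total:
  fixes a b :: "'n::{finite,linorder} pterm"
  assumes "tdeg a = tdeg b" "a \<noteq> b"
  shows "drl_less a b \<or> drl_less b a"
proof -
  let ?D = "{i. lookup a i \<noteq> lookup b i}"
  have ne: "?D \<noteq> {}" using assms(2) by (auto intro: poly_mapping_eqI)
  let ?k = "Min ?D"
  have "?k \<in> ?D" by (rule Min_in[OF finite ne])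
  moreover have "lookup a i = lookup b i" if "i < ?k" for i
  proof (rule ccontr)
    assume "lookup a i \<noteq> lookup b i"
    then have "?k \<le> i" by (intro Min_le) auto
    then show False using that by simp
  qed
  ultimately show ?thesis using assms(1) unfolding drl_less_def
    by (metis (mono_tags, lifting) linorder_neqE_nat mem_Collect_eq)
qed

lemma drl_less_asym: "drl_less a b \<Longrightarrow> \<not> drl_less b a"
  using drl_less_trans drl_less_irrefl by blast

lemma drl_le_trans: "drl_le a b \<Longrightarrow> drl_le b c \<Longrightarrow> drl_le a c"
  using drl_less_trans by (auto simp: drl_le_def)

lemma drl_le_refl [simp]: "drl_le a a"
  by (simp add: drl_le_def)

lemma drl_less_add: "drl_less a b \<Longrightarrow> drl_less (a + w) (b + w)"
  by (auto simp: drl_less_def lookup_add)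

lemma drl_le_add: "drl_le a b \<Longrightarrow> drl_le (a + w) (b + w)"
  using drl_less_add by (auto simp: drl_le_def)

definition x0 :: "'n::{finite,linorder}" where "x0 = Min UNIV"

lemma x0_le [simp]: "(x0 :: 'n::{finite,linorder}) \<le> i"
  by (simp add: x0_def)

lemma not_less_x0 [simp]: "\<not> i < (x0 :: 'n::{finite,linorder})"
  by (simp add: not_less)

text \<open>The exponent of \<open>x0\<close> is compared first, and the larger exponent belongs to
  the smaller term. This is the property that ties degrevlex to divisibility by powers of
  \<open>x0\<close>.\<close>

lemma drl_le_lookup_x0:
  fixes a b :: "'n::{finite,linorder} pterm"
  assumes "drl_le a b"
  shows "lookup b x0 \<le> lookup a x0"
proof (cases "a = b")
  case False
  then obtain k where k: "lookup a k > lookup b k"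
    "\<And>i. i < k \<Longrightarrow> lookup a i = lookup b i"
    using assms by (auto simp: drl_less_def drl_le_def)
  show ?thesis using k by (cases "k = x0") (auto simp: order.strict_iff_order)
qed simp

lemma drl_max_exists:
  fixes A :: "'n::{finite,linorder} pterm set"
  assumes "finite A" "A \<noteq> {}" "\<And>u. u \<in> A \<Longrightarrow> tdeg u = t"
  shows "\<exists>a\<in>A. \<forall>v\<in>A. drl_le v a"
  using assms
proof (induction A rule: finite_ne_induct)
  case (insert x F)
  then obtain a where a: "a \<in> F" "\<forall>v\<in>F. drl_le v a" by auto
  have "tdeg x = tdeg a" using insert.prems a(1) by simp
  then consider "drl_le x a" | "drl_less a x"
    using drl_less_total[of x a] by (auto simp: drl_le_def)
  then show ?case
  proof cases
    case 1
    then show ?thesis using a by blast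
  next
    case 2
    then have "\<forall>v\<in>F. drl_le v x" using a(2) drl_le_trans by (auto simp: drl_le_def)
    then show ?thesis by (intro bexI[of _ x]) auto
  qed
qed simp

text \<open>\<open>drl_le\<close> relates terms of equal degree only, so a polynomial with a leading
  term in this sense is a form, and \<open>lts\<close> of an ideal is computed from its homogeneous
  elements.\<close>

definition is_lt :: "('n::linorder, 'a::zero) mpoly \<Rightarrow> 'n pterm \<Rightarrow> bool" where
  "is_lt f u \<longleftrightarrow> u \<in> keys f \<and> (\<forall>v\<in>keys f. drl_le v u)"

definition lts :: "('n::linorder, 'a::zero) mpoly set \<Rightarrow> 'n pterm set" where
  "lts U = {u. \<exists>f\<in>U. is_lt f u}"

lemma is_lt_forms: "is_lt f u \<Longrightarrow> f \<in> forms (tdeg u)"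
  by (auto simp: is_lt_def forms_def dest: drl_le_tdeg)

lemma is_lt_unique: "is_lt f u \<Longrightarrow> is_lt f v \<Longrightarrow> u = v"
  using drl_less_asym by (auto simp: is_lt_def drl_le_def)

lemma is_lt_exists:
  fixes f :: "('n::{finite,linorder}, 'a::zero) mpoly"
  assumes "f \<in> forms t" "f \<noteq> 0"
  shows "\<exists>u. is_lt f u"
proof -
  have "keys f \<noteq> {}"
  proof
    assume "keys f = {}"
    then have "f = 0" by (intro poly_mapping_eqI) (simp flip: not_in_keys_iff_lookup_eq_zero)
    then show False using assms(2) by simp
  qed
  then show ?thesis
    using drl_max_exists[of "keys f" t] assms(1) by (auto simp: is_lt_def forms_def)
qed

lemma tslice_lts: "tslice (lts H) t = lts (H \<inter> forms t)"
proof (rule equalityI; rule subsetI)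
  fix u assume "u \<in> tslice (lts H) t"
  then show "u \<in> lts (H \<inter> forms t)" using is_lt_forms by (auto simp: tslice_def lts_def)
next
  fix u assume "u \<in> lts (H \<inter> forms t)"
  then show "u \<in> tslice (lts H) t" by (auto simp: tslice_def lts_def is_lt_def forms_def)
qed

text \<open>Induction on \<open>A\<close> by removing its largest term a. The coefficient at a is a
  functional on \<open>U\<close> which is nonzero exactly when a is a leading term, and its kernel
  lives on the remaining terms.\<close>

lemma dim_eq_card_lts_supported:
  fixes U :: "('n::{finite,linorder}, 'a::field) mpoly set"
  assumes "finite A" "\<And>u. u \<in> A \<Longrightarrow> tdeg u = t" "mpoly.subspace U" "U \<subseteq> supported A"
  shows "mpoly.dim U = card (lts U)"
  using assms
proof (induction "card A" arbitrary: A U)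
  case 0
  then have "U \<subseteq> {0}" by (auto simp: supported_def intro!: poly_mapping_eqI simp flip: not_in_keys_iff_lookup_eq_zero)
  then have "lts U = {}" by (auto simp: lts_def is_lt_def)
  moreover have "mpoly.dim U = 0"
    using mpoly.dim_le_card[of U "{}"] \<open>U \<subseteq> {0}\<close> by simp
  ultimately show ?case by simp
next
  case (Suc k)
  then have "A \<noteq> {}" by auto
  then obtain a where a: "a \<in> A" "\<forall>v\<in>A. drl_le v a"
    using drl_max_exists[OF Suc.prems(1)] Suc.prems(2) by blast
  have lt_a: "is_lt f a" if "f \<in> U" "lookup f a \<noteq> 0" for f
    using that a Suc.prems(4) by (auto simp: is_lt_def supported_def in_keys_iff subset_iff)
  let ?U' = "{f\<in>U. lookup f a = 0}"
  have sub': "mpoly.subspace ?U'"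
    using Suc.prems(3) by (auto simp: mpoly.subspace_def lookup_add)
  have supp': "?U' \<subseteq> supported (A - {a})"
    using Suc.prems(4) by (auto simp: supported_def)
  have IH: "mpoly.dim ?U' = card (lts ?U')"
    by (rule Suc.hyps(1)[OF _ _ _ sub' supp']) (use Suc.hyps(2) Suc.prems(1,2) a(1) in auto)
  show ?case
  proof (cases "\<exists>f\<in>U. lookup f a \<noteq> 0")
    case False
    then have "?U' = U" by auto
    then show ?thesis using IH by simp
  next
    case True
    then obtain f0 where f0: "f0 \<in> U" "lookup f0 a \<noteq> 0" by blast
    \<comment> \<open>The functional takes its values in the constants, so that
      \<open>rank_nullity\<close> between polynomial spaces applies.\<close>
    let ?phi = "\<lambda>f :: ('n, 'a) mpoly. mscale (lookup f a) (1 :: ('n, 'a) mpoly)"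
    have lin: "Vector_Spaces.linear mscale mscale ?phi"
      by (rule linear_mscaleI) (simp_all add: lookup_add mpoly.scale_left_distrib)
    have phi0: "?phi f = 0 \<longleftrightarrow> lookup f a = 0" for f
      by (metis (no_types) mpoly.scale_eq_0_iff zero_neq_one)
    have "mpoly.dim U = mpoly.dim {f\<in>U. ?phi f = 0} + mpoly.dim (?phi ` U)"
      by (rule vector_space_pair.rank_nullity[OF vector_space_pair_mscale lin, of "monomial ` A"])
        (use Suc.prems in \<open>auto simp: span_monomials\<close>)
    then have "mpoly.dim U = mpoly.dim ?U' + mpoly.dim (?phi ` U)" by (simp only: phi0)
    moreover have "mpoly.dim (?phi ` U) = 1"
    proof -
      have "?phi ` U = mpoly.span {1}"
      proof (rule equalityI)
        show "mpoly.span {1} \<subseteq> ?phi ` U"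
        proof
          fix g :: "('n, 'a) mpoly" assume "g \<in> mpoly.span {1}"
          then obtain c where g: "g = mscale c 1" by (auto simp: mpoly.span_singleton)
          let ?f = "mscale (c / lookup f0 a) f0"
          have "?f \<in> U" using f0(1) Suc.prems(3) by (simp add: mpoly.subspace_scale)
          moreover have "?phi ?f = g" using f0(2) g by simp
          ultimately show "g \<in> ?phi ` U" by blast
        qed
      qed (auto intro: mpoly.span_scale mpoly.span_base)
      moreover have "mpoly.dim {1 :: ('n, 'a) mpoly} = 1"
        using mpoly.dim_eq_card_independent[of "{1}"] by simp
      ultimately show ?thesis by simp
    qed
    moreover have "lts U = insert a (lts ?U')"
    proof (rule equalityI; rule subsetI)
      fix u assume "u \<in> lts U"
      then obtain f where f: "f \<in> U" "is_lt f u" by (auto simp: lts_def)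
      show "u \<in> insert a (lts ?U')"
      proof (cases "lookup f a = 0")
        case True
        then show ?thesis using f by (auto simp: lts_def)
      next
        case False
        then show ?thesis using lt_a[OF f(1)] f(2) is_lt_unique by blast
      qed
    next
      fix u assume "u \<in> insert a (lts ?U')"
      then show "u \<in> lts U" using lt_a[OF f0] f0(1) by (auto simp: lts_def)
    qed
    moreover have "a \<notin> lts ?U'" by (auto simp: lts_def is_lt_def in_keys_iff)
    moreover have "finite (lts ?U')"
      by (rule finite_subset[OF _ Suc.prems(1)]) (use supp' in \<open>auto simp: lts_def is_lt_def supported_def\<close>)
    ultimately show ?thesis using IH by simp
  qed
qed

lemma dim_eq_card_lts:
  fixes U :: "('n::{finite,linorder}, 'a::field) mpoly set"
  assumes "mpoly.subspace U" "U \<subseteq> forms t"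
  shows "mpoly.dim U = card (lts U)"
  by (rule dim_eq_card_lts_supported[of "{u. tdeg u = t}" t]) (use assms in \<open>auto simp: forms_eq_supported\<close>)

lemma lts_subset_forms: "U \<subseteq> forms t \<Longrightarrow> lts U \<subseteq> {u. tdeg u = t}"
  by (auto simp: lts_def is_lt_def forms_def)

lemma is_lt_monomial_mult:
  fixes f :: "('n::linorder, 'a::comm_ring_1) mpoly"
  shows "is_lt f u \<Longrightarrow> is_lt (monomial w * f) (w + u)"
  using drl_le_add by (auto simp: is_lt_def keys_monomial_mult add.commute[of w])

lemma upclosed_lts:
  fixes H :: "('n::linorder, 'a::comm_ring_1) mpoly set"
  assumes "mideal.subspace H"
  shows "upclosed (lts H)"
  unfolding upclosed_def
proof (intro ballI allI)
  fix u w assume "u \<in> lts H"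
  then obtain f where "f \<in> H" "is_lt f u" by (auto simp: lts_def)
  then have "monomial w * f \<in> H" "is_lt (monomial w * f) (u + w)"
    using assms is_lt_monomial_mult[of f u w] by (auto simp: mideal.subspace_scale add.commute)
  then show "u + w \<in> lts H" by (auto simp: lts_def)
qed

lemma subspace_Int_forms:
  fixes H :: "('n, 'a::field) mpoly set"
  assumes "mideal.subspace H"
  shows "mpoly.subspace (H \<inter> forms t)"
  using mpoly.subspace_inter[OF ideal_subspace[OF assms] subspace_forms] .

lemma card_tslice_lts:
  fixes H :: "('n::{finite,linorder}, 'a::field) mpoly set"
  assumes "mideal.subspace H"
  shows "card (tslice (lts H) t) = mpoly.dim (H \<inter> forms t)"
  using dim_eq_card_lts[OF subspace_Int_forms[OF assms] Int_lower2] by (simp add: tslice_lts)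

text \<open>
  The saturation of the initial ideal of a saturated ideal over any field is a monomial ideal, so
  it can be regarded over the ground field, where the regularity hypothesis applies to it.
\<close>

locale gotzmann =
  fixes p :: "rat poly" and r m q :: nat and ground :: "'a::field itself"
    and vars :: "'n::{finite,linorder} itself"
  assumes regular: "\<And>I :: ('n, 'a) mpoly set. I \<in> subscheme_ideals p \<Longrightarrow> mumford_regular r I"
    and r_le: "r \<le> m"
    and q_eq: "rat_of_nat q =
           rat_of_nat ((CARD('n) - 1 + m) choose (CARD('n) - 1)) - poly p (rat_of_nat m)"
begin

lemma q_eq': "rat_of_nat q = rat_of_nat (card {u :: 'n pterm. tdeg u = m}) - poly p (rat_of_nat m)"
proof -
  have "CARD('n) - 1 + m = m + CARD('n) - 1" using zero_less_card_finite[where 'a='n] by linarith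
  then show ?thesis using q_eq by (simp only: card_tdeg_eq)
qed

text \<open>A priori the saturation could add terms to the initial ideal. In degree m both have
  exactly q terms, by regularity of the saturation and the choice of q; in higher degrees the
  saturation is generated by its part of degree m and cannot grow either.\<close>

lemma initial_ideal:
  fixes H :: "('n, 'k::field) mpoly set"
  assumes H: "H \<in> subscheme_ideals p" and dim: "mpoly.dim (H \<inter> forms m) = q"
  shows "(supported (satT (lts H)) :: ('n, 'a) mpoly set) \<in> subscheme_ideals p"
    and "m \<le> t \<Longrightarrow> tslice (satT (lts H)) t = tslice (lts H) t"
    and "saturation (mideal.span (mpoly.span (monomial ` tslice (lts H) m))) =
      (supported (satT (lts H)) :: ('n, 'a) mpoly set)"
proof -
  let ?T = "lts H"
  have idH: "mideal.subspace H" using H by (simp add: subscheme_ideals_def homogeneous_ideal_def)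
  have up: "upclosed ?T" by (rule upclosed_lts[OF idH])
  have HF: "rat_of_nat (card {u :: 'n pterm. tdeg u = t} - card (tslice ?T t)) = rat_of_nat (hilbert_function H t)" for t
    by (simp add: hilbert_function_def dim_forms card_tslice_lts[OF idH])
  obtain t0 where "\<And>t. t \<ge> t0 \<Longrightarrow> rat_of_nat (hilbert_function H t) = poly p (rat_of_nat t)"
    using H by (auto simp: subscheme_ideals_def)
  then show G: "(supported (satT ?T) :: ('n, 'a) mpoly set) \<in> subscheme_ideals p" (is "?G \<in> _")
    by (intro supported_satT_in_subscheme_ideals[OF up]) (simp add: HF)
  have sub: "tslice ?T t \<subseteq> tslice (satT ?T) t" for t
    using subset_satT[OF up] by (auto simp: tslice_def)
  have m: "tslice (satT ?T) m = tslice ?T m"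
  proof -
    have "rat_of_nat (card {u :: 'n pterm. tdeg u = m}) - rat_of_nat (card (tslice (satT ?T) m)) = poly p (rat_of_nat m)"
      using hilbert_function_regular[OF regular[OF G] G r_le]
      by (simp add: rat_hilbert_function dim_supported_Int_forms)
    then have "rat_of_nat (card (tslice (satT ?T) m)) = rat_of_nat q" using q_eq' by simp
    then have "card (tslice (satT ?T) m) = card (tslice ?T m)" using dim card_tslice_lts[OF idH] by simp
    then show ?thesis using card_subset_eq[OF finite_tslice sub] by metis
  qed
  show "tslice (satT ?T) t = tslice ?T t" if t: "m \<le> t"
  proof
    show "tslice (satT ?T) t \<subseteq> tslice ?T t"
    proof
      fix u assume u: "u \<in> tslice (satT ?T) t"
      have "(monomial u :: ('n, 'a) mpoly) \<in> ?G \<inter> forms t"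
        using u by (simp add: supported_Int_forms)
      then have "(monomial u :: ('n, 'a) mpoly) \<in> mideal.span (?G \<inter> forms m)"
        using regular_generators[OF regular[OF G] G r_le t] by blast
      then have "(monomial u :: ('n, 'a) mpoly) \<in> supported {a + w |a w. a \<in> tslice ?T m}"
        by (simp only: supported_Int_forms m ideal_generated_supported)
      then have "u \<in> ?T" using up by (auto simp: upclosed_def tslice_def)
      then show "u \<in> tslice ?T t" using u by (simp add: tslice_def)
    qed
  qed (rule sub)
  have "saturation (mideal.span (?G \<inter> forms m)) = ?G"
    by (rule regular_saturation_truncation[OF regular[OF G] G r_le])
  then show "saturation (mideal.span (mpoly.span (monomial ` tslice ?T m))) = ?G"
    by (simp only: supported_Int_forms m span_monomials)
qed

end

section \<open>Pluecker coordinates and leading terms\<close>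

definition family_basis :: "nat \<Rightarrow> (nat \<Rightarrow> ('n, 'k::field) mpoly) \<Rightarrow> ('n, 'k) mpoly set \<Rightarrow> bool" where
  "family_basis q b V \<longleftrightarrow>
     inj_on b {..<q} \<and> mpoly.independent (b ` {..<q}) \<and> mpoly.span (b ` {..<q}) = V"

text \<open>The basis-free counterpart of a nonzero Pluecker coordinate: for \<open>M\<close> of
  length dim \<open>V\<close>, restriction to the coefficients at \<open>M\<close> is injective on
  \<open>V\<close>.\<close>

definition coordinates_of :: "('n, 'k::zero) mpoly set \<Rightarrow> 'n pterm list \<Rightarrow> bool" where
  "coordinates_of V M \<longleftrightarrow> (\<forall>f\<in>V. (\<forall>u\<in>set M. lookup f u = 0) \<longrightarrow> f = 0)"

lemma family_basis_span:
  assumes "family_basis q b V"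
  shows "f \<in> V \<longleftrightarrow> (\<exists>c. f = (\<Sum>i<q. mscale (c i) (b i)))"
proof
  assume "f \<in> V"
  then have "f \<in> mpoly.span (b ` {..<q})" using assms by (simp add: family_basis_def)
  then obtain u where "f = (\<Sum>v\<in>b ` {..<q}. mscale (u v) v)"
    by (auto simp: mpoly.span_finite)
  also have "\<dots> = (\<Sum>i<q. mscale (u (b i)) (b i))"
    using assms by (simp add: family_basis_def sum.reindex)
  finally show "\<exists>c. f = (\<Sum>i<q. mscale (c i) (b i))" by (rule exI[of _ "\<lambda>i. u (b i)"])
next
  assume "\<exists>c. f = (\<Sum>i<q. mscale (c i) (b i))"
  then obtain c where f: "f = (\<Sum>i<q. mscale (c i) (b i))" by blast
  have "f \<in> mpoly.span (b ` {..<q})"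
    unfolding f by (intro mpoly.span_sum mpoly.span_scale mpoly.span_base) auto
  then show "f \<in> V" using assms by (simp add: family_basis_def)
qed

lemma family_basis_independent:
  assumes b: "family_basis q b V" and sum: "(\<Sum>i<q. mscale (c i) (b i)) = 0" and i: "i < q"
  shows "c i = 0"
proof -
  have inj: "inj_on b {..<q}" and ind: "mpoly.independent (b ` {..<q})"
    using b by (auto simp: family_basis_def)
  let ?u = "\<lambda>v. c (the_inv_into {..<q} b v)"
  have "(\<Sum>v\<in>b ` {..<q}. mscale (?u v) v) = (\<Sum>i<q. mscale (c i) (b i))"
    using inj by (subst sum.reindex) (auto simp: the_inv_into_f_f intro!: sum.cong)
  then have "?u (b i) = 0"
    using mpoly.independentD[OF ind finite_imageI[OF finite_lessThan] subset_refl, of ?u "b i"] sum i by auto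
  then show ?thesis using the_inv_into_f_f[OF inj] i by simp
qed

lemma family_basisI:
  assumes "\<And>f. f \<in> V \<longleftrightarrow> (\<exists>c. f = (\<Sum>i<q. mscale (c i) (b i)))"
    and "\<And>c. (\<Sum>i<q. mscale (c i) (b i)) = 0 \<Longrightarrow> \<forall>i\<in>{..<q}. c i = 0"
  shows "family_basis q b V"
proof -
  have *: "inj_on b {..<q}" "mpoly.independent (b ` {..<q})"
    using mpoly.independent_family[of "{..<q}" b] assms(2) by auto
  then have "family_basis q b (mpoly.span (b ` {..<q}))" by (simp add: family_basis_def)
  then have "mpoly.span (b ` {..<q}) = V" using family_basis_span assms(1) by blast
  then show ?thesis using * by (simp add: family_basis_def)
qed

text \<open>A vector in the kernel of the transposed coefficient matrix is the same as a combination
  of the basis whose coefficients at the terms of \<open>M\<close> all vanish.\<close>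

lemma pluecker_nonzero_iff:
  assumes b: "family_basis q b V" and M: "length M = q"
  shows "pluecker q b M \<noteq> 0 \<longleftrightarrow> coordinates_of V M"
proof -
  let ?A = "Matrix.mat q q (\<lambda>(i, j). lookup (b i) (M ! j))"
  let ?B = "transpose_mat ?A"
  let ?f = "\<lambda>v. \<Sum>i<q. mscale (vec_index v i) (b i)"
  have carr: "?A \<in> carrier_mat q q" "?B \<in> carrier_mat q q" by auto
  have det: "pluecker q b M = Determinant.det ?B"
    using det_transpose[OF carr(1)] by (simp add: pluecker_def)
  have Bv: "?B *\<^sub>v v = 0\<^sub>v q \<longleftrightarrow> (\<forall>u\<in>set M. lookup (?f v) u = 0)"
    if v: "v \<in> carrier_vec q" for v
  proof -
    have idx: "vec_index (?B *\<^sub>v v) j = lookup (?f v) (M ! j)" if "j < q" for j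
      using that v by (simp add: scalar_prod_def lookup_sum atLeast0LessThan mult.commute)
    have "?B *\<^sub>v v = 0\<^sub>v q \<longleftrightarrow> (\<forall>j<q. vec_index (?B *\<^sub>v v) j = 0)"
    proof (intro iffI allI impI)
      fix j assume "?B *\<^sub>v v = 0\<^sub>v q" "j < q"
      then show "vec_index (?B *\<^sub>v v) j = 0" by (simp only: index_zero_vec)
    next
      assume "\<forall>j<q. vec_index (?B *\<^sub>v v) j = 0"
      then show "?B *\<^sub>v v = 0\<^sub>v q"
        by (intro eq_vecI) (simp_all only: index_zero_vec dim_mult_mat_vec carrier_matD[OF carr(2)])
    qed
    also have "\<dots> \<longleftrightarrow> (\<forall>j<q. lookup (?f v) (M ! j) = 0)" using idx by simp
    also have "\<dots> \<longleftrightarrow> (\<forall>u\<in>set M. lookup (?f v) u = 0)" by (simp only: all_set_conv_all_nth M)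
    finally show ?thesis .
  qed
  have "Determinant.det ?B = 0 \<longleftrightarrow> (\<exists>v. v \<in> carrier_vec q \<and> v \<noteq> 0\<^sub>v q \<and> ?B *\<^sub>v v = 0\<^sub>v q)"
    by (rule det_0_iff_vec_prod_zero_field[OF carr(2)])
  also have "\<dots> \<longleftrightarrow> (\<exists>f\<in>V. f \<noteq> 0 \<and> (\<forall>u\<in>set M. lookup f u = 0))"
  proof
    assume "\<exists>v. v \<in> carrier_vec q \<and> v \<noteq> 0\<^sub>v q \<and> ?B *\<^sub>v v = 0\<^sub>v q"
    then obtain v where v: "v \<in> carrier_vec q" "v \<noteq> 0\<^sub>v q" "?B *\<^sub>v v = 0\<^sub>v q" by blast
    have "?f v \<in> V" using family_basis_span[OF b] by blast
    moreover have "?f v \<noteq> 0"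
    proof
      assume "?f v = 0"
      then have "v = 0\<^sub>v q" using family_basis_independent[OF b] v(1) by (intro eq_vecI) auto
      then show False using v(2) by simp
    qed
    ultimately show "\<exists>f\<in>V. f \<noteq> 0 \<and> (\<forall>u\<in>set M. lookup f u = 0)"
      using Bv[OF v(1)] v(3) by blast
  next
    assume "\<exists>f\<in>V. f \<noteq> 0 \<and> (\<forall>u\<in>set M. lookup f u = 0)"
    then obtain f where f: "f \<in> V" "f \<noteq> 0" "\<forall>u\<in>set M. lookup f u = 0" by blast
    then obtain c where c: "f = (\<Sum>i<q. mscale (c i) (b i))" using family_basis_span[OF b] by blast
    let ?v = "Matrix.vec q c"
    have fv: "?f ?v = f" unfolding c by (rule sum.cong) auto
    have "?v \<noteq> 0\<^sub>v q"
    proof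
      assume *: "?v = 0\<^sub>v q"
      have "?f ?v = 0" unfolding * by (rule sum.neutral) simp
      then show False using fv f(2) by simp
    qed
    moreover have "?B *\<^sub>v ?v = 0\<^sub>v q" using Bv[of ?v] f(3) fv by simp
    ultimately show "\<exists>v. v \<in> carrier_vec q \<and> v \<noteq> 0\<^sub>v q \<and> ?B *\<^sub>v v = 0\<^sub>v q"
      by (intro exI[of _ ?v]) auto
  qed
  finally show ?thesis using det by (auto simp: coordinates_of_def)
qed

lemma grassmannian_subset_span:
  "V \<in> grassmannian q m \<Longrightarrow> V \<subseteq> mpoly.span (monomial ` {u :: 'n::finite pterm. tdeg u = m} :: ('n, 'k::field) mpoly set)"
  by (auto simp: span_monomials grassmannian_def forms_eq_supported)

lemma family_basis_exists:
  fixes V :: "('n::finite, 'k::field) mpoly set"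
  assumes "V \<in> grassmannian q m"
  obtains b where "family_basis q b V"
proof -
  have V: "mpoly.subspace V" "mpoly.dim V = q" using assms by (auto simp: grassmannian_def)
  obtain B where B: "B \<subseteq> V" "mpoly.independent B" "finite B" "mpoly.span B = V" "card B = mpoly.dim V"
    using mpoly.finite_basis_exists[OF _ grassmannian_subset_span[OF assms] V(1)] by auto
  then obtain b where "bij_betw b {0..<q} B" using ex_bij_betw_nat_finite[of B] V(2) by auto
  then have "family_basis q b V"
    using B by (auto simp: family_basis_def bij_betw_def atLeast0LessThan)
  then show ?thesis using that by blast
qed

lemma field_embedding_simps:
  assumes "field_embedding \<iota>"
  shows "\<iota> 0 = 0" "\<iota> 1 = 1" "\<iota> (x + y) = \<iota> x + \<iota> y" "\<iota> (x * y) = \<iota> x * \<iota> y" "\<iota> (- x) = - \<iota> x"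
    "\<iota> (x - y) = \<iota> x - \<iota> y" "\<iota> x = 0 \<longleftrightarrow> x = 0"
proof -
  show 1: "\<iota> 1 = 1" and a: "\<And>x y. \<iota> (x + y) = \<iota> x + \<iota> y" and m: "\<And>x y. \<iota> (x * y) = \<iota> x * \<iota> y"
    using assms by (auto simp: field_embedding_def)
  show 0: "\<iota> 0 = 0" using a[of 0 0] by (metis add_0 add_right_cancel)
  show n: "\<iota> (- x) = - \<iota> x" for x using a[of x "- x"] 0 by (simp add: eq_neg_iff_add_eq_0 add.commute)
  show "\<iota> (x - y) = \<iota> x - \<iota> y" using a[of x "- y"] n[of y] by simp
  show "\<iota> x = 0 \<longleftrightarrow> x = 0"
  proof
    assume "\<iota> x = 0"
    then show "x = 0" using m[of x "inverse x"] 1 by (cases "x = 0") auto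
  qed (simp add: 0)
qed

lemma meval_0 [simp]: "meval h c 0 = 0"
  by (simp add: meval_def)

lemma linear_form_in_pluecker_point_iff:
  assumes "F \<in> pluecker_ring q m" "F \<in> forms 1"
  shows "F \<in> pluecker_point \<iota> q m V \<longleftrightarrow> (\<forall>b. family_basis q b V \<longrightarrow> meval \<iota> (pluecker q b) F = 0)"
  using assms hcomponent_of_form[OF assms(2)]
  by (auto simp: pluecker_point_def family_basis_def)

lemma Var_in_pluecker_ring: "M \<in> eterms q m \<Longrightarrow> Var M \<in> pluecker_ring q m"
  by (simp add: pluecker_ring_def Var_def monomial_def)

lemma Var_in_forms: "Var v \<in> forms 1"
  by (simp add: forms_def Var_def monomial_def)

lemma meval_Var:
  assumes "field_embedding \<iota>"
  shows "meval \<iota> c (Var v) = c v"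
  by (simp add: meval_def Var_def monomial_def field_embedding_simps[OF assms])

text \<open>Membership in the prime ideal tests every basis, but by
  \<open>pluecker_nonzero_iff\<close> the outcome does not depend on the basis, so one basis
  decides.\<close>

lemma open_chart_iff:
  fixes V :: "('n::{finite,linorder}, 'k::field) mpoly set" and \<iota> :: "'a::field \<Rightarrow> 'k"
  assumes "field_embedding \<iota>" "M \<in> eterms q m" "V \<in> grassmannian q m"
  shows "pluecker_point \<iota> q m V \<in> open_chart M \<longleftrightarrow> coordinates_of V M"
proof -
  have M: "length M = q" using assms(2) by (simp add: eterms_def)
  have "pluecker_point \<iota> q m V \<in> open_chart M \<longleftrightarrow> (\<exists>b. family_basis q b V \<and> pluecker q b M \<noteq> 0)"
    unfolding open_chart_def
    using linear_form_in_pluecker_point_iff[OF Var_in_pluecker_ring[OF assms(2)] Var_in_forms, of \<iota> V]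
    by (simp add: meval_Var[OF assms(1)])
  also have "\<dots> \<longleftrightarrow> coordinates_of V M"
  proof -
    obtain b where "family_basis q b V" using family_basis_exists[OF assms(3)] .
    then show ?thesis using pluecker_nonzero_iff[OF _ M, of _ V] by metis
  qed
  finally show ?thesis .
qed

section \<open>Leading terms as the largest nonvanishing Pluecker coordinate\<close>

lemma drl_sorted_list_exists:
  fixes A :: "'n::{finite,linorder} pterm set"
  assumes "finite A" "\<And>u. u \<in> A \<Longrightarrow> tdeg u = m"
  shows "\<exists>L. set L = A \<and> length L = card A \<and> sorted_wrt (\<lambda>a b. drl_less b a) L"
  using assms
proof (induction "card A" arbitrary: A)
  case 0
  then show ?case by auto
next
  case (Suc k)
  then have "A \<noteq> {}" by auto
  then obtain a where a: "a \<in> A" "\<forall>v\<in>A. drl_le v a"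
    using drl_max_exists[OF Suc.prems(1)] Suc.prems(2) by blast
  have "\<exists>L. set L = A - {a} \<and> length L = card (A - {a}) \<and> sorted_wrt (\<lambda>a b. drl_less b a) L"
    by (rule Suc.hyps(1)) (use Suc.hyps(2) Suc.prems a(1) in auto)
  then obtain L where L: "set L = A - {a}" "length L = card (A - {a})" "sorted_wrt (\<lambda>a b. drl_less b a) L" by blast
  have "set (a # L) = A" "length (a # L) = card A" "sorted_wrt (\<lambda>a b. drl_less b a) (a # L)"
    using L a Suc.hyps(2) Suc.prems(1) by (auto simp: drl_le_def)
  then show ?case by blast
qed

lemma card_lts_grassmannian:
  fixes V :: "('n::{finite,linorder}, 'k::field) mpoly set"
  assumes "V \<in> grassmannian q m"
  shows "card (lts V) = q"
  using dim_eq_card_lts[of V m] assms by (simp add: grassmannian_def)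

lemma lts_eterm_exists:
  fixes V :: "('n::{finite,linorder}, 'k::field) mpoly set"
  assumes "V \<in> grassmannian q m"
  obtains L where "L \<in> eterms q m" "set L = lts V"
proof -
  have sub: "lts V \<subseteq> {u. tdeg u = m}" using assms lts_subset_forms by (auto simp: grassmannian_def)
  then have "finite (lts V)" using finite_subset finite_tdeg by blast
  then show ?thesis
    using drl_sorted_list_exists[of "lts V" m] sub card_lts_grassmannian[OF assms] that
    by (force simp: eterms_def)
qed

lemma coordinates_of_lts:
  fixes V :: "('n::{finite,linorder}, 'k::field) mpoly set"
  assumes "V \<in> grassmannian q m" "set L = lts V"
  shows "coordinates_of V L"
  unfolding coordinates_of_def
proof (intro ballI impI, rule ccontr)
  fix f assume f: "f \<in> V" "\<forall>u\<in>set L. lookup f u = 0" "f \<noteq> 0"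
  have "f \<in> forms m" using f(1) assms(1) by (auto simp: grassmannian_def)
  then obtain u where u: "is_lt f u" using is_lt_exists f(3) by blast
  then have "u \<in> set L" using f(1) assms(2) by (auto simp: lts_def)
  then show False using f(2) u by (auto simp: is_lt_def in_keys_iff)
qed

lemma eterms_distinct: "M \<in> eterms q m \<Longrightarrow> distinct M"
proof -
  assume "M \<in> eterms q m"
  then have "sorted_wrt (\<lambda>a b. drl_less b a) M" by (simp add: eterms_def)
  then show "distinct M" by (induction M) auto
qed

text \<open>
  An echelon argument without bases: the forms in \<open>V\<close> supported outside \<open>D\<close> are determined by their
  coefficients at the terms of \<open>M\<close> outside \<open>D\<close>, and their number of leading terms is known.
\<close>

lemma card_coordinates_Int_upset:
  fixes V :: "('n::{finite,linorder}, 'k::field) mpoly set"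
  assumes V: "V \<in> grassmannian q m" and M: "M \<in> eterms q m" "coordinates_of V M"
    and D: "\<And>u v. u \<in> D \<Longrightarrow> drl_le u v \<Longrightarrow> v \<in> D"
  shows "card (set M \<inter> D) \<le> card (lts V \<inter> D)"
proof -
  have V': "mpoly.subspace V" "V \<subseteq> forms m" using V by (auto simp: grassmannian_def)
  let ?U = "V \<inter> supported (- D)"
  have subU: "mpoly.subspace ?U" using V'(1) by (simp add: mpoly.subspace_inter)
  have ltU: "lts ?U = lts V - D"
  proof (rule equalityI; rule subsetI)
    fix u assume "u \<in> lts ?U"
    then show "u \<in> lts V - D" by (auto simp: lts_def is_lt_def supported_def)
  next
    fix u assume "u \<in> lts V - D"
    then obtain f where f: "f \<in> V" "is_lt f u" "u \<notin> D" by (auto simp: lts_def)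
    then have "f \<in> supported (- D)" using D by (fastforce simp: is_lt_def supported_def)
    then show "u \<in> lts ?U" using f by (auto simp: lts_def)
  qed
  have dimU: "mpoly.dim ?U = card (lts V - D)"
    using dim_eq_card_lts[OF subU, of m] V'(2) ltU by auto
  let ?R = "\<lambda>f :: ('n, 'k) mpoly. \<Sum>u\<in>set M - D. mscale (lookup f u) (monomial u)"
  have lin: "Vector_Spaces.linear mscale mscale ?R"
    by (rule linear_mscaleI)
      (simp_all add: lookup_add mpoly.scale_left_distrib sum.distrib mpoly.scale_sum_right)
  have "mpoly.dim (?R ` ?U) = mpoly.dim ?U"
  proof (rule dim_image_inj_supported[OF lin _ finite_tdeg[of m] subU])
    show "?U \<subseteq> supported {u. tdeg u = m}" using V'(2) by (auto simp: forms_eq_supported)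
    fix f assume f: "f \<in> ?U" "?R f = 0"
    have "lookup f u = 0" if u: "u \<in> set M" for u
    proof (cases "u \<in> D")
      case True
      then show ?thesis using f(1) by (auto simp: supported_def in_keys_iff)
    next
      case False
      have "lookup (?R f) u = (\<Sum>v\<in>set M - D. if v = u then lookup f v else 0)"
        by (simp add: lookup_sum lookup_monomial if_distrib cong: if_cong)
      then show ?thesis using f(2) u False by simp
    qed
    then show "f = 0" using M(2) f(1) by (auto simp: coordinates_of_def)
  qed
  moreover have "mpoly.dim (?R ` ?U) \<le> card (set M - D)"
  proof -
    have "?R ` ?U \<subseteq> mpoly.span (monomial ` (set M - D))"
      by (rule image_subsetI, rule mpoly.span_sum, rule mpoly.span_scale, rule mpoly.span_base, rule imageI)
    then have "mpoly.dim (?R ` ?U) \<le> card (monomial ` (set M - D) :: ('n, 'k) mpoly set)"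
      by (rule mpoly.dim_le_card) simp
    also have "\<dots> \<le> card (set M - D)" by (rule card_image_le) simp
    finally show ?thesis .
  qed
  ultimately have le: "card (lts V - D) \<le> card (set M - D)" using dimU by simp
  have finV: "finite (lts V)"
    using finite_subset[OF lts_subset_forms[OF V'(2)] finite_tdeg] .
  have "card (set M) = q" using M(1) eterms_distinct[OF M(1)] by (simp add: eterms_def distinct_card)
  moreover have "card (set M) = card (set M - D) + card (set M \<inter> D)"
    using card_Diff_subset_Int[of "set M" D] card_mono[of "set M" "set M \<inter> D"] by simp
  moreover have "card (lts V) = card (lts V - D) + card (lts V \<inter> D)"
    using card_Diff_subset_Int[of "lts V" D] card_mono[of "lts V" "lts V \<inter> D"] finV by simp
  ultimately show ?thesis using le card_lts_grassmannian[OF V] by linarith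
qed

lemma eterm_less_total:
  fixes L M :: "'n::{finite,linorder} eterm"
  assumes "L \<in> eterms q m" "M \<in> eterms q m" "L \<noteq> M"
  shows "eterm_less L M \<or> eterm_less M L"
proof -
  have len: "length L = q" "length M = q" using assms by (auto simp: eterms_def)
  then obtain j0 where "j0 < q \<and> L ! j0 \<noteq> M ! j0" using assms(3) by (metis nth_equalityI)
  define j where "j = (LEAST j. j < q \<and> L ! j \<noteq> M ! j)"
  have j: "j < q" "L ! j \<noteq> M ! j" using LeastI[of "\<lambda>j. j < q \<and> L ! j \<noteq> M ! j"] \<open>j0 < q \<and> _\<close> by (auto simp: j_def)
  have "L ! i = M ! i" if "i < j" for i
    using not_less_Least[of i "\<lambda>j. j < q \<and> L ! j \<noteq> M ! j"] that j(1) by (auto simp: j_def)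
  moreover have "tdeg (L ! j) = tdeg (M ! j)"
    using assms(1,2) j(1) by (auto simp: eterms_def)
  then have "drl_less (L ! j) (M ! j) \<or> drl_less (M ! j) (L ! j)"
    using drl_less_total j(2) by blast
  ultimately show ?thesis using len j(1) unfolding eterm_less_def by metis
qed

lemma eterm_less_trans:
  assumes "eterm_less L M" "eterm_less M N"
  shows "eterm_less L N"
proof -
  obtain j where j: "j < length L" "\<And>i. i < j \<Longrightarrow> L ! i = M ! i" "drl_less (L ! j) (M ! j)"
    using assms(1) by (auto simp: eterm_less_def)
  obtain k where k: "k < length M" "\<And>i. i < k \<Longrightarrow> M ! i = N ! i" "drl_less (M ! k) (N ! k)"
    using assms(2) by (auto simp: eterm_less_def)
  have "drl_less (L ! min j k) (N ! min j k)"
    using j k drl_less_trans by (cases j k rule: linorder_cases) (auto simp: min_def)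
  moreover have "\<forall>i<min j k. L ! i = N ! i" using j(2) k(2) by simp
  moreover have "min j k < length L" "length L = length N"
    using j(1) assms by (auto simp: eterm_less_def)
  ultimately show ?thesis unfolding eterm_less_def by blast
qed

lemma eterm_less_irrefl [simp]: "\<not> eterm_less L L"
  by (auto simp: eterm_less_def)

lemma finite_eterms [simp]: "finite (eterms q m :: 'n::{finite,linorder} eterm set)"
proof -
  have "eterms q m \<subseteq> {L :: 'n eterm. set L \<subseteq> {u. tdeg u = m} \<and> length L = q}"
    by (auto simp: eterms_def)
  then show ?thesis using finite_subset finite_lists_length_eq[OF finite_tdeg] by blast
qed

lemma eterm_max_exists:
  fixes T :: "'n::{finite,linorder} eterm set"
  assumes "finite T" "T \<noteq> {}" "T \<subseteq> eterms q m"
  shows "\<exists>L\<in>T. \<forall>M\<in>T. M = L \<or> eterm_less M L"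
  using assms
proof (induction T rule: finite_ne_induct)
  case (insert x F)
  then obtain L where L: "L \<in> F" "\<forall>M\<in>F. M = L \<or> eterm_less M L" by auto
  consider "eterm_less L x" | "x = L \<or> eterm_less x L"
    using eterm_less_total[of x q m L] insert.prems L(1) by auto
  then show ?case
  proof cases
    case 1
    have "M = x \<or> eterm_less M x" if "M \<in> insert x F" for M
      using that L(2) 1 eterm_less_trans[of M L x] by auto
    then show ?thesis by (intro bexI[of _ x]) auto
  next
    case 2
    then show ?thesis using L by (intro bexI[of _ L]) auto
  qed
qed simp

text \<open>Otherwise let j be the first index of difference and count the entries not below the
  j-th entry of \<open>M\<close>: \<open>M\<close> has at least j + 1 of them and \<open>L\<close>
  at most j, against \<open>card_coordinates_Int_upset\<close>.\<close>

lemma coordinates_le_lts: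
  fixes V :: "('n::{finite,linorder}, 'k::field) mpoly set"
  assumes V: "V \<in> grassmannian q m" and M: "M \<in> eterms q m" "coordinates_of V M"
    and L: "L \<in> eterms q m" "set L = lts V"
  shows "M = L \<or> eterm_less M L"
proof (rule ccontr)
  assume "\<not> (M = L \<or> eterm_less M L)"
  then have "eterm_less L M" using eterm_less_total[OF M(1) L(1)] by blast
  then obtain j where j: "j < length L" "\<And>i. i < j \<Longrightarrow> L ! i = M ! i" "drl_less (L ! j) (M ! j)"
    by (auto simp: eterm_less_def)
  have len: "length L = q" "length M = q" using L(1) M(1) by (auto simp: eterms_def)
  let ?D = "{u. drl_le (M ! j) u}"
  have sM: "drl_less (M ! k) (M ! i)" if "i < k" "k < q" for i k
    using M(1) that by (auto simp: eterms_def sorted_wrt_iff_nth_less)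
  have sL: "drl_less (L ! k) (L ! i)" if "i < k" "k < q" for i k
    using L(1) that by (auto simp: eterms_def sorted_wrt_iff_nth_less)
  have "M ! i \<in> set M \<inter> ?D" if "i \<le> j" for i
    using that sM[of i j] j(1) len by (cases "i = j") (auto simp: drl_le_def)
  then have "(!) M ` {..j} \<subseteq> set M \<inter> ?D" by auto
  then have "card ((!) M ` {..j}) \<le> card (set M \<inter> ?D)" by (intro card_mono) auto
  moreover have "inj_on ((!) M) {..j}"
    using eterms_distinct[OF M(1)] j(1) len by (auto intro!: inj_onI simp: nth_eq_iff_index_eq)
  ultimately have 1: "Suc j \<le> card (set M \<inter> ?D)" by (simp add: card_image)
  have "set L \<inter> ?D \<subseteq> (!) L ` {..<j}"
  proof
    fix u assume u: "u \<in> set L \<inter> ?D"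
    then obtain i where i: "i < q" "u = L ! i" using len by (auto simp: in_set_conv_nth)
    have "i < j"
    proof (rule ccontr)
      assume "\<not> i < j"
      then have "drl_le (L ! i) (L ! j)" using sL[of j i] i(1) by (cases "i = j") (auto simp: drl_le_def)
      then have "drl_less (L ! i) (M ! j)" using j(3) drl_less_trans by (auto simp: drl_le_def)
      then show False using u i(2) drl_less_asym drl_less_irrefl by (auto simp: drl_le_def)
    qed
    then show "u \<in> (!) L ` {..<j}" using i by auto
  qed
  then have "card (set L \<inter> ?D) \<le> card ((!) L ` {..<j})" by (intro card_mono) auto
  also have "\<dots> \<le> j" using card_image_le[of "{..<j}" "(!) L"] by simp
  finally have 2: "card (lts V \<inter> ?D) \<le> j" using L(2) by simp
  have "card (set M \<inter> ?D) \<le> card (lts V \<inter> ?D)"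
    by (rule card_coordinates_Int_upset[OF V M]) (use drl_le_trans in auto)
  then show False using 1 2 by simp
qed

section \<open>Changes of the first coordinate\<close>

text \<open>The value of a term at \<open>c\<close>. The product runs over all variables and not
  over \<open>keys u\<close>, which makes multiplicativity in the term immediate.\<close>

definition tprod :: "('n \<Rightarrow> 'r::comm_ring_1) \<Rightarrow> 'n::finite pterm \<Rightarrow> 'r" where
  "tprod c u = (\<Prod>v\<in>UNIV. c v ^ lookup u v)"

lemma tprod_add: "tprod c (u + w) = tprod c u * tprod c w"
  by (simp add: tprod_def lookup_add power_add prod.distrib)

lemma tprod_0 [simp]: "tprod c 0 = 1"
  by (simp add: tprod_def)

lemma tprod_single: "tprod c (single i k) = c i ^ k"
proof -
  have "tprod c (single i k) = (\<Prod>v\<in>UNIV. if v = i then c v ^ k else 1)"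
    unfolding tprod_def by (rule prod.cong) (auto simp: lookup_single when_def)
  then show ?thesis by simp
qed

definition psubst :: "('n::finite \<Rightarrow> ('n, 'a::comm_ring_1) mpoly) \<Rightarrow> ('n, 'a) mpoly \<Rightarrow> ('n, 'a) mpoly" where
  "psubst c f = meval Const c f"

lemma meval_eq_tprod:
  "meval h c f = (\<Sum>u\<in>keys f. h (lookup f u) * tprod c (u :: 'n::finite pterm))"
proof -
  have "(\<Prod>v\<in>keys u. c v ^ lookup u v) = tprod c u" for u :: "'n pterm"
    unfolding tprod_def by (rule prod.mono_neutral_left) (auto simp: in_keys_iff)
  then show ?thesis by (simp add: meval_def)
qed

lemma psubst_eq_sum:
  assumes "finite A" "keys f \<subseteq> A"
  shows "psubst c f = (\<Sum>u\<in>A. mscale (lookup f u) (tprod c u))"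
  unfolding psubst_def meval_eq_tprod mscale_def
  by (rule sum.mono_neutral_left) (use assms in \<open>auto simp: in_keys_iff Const_def\<close>)

lemma mscale_add_left: "mscale (a + b) f = mscale a f + mscale b f"
  by (rule poly_mapping_eqI) (simp add: lookup_add distrib_right)

lemma mscale_sum_right: "mscale a (sum f A) = (\<Sum>i\<in>A. mscale a (f i))"
  by (simp add: mscale_def sum_distrib_left)

lemma mscale_mscale: "mscale a (mscale b f) = mscale (a * b) f"
  by (rule poly_mapping_eqI) (simp add: mult.assoc)

lemma mscale_mult_left: "mscale a f * g = mscale a (f * g)"
  by (simp add: mscale_def mult.assoc)

lemma mscale_mult_right: "f * mscale a g = mscale a (f * g)"
  by (simp add: mscale_def mult.left_commute)

lemma psubst_add: "psubst c (f + g) = psubst c f + psubst c g"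
proof -
  let ?A = "keys f \<union> keys g"
  have "finite ?A" by simp
  note * = psubst_eq_sum[OF this, of _ c]
  show ?thesis
    using keys_add[of f g] by (simp add: * lookup_add mscale_add_left sum.distrib)
qed

lemma psubst_mscale: "psubst c (mscale a f) = mscale a (psubst c f)"
  using psubst_eq_sum[OF finite_keys keys_mscale[of a f], of c] psubst_eq_sum[OF finite_keys subset_refl, of c f]
  by (simp add: mscale_sum_right mscale_mscale)

lemma psubst_0 [simp]: "psubst c 0 = 0"
  by (simp add: psubst_def)

lemma psubst_sum: "psubst c (sum f A) = (\<Sum>i\<in>A. psubst c (f i))"
  by (induction A rule: infinite_finite_induct) (simp_all add: psubst_add)

lemma psubst_monomial_mult: "psubst c (monomial w * f) = tprod c w * psubst c f"
proof -
  have "psubst c (monomial w * f) =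
      (\<Sum>u\<in>(+) w ` keys f. mscale (lookup (monomial w * f) u) (tprod c u))"
    by (rule psubst_eq_sum) (simp_all add: keys_monomial_mult)
  also have "\<dots> = (\<Sum>u\<in>keys f. mscale (lookup f u) (tprod c (w + u)))"
    by (subst sum.reindex) (auto intro: inj_onI)
  also have "\<dots> = tprod c w * psubst c f"
    by (simp add: psubst_eq_sum[OF finite_keys subset_refl, of c f] sum_distrib_left tprod_add mscale_mult_right)
  finally show ?thesis .
qed

lemma psubst_1 [simp]: "psubst c 1 = 1"
  using psubst_eq_sum[of "{0}" 1 c] by (simp add: mscale_def Const_def)

lemma psubst_monomial: "psubst c (monomial w) = tprod c w"
  using psubst_monomial_mult[of c w 1] by simp

lemma psubst_Var: "psubst c (Var i) = c i"
  by (simp add: Var_def psubst_monomial tprod_single)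

lemma psubst_mult: "psubst c (f * g) = psubst c f * psubst c g"
proof -
  have "psubst c ((\<Sum>u\<in>keys f. mscale (lookup f u) (monomial u)) * g)
      = psubst c (\<Sum>u\<in>keys f. mscale (lookup f u) (monomial u)) * psubst c g"
    by (simp add: sum_distrib_right psubst_sum mscale_mult_left psubst_mscale psubst_monomial_mult psubst_monomial)
  then show ?thesis by (simp add: sum_mscale_monomial)
qed

lemma psubst_power: "psubst c (f ^ k) = psubst c f ^ k"
  by (induction k) (simp_all add: psubst_mult)

lemma psubst_prod: "psubst c (prod f A) = (\<Prod>i\<in>A. psubst c (f i))"
  by (induction A rule: infinite_finite_induct) (simp_all add: psubst_mult)

lemma psubst_psubst: "psubst c (psubst d f) = psubst (\<lambda>i. psubst c (d i)) f"
proof -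
  have "psubst c (tprod d u) = tprod (\<lambda>i. psubst c (d i)) u" for u
    by (simp add: tprod_def psubst_prod psubst_power)
  then show ?thesis
    by (simp add: psubst_eq_sum[OF finite_keys subset_refl, of _ f] psubst_sum psubst_mscale)
qed

lemma Var_power: "Var i ^ k = (monomial (single i k) :: ('n, 'a::comm_ring_1) mpoly)"
  by (induction k) (simp_all add: Var_def monomial_mult flip: single_add)

lemma psubst_Var_id:
  fixes f :: "('n::finite, 'a::comm_ring_1) mpoly"
  shows "psubst Var f = f"
proof -
  have "tprod Var u = (monomial u :: ('n, 'a) mpoly)" for u :: "'n pterm"
  proof -
    have "(\<Prod>i\<in>A. monomial (single i (lookup u i))) =
        (monomial (\<Sum>i\<in>A. single i (lookup u i)) :: ('n, 'a) mpoly)" for A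
      by (induction A rule: infinite_finite_induct) (simp_all add: monomial_mult)
    then show ?thesis by (simp add: tprod_def Var_power sum_single_lookup)
  qed
  then show ?thesis by (simp add: psubst_eq_sum[OF finite_keys subset_refl, of _ f] sum_mscale_monomial)
qed

lemma forms_mult:
  fixes f g :: "('v, 'a::comm_ring_1) mpoly"
  assumes "f \<in> forms a" "g \<in> forms b"
  shows "f * g \<in> forms (a + b)"
  using keys_mult[of f g] assms by (fastforce simp: forms_def)

lemma forms_1 [simp]: "1 \<in> forms 0"
  by (simp add: forms_def)

lemma forms_power:
  fixes f :: "('v, 'a::comm_ring_1) mpoly"
  shows "f \<in> forms a \<Longrightarrow> f ^ k \<in> forms (k * a)"
  by (induction k) (simp_all add: forms_mult)

lemma forms_prod:
  fixes f :: "'i \<Rightarrow> ('v, 'a::comm_ring_1) mpoly"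
  assumes "finite A" "\<And>i. i \<in> A \<Longrightarrow> f i \<in> forms (d i)"
  shows "prod f A \<in> forms (sum d A)"
  using assms by (induction A) (simp_all add: forms_mult)

lemma psubst_forms:
  fixes f :: "('n::finite, 'a::field) mpoly"
  assumes "\<And>i. c i \<in> forms 1" "f \<in> forms d"
  shows "psubst c f \<in> forms d"
proof -
  have "tprod c u \<in> forms (tdeg u)" for u
    unfolding tprod_def tdeg_eq_sum using forms_power[OF assms(1)] by (intro forms_prod) auto
  then have "mscale (lookup f u) (tprod c u) \<in> forms d" if "u \<in> keys f" for u
    using assms(2) that by (intro mpoly.subspace_scale[OF subspace_forms]) (auto simp: forms_def)
  then show ?thesis
    unfolding psubst_eq_sum[OF finite_keys subset_refl] by (rule mpoly.subspace_sum[OF subspace_forms])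
qed

section \<open>Shears of the first coordinate\<close>

definition shear_form :: "('n::{finite,linorder} \<Rightarrow> 'a) \<Rightarrow> ('n, 'a::comm_ring_1) mpoly" where
  "shear_form v = Var x0 + (\<Sum>j\<in>UNIV. mscale (v j) (Var j))"

text \<open>Changing \<open>x0\<close> alone is enough to turn a linear form with coefficient 1 at
  \<open>x0\<close> into \<open>x0\<close>, and for \<open>v x0 = 0\<close> the inverse is obtained
  by negating \<open>v\<close>.\<close>

definition shear :: "('n::{finite,linorder} \<Rightarrow> 'a) \<Rightarrow> ('n, 'a::comm_ring_1) mpoly \<Rightarrow> ('n, 'a) mpoly" where
  "shear v = psubst (\<lambda>i. if i = x0 then shear_form v else Var i)"

text \<open>This is the matrix of \<open>shear v\<close> for \<open>v x0 = 0\<close>: in general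
  \<open>shear_form v\<close> has coefficient 1 + \<open>v x0\<close> at \<open>x0\<close>, whereas
  the corner of the matrix is 1.\<close>

definition shear_mat :: "('n::{finite,linorder} \<Rightarrow> 'a) \<Rightarrow> ('a::comm_ring_1, 'n) sqmat" where
  "shear_mat v = (\<chi> i j. if i = x0 then (if j = x0 then 1 else v j) else (if i = j then 1 else 0))"

lemma gl_act_shear_mat:
  fixes \<iota> :: "'a::field \<Rightarrow> 'k::field" and v :: "'n::{finite,linorder} \<Rightarrow> 'a"
  assumes "field_embedding \<iota>" "v x0 = 0"
  shows "gl_act \<iota> (shear_mat v) = shear (\<lambda>j. \<iota> (v j))"
proof -
  note \<iota> = field_embedding_simps[OF assms(1)]
  have "(\<Sum>j\<in>UNIV. Const (\<iota> (vec_nth (vec_nth (shear_mat v) i) j)) * Var j) =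
      (if i = x0 then shear_form (\<lambda>j. \<iota> (v j)) else (Var i :: ('n, 'k) mpoly))" for i
  proof (cases "i = x0")
    case True
    have "(\<Sum>j\<in>UNIV. Const (\<iota> (vec_nth (vec_nth (shear_mat v) i) j)) * Var j) =
        (\<Sum>j\<in>UNIV. (if j = x0 then Var j else 0) + mscale (\<iota> (v j)) (Var j :: ('n, 'k) mpoly))"
      by (rule sum.cong) (use True assms(2) in \<open>auto simp: shear_mat_def \<iota> mscale_def Const_def\<close>)
    then show ?thesis using True by (simp add: sum.distrib shear_form_def)
  next
    case False
    have "(\<Sum>j\<in>UNIV. Const (\<iota> (vec_nth (vec_nth (shear_mat v) i) j)) * Var j) =
        (\<Sum>j\<in>UNIV. if j = i then (Var j :: ('n, 'k) mpoly) else 0)"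
      by (rule sum.cong) (use False in \<open>auto simp: shear_mat_def \<iota> Const_def\<close>)
    then show ?thesis using False by simp
  qed
  then show ?thesis by (auto simp: gl_act_def shear_def psubst_def)
qed

lemma shear_form_forms: "shear_form v \<in> (forms 1 :: ('n::{finite,linorder}, 'a::field) mpoly set)"
  unfolding shear_form_def
  by (intro mpoly.subspace_add[OF subspace_forms] mpoly.subspace_sum[OF subspace_forms]
      mpoly.subspace_scale[OF subspace_forms] Var_in_forms)

lemma shear_forms:
  fixes f :: "('n::{finite,linorder}, 'a::field) mpoly"
  shows "f \<in> forms d \<Longrightarrow> shear v f \<in> forms d"
  unfolding shear_def by (rule psubst_forms) (simp_all add: shear_form_forms[unfolded One_nat_def] Var_in_forms[unfolded One_nat_def])

lemma shear_shear_form: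
  fixes v :: "'n::{finite,linorder} \<Rightarrow> 'a::comm_ring_1"
  assumes "v x0 = 0"
  shows "shear w (shear_form v) = shear_form (\<lambda>j. v j + w j)"
proof -
  have "(\<Sum>j\<in>UNIV. mscale (v j) (shear w (Var j))) = (\<Sum>j\<in>UNIV. mscale (v j) (Var j))"
    by (rule sum.cong) (use assms in \<open>auto simp: shear_def psubst_Var mscale_def Const_def\<close>)
  moreover have "shear w (shear_form v) = shear_form w + (\<Sum>j\<in>UNIV. mscale (v j) (shear w (Var j)))"
    by (simp add: shear_form_def[of v] shear_def psubst_add psubst_sum psubst_mscale psubst_Var)
  ultimately show ?thesis
    by (simp add: shear_form_def mscale_add_left sum.distrib algebra_simps)
qed

lemma shear_form_0: "shear_form (\<lambda>j. 0) = Var x0"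
  by (simp add: shear_form_def mscale_def Const_def)

lemma shear_inverse:
  fixes v :: "'n::{finite,linorder} \<Rightarrow> 'a::comm_ring_1" and f
  assumes "v x0 = 0"
  shows "shear (\<lambda>j. - v j) (shear v f) = f"
proof -
  have "psubst (\<lambda>i. if i = x0 then shear_form (\<lambda>j. - v j) else Var i) (if i = x0 then shear_form v else Var i) = Var i" for i
    using shear_shear_form[of v "\<lambda>j. - v j", OF assms]
    by (auto simp: shear_def shear_form_0 psubst_Var)
  then show ?thesis by (simp add: shear_def psubst_psubst psubst_Var_id)
qed

lemma shear_inverse':
  fixes v :: "'n::{finite,linorder} \<Rightarrow> 'a::comm_ring_1"
  assumes "v x0 = 0"
  shows "shear v (shear (\<lambda>j. - v j) f) = f"
  using shear_inverse[of "\<lambda>j. - v j" f] assms by simp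

lemma shear_mult: "shear v (f * g) = shear v f * shear v g"
  by (simp add: shear_def psubst_mult)

lemma shear_power: "shear v (f ^ k) = shear v f ^ k"
  by (simp add: shear_def psubst_power)

lemma shear_Var_x0: "shear v (Var x0) = shear_form v"
  by (simp add: shear_def psubst_Var)

lemma linear_shear: "Vector_Spaces.linear mscale mscale (shear v :: ('n::{finite,linorder}, 'a::field) mpoly \<Rightarrow> _)"
  by (rule linear_mscaleI) (simp_all add: shear_def psubst_add psubst_mscale)

lemma subspace_shear_image:
  fixes U :: "('n::{finite,linorder}, 'a::field) mpoly set"
  assumes "mpoly.subspace U"
  shows "mpoly.subspace (shear v ` U)"
  using module_hom.subspace_image[OF _ assms, of mscale "shear v"] linear_shear[of v]
  by (simp add: module_hom_iff_linear)

lemma shear_grassmannian: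
  fixes V :: "('n::{finite,linorder}, 'a::field) mpoly set"
  assumes V: "V \<in> grassmannian q m" and v: "v x0 = 0"
  shows "shear v ` V \<in> grassmannian q m"
proof -
  have V': "mpoly.subspace V" "V \<subseteq> forms m" "mpoly.dim V = q" using V by (auto simp: grassmannian_def)
  have "mpoly.dim (shear v ` V) = mpoly.dim V"
  proof (rule dim_image_inj_supported[OF linear_shear _ finite_tdeg[of m] V'(1)])
    show "V \<subseteq> supported {u. tdeg u = m}" using V'(2) by (simp add: forms_eq_supported)
    fix x assume "shear v x = 0"
    then have "x = shear (\<lambda>j. - v j) 0" using shear_inverse[of v x] v by simp
    then show "x = 0" by (simp add: shear_def)
  qed
  moreover have "mpoly.subspace (shear v ` V)"
    by (rule subspace_shear_image[OF V'(1)])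
  moreover have "shear v ` V \<subseteq> forms m" using V'(2) shear_forms by blast
  ultimately show ?thesis using V'(3) by (simp add: grassmannian_def)
qed

lemma invertible_shear_mat:
  fixes v :: "'n::{finite,linorder} \<Rightarrow> 'a::field"
  assumes "v x0 = 0"
  shows "invertible (shear_mat v)"
proof -
  have mult: "shear_mat v ** shear_mat w = Finite_Cartesian_Product.mat 1" if v: "v x0 = 0" and w: "\<And>j. w j = - v j"
    for v w :: "'n \<Rightarrow> 'a"
  proof -
    have "(\<Sum>k\<in>UNIV. vec_nth (vec_nth (shear_mat v) i) k * vec_nth (vec_nth (shear_mat w) k) j) =
        (if i = j then 1 else 0)" for i j
    proof (cases "i = x0")
      case True
      have "(\<Sum>k\<in>UNIV. vec_nth (vec_nth (shear_mat v) i) k * vec_nth (vec_nth (shear_mat w) k) j) =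
          (\<Sum>k\<in>UNIV. (if k = x0 then vec_nth (vec_nth (shear_mat w) k) j else 0) + (if k = j then v k else 0))"
        by (rule sum.cong) (use True v in \<open>auto simp: shear_mat_def\<close>)
      also have "\<dots> = vec_nth (vec_nth (shear_mat w) x0) j + v j" by (simp add: sum.distrib)
      finally show ?thesis using True v w by (auto simp: shear_mat_def)
    next
      case False
      have "(\<Sum>k\<in>UNIV. vec_nth (vec_nth (shear_mat v) i) k * vec_nth (vec_nth (shear_mat w) k) j) =
          (\<Sum>k\<in>UNIV. if k = i then vec_nth (vec_nth (shear_mat w) k) j else 0)"
        by (rule sum.cong) (use False in \<open>auto simp: shear_mat_def\<close>)
      then show ?thesis using False by (simp add: shear_mat_def)
    qed
    then show ?thesis by (simp add: matrix_matrix_mult_def Finite_Cartesian_Product.mat_def)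
  qed
  show ?thesis unfolding invertible_def
    by (rule exI[of _ "shear_mat (\<lambda>j. - v j)"]) (use assms in \<open>auto intro!: mult\<close>)
qed

section \<open>Linear forms that are nonzerodivisors\<close>

text \<open>Inversion of a Vandermonde system modulo \<open>H\<close>. For a fixed a in
  \<open>C\<close>, the difference of the values at c and at a is c - a times the value at c of a
  quotient with one coefficient fewer, so induction applies to the other scalars.\<close>

lemma vandermonde_subspace:
  fixes H :: "('v, 'k::field) mpoly set"
  assumes "mpoly.subspace H" "finite C" "N \<le> card C"
    "\<And>c. c \<in> C \<Longrightarrow> (\<Sum>j<N. mscale (c ^ j) (h j)) \<in> H" "j < N"
  shows "h j \<in> H"
  using assms
proof (induction N arbitrary: C h j)
  case (Suc N)
  note sub = mpoly.subspace_add[OF Suc.prems(1)] mpoly.subspace_diff[OF Suc.prems(1)] mpoly.subspace_scale[OF Suc.prems(1)]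
  obtain a where a: "a \<in> C" using Suc.prems(3) by fastforce
  \<comment> \<open>synthetic division of \<open>\<Sum>j\<le>N. c ^ j * h j\<close> by \<open>c - a\<close>, with quotient coefficients \<open>h'\<close>\<close>
  define h' where "h' i = (\<Sum>k<N - i. mscale (a ^ k) (h (Suc i + k)))" for i
  have rec: "h (Suc i) = h' i - mscale a (h' (Suc i))" if "i < N" for i
  proof -
    have "N - i = Suc (N - Suc i)" using that by simp
    then have "h' i = h (Suc i) + (\<Sum>k<N - Suc i. mscale (a ^ Suc k) (h (Suc (Suc i) + k)))"
      unfolding h'_def by (simp add: sum.lessThan_Suc_shift del: sum.lessThan_Suc)
    also have "(\<Sum>k<N - Suc i. mscale (a ^ Suc k) (h (Suc (Suc i) + k))) = mscale a (h' (Suc i))"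
      unfolding h'_def by (simp add: mscale_sum_right mscale_mscale)
    finally show ?thesis by simp
  qed
  have h'N: "h' N = 0" by (simp add: h'_def)
  have div: "(\<Sum>j<Suc N. mscale (c ^ j) (h j)) =
      (h 0 + mscale a (h' 0)) + mscale (c - a) (\<Sum>i<N. mscale (c ^ i) (h' i))" for c
  proof -
    have "(\<Sum>i<N. mscale (c ^ Suc i) (h' (Suc i))) + h' 0 = (\<Sum>i<Suc N. mscale (c ^ i) (h' i))"
      by (simp add: sum.lessThan_Suc_shift del: sum.lessThan_Suc)
    then have shift: "(\<Sum>i<N. mscale (c ^ Suc i) (h' (Suc i))) = (\<Sum>i<N. mscale (c ^ i) (h' i)) - h' 0"
      using h'N by (simp add: eq_diff_eq)
    have "(\<Sum>j<Suc N. mscale (c ^ j) (h j)) = h 0 + (\<Sum>i<N. mscale (c ^ Suc i) (h (Suc i)))"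
      by (simp add: sum.lessThan_Suc_shift del: sum.lessThan_Suc)
    also have "(\<Sum>i<N. mscale (c ^ Suc i) (h (Suc i))) =
        mscale c (\<Sum>i<N. mscale (c ^ i) (h' i)) - mscale a (\<Sum>i<N. mscale (c ^ Suc i) (h' (Suc i)))"
      by (simp add: rec mpoly.scale_right_diff_distrib sum_subtractf mscale_sum_right mscale_mscale mult.commute mult.left_commute)
    finally show ?thesis
      unfolding shift by (simp add: mpoly.scale_right_diff_distrib mpoly.scale_left_diff_distrib algebra_simps)
  qed
  have G0: "h 0 + mscale a (h' 0) \<in> H" using Suc.prems(4)[OF a] div[of a] by simp
  have h': "h' i \<in> H" if "i < N" for i
  proof (rule Suc.IH[of "C - {a}" h' i])
    show "N \<le> card (C - {a})" using Suc.prems(2,3) a by (simp add: card_Diff_singleton)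
    fix c assume c: "c \<in> C - {a}"
    have "mscale (c - a) (\<Sum>i<N. mscale (c ^ i) (h' i)) \<in> H"
      using sub(2)[OF Suc.prems(4)[of c] G0] c div[of c] by simp
    then have "mscale (inverse (c - a)) (mscale (c - a) (\<Sum>i<N. mscale (c ^ i) (h' i))) \<in> H" by (rule sub(3))
    then show "(\<Sum>i<N. mscale (c ^ i) (h' i)) \<in> H" using c by (simp add: mscale_mscale)
  qed (use Suc.prems that in auto)
  then have h'': "h' i \<in> H" if "i \<le> N" for i
    using that h'N mpoly.subspace_0[OF Suc.prems(1)] by (cases "i = N") auto
  show ?case
  proof (cases j)
    case 0
    have "h 0 + mscale a (h' 0) - mscale a (h' 0) \<in> H" by (intro sub G0 h'') simp
    then show ?thesis using 0 by simp
  next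
    case (Suc i)
    then show ?thesis using rec[of i] Suc.prems(5) by (auto intro!: sub h'')
  qed
qed simp

section \<open>Linear forms on the moment curve\<close>

definition pos :: "'n::{finite,linorder} \<Rightarrow> nat" where
  "pos j = card {i. i < j}"

lemma pos_strict_mono: "i < j \<Longrightarrow> pos i < pos (j :: 'n::{finite,linorder})"
  unfolding pos_def by (rule psubset_card_mono) auto

lemma pos_inj: "inj pos"
  by (rule linorder_injI) (metis pos_strict_mono less_irrefl)

lemma pos_less: "pos (j :: 'n::{finite,linorder}) < CARD('n)"
  unfolding pos_def by (rule psubset_card_mono) auto

lemma pos_x0 [simp]: "pos x0 = 0"
  by (simp add: pos_def)

text \<open>The point (1, c, c^2, ...) of the moment curve. The coordinate at \<open>x0\<close> is 0
  here because \<open>shear_form\<close> supplies the leading 1.\<close>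

definition moment_coeffs :: "'a::comm_ring_1 \<Rightarrow> 'n::{finite,linorder} \<Rightarrow> 'a" where
  "moment_coeffs c j = (if j = x0 then 0 else c ^ pos j)"

lemma shear_form_moment:
  "shear_form (moment_coeffs c) = (\<Sum>j\<in>UNIV. mscale (c ^ pos j) (Var (j :: 'n::{finite,linorder}) :: ('n, 'a::comm_ring_1) mpoly))"
proof -
  have "(\<Sum>j\<in>UNIV. mscale (c ^ pos j) (Var j :: ('n, 'a) mpoly)) =
     (\<Sum>j\<in>UNIV. (if j = x0 then Var j else 0) + mscale (moment_coeffs c j) (Var j))"
    by (rule sum.cong) (auto simp: moment_coeffs_def mscale_def Const_def)
  then show ?thesis by (simp add: sum.distrib shear_form_def)
qed

text \<open>Such an \<open>f\<close> lies in the colon of \<open>H\<close> by the first power of the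
  irrelevant ideal.\<close>

lemma socle_of_saturated:
  fixes H :: "('n, 'a::comm_ring_1) mpoly set"
  assumes "mideal.subspace H" "saturation H = H" "\<And>j. f * Var j \<in> H"
  shows "f \<in> H"
proof -
  have "f * monomial w \<in> H" if w1: "tdeg w = 1" for w
  proof -
    obtain j where j: "lookup w j \<noteq> 0"
      using w1 by (metis lookup_zero poly_mapping_eqI tdeg_zero zero_neq_one)
    have w: "w = single j 1 + (w - single j 1)"
      by (rule pterm_eq_add_minus) (use j in \<open>auto simp: lookup_single when_def\<close>)
    then have "tdeg w = 1 + tdeg (w - single j 1)" by (metis tdeg_add tdeg_single)
    then have "w = single j 1" using w1 w by simp
    then show ?thesis using assms(3)[of j] by (simp add: Var_def)
  qed
  then show ?thesis using in_saturation_iff[OF assms(1), of f] assms(2) by blast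
qed

text \<open>Each product in \<open>h\<close> is a polynomial in c whose coefficients are the
  \<open>h * Var j\<close>. As many scalars as variables recover these coefficients modulo
  \<open>H\<close>.\<close>

lemma moment_vandermonde:
  fixes H :: "('n::{finite,linorder}, 'k::field) mpoly set"
  assumes H: "mpoly.subspace H" and C: "finite C" "CARD('n) \<le> card C"
    and h: "\<And>c. c \<in> C \<Longrightarrow> shear_form (moment_coeffs c) * h \<in> H"
  shows "h * Var j \<in> H"
proof -
  let ?g = "\<lambda>k. if k \<in> range (pos :: 'n \<Rightarrow> nat) then h * Var (inv_into UNIV pos k) else 0"
  have "(\<Sum>k<CARD('n). mscale (c ^ k) (?g k)) = shear_form (moment_coeffs c) * h" for c
  proof -
    have "(\<Sum>k<CARD('n). mscale (c ^ k) (?g k)) = (\<Sum>k\<in>range (pos :: 'n \<Rightarrow> nat). mscale (c ^ k) (?g k))"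
      by (rule sum.mono_neutral_right) (use pos_less in \<open>auto simp: mscale_def\<close>)
    also have "\<dots> = (\<Sum>j\<in>UNIV. mscale (c ^ pos (j :: 'n)) (h * Var j))"
      by (subst sum.reindex[OF pos_inj]) (simp add: pos_inj)
    also have "\<dots> = shear_form (moment_coeffs c) * h"
      unfolding shear_form_moment sum_distrib_right
      by (rule sum.cong) (simp_all add: mscale_def mult.assoc mult.commute[of h])
    finally show ?thesis .
  qed
  then have "?g (pos j) \<in> H"
    using vandermonde_subspace[OF H C, of ?g "pos j"] h pos_less[of j] by simp
  then show ?thesis by (simp add: pos_inj)
qed

text \<open>A member of least dimension contains all later ones, whose dimension cannot be
  smaller.\<close>

lemma decreasing_chain_stable:
  fixes W :: "nat \<Rightarrow> ('v, 'k::field) mpoly set"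
  assumes "\<And>i. mpoly.subspace (W i)" "\<And>i j. i \<le> j \<Longrightarrow> W j \<subseteq> W i" "\<And>i. W i \<subseteq> supported A" "finite A"
  obtains N where "\<And>i. N \<le> i \<Longrightarrow> W i = W N"
proof -
  obtain N where N: "\<And>i. mpoly.dim (W N) \<le> mpoly.dim (W i)"
    using ex_has_least_nat[of "\<lambda>_. True" 0 "\<lambda>i. mpoly.dim (W i)"] by auto
  have "W i = W N" if "N \<le> i" for i
    by (rule subspace_eq_supported[OF assms(2)[OF that] assms(3,4,1,1) N])
  then show ?thesis using that by blast
qed

text \<open>
  Otherwise take infinitely many \<open>c\<^sub>i\<close> with \<open>f\<^sub>i \<notin> H\<close> killed modulo \<open>H\<close> by the linear form of \<open>c\<^sub>i\<close>. The
  spans of the tails of \<open>(f\<^sub>i)\<close> become stationary, so some \<open>f\<^sub>N\<close> lies in the span of arbitrarily late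
  finite sets of them and is killed by the corresponding products of linear forms. Peeling off
  factors yields a multiple of \<open>f\<^sub>N\<close> outside \<open>H\<close> that is killed by more linear forms than there are
  variables; these are linearly independent by Vandermonde, which contradicts saturation.
\<close>

lemma nonzerodivisor_exists:
  fixes H :: "('n::{finite,linorder}, 'k::field) mpoly set"
  assumes H: "mideal.subspace H" "saturation H = H" and C: "infinite C"
  shows "\<exists>c\<in>C. \<forall>f. (\<forall>u\<in>keys f. tdeg u < m) \<and> shear_form (moment_coeffs c) * f \<in> H \<longrightarrow> f \<in> H"
proof (rule ccontr)
  assume neg: "\<not> ?thesis"
  let ?l = "\<lambda>c :: 'k. shear_form (moment_coeffs c) :: ('n, 'k) mpoly"
  note sH = ideal_subspace[OF H(1)]
  obtain c :: "nat \<Rightarrow> 'k" where c: "inj c" "range c \<subseteq> C"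
    using C infinite_countable_subset by blast
  have "\<forall>i. \<exists>f. f \<in> supported {u. tdeg u < m} \<and> ?l (c i) * f \<in> H \<and> f \<notin> H"
    using neg c(2) by (fastforce simp: supported_def)
  then obtain f where f: "\<And>i. f i \<in> supported {u. tdeg u < m}" "\<And>i. ?l (c i) * f i \<in> H" "\<And>i. f i \<notin> H" by metis
  obtain N where N: "\<And>i. N \<le> i \<Longrightarrow> mpoly.span (f ` {i..}) = mpoly.span (f ` {N..})"
  proof (rule decreasing_chain_stable[of "\<lambda>i. mpoly.span (f ` {i..})" "{u. tdeg u < m}"])
    show "mpoly.span (f ` {i..}) \<subseteq> supported {u. tdeg u < m}" for i
      by (rule mpoly.span_minimal) (use f(1) in auto)
  qed (auto intro!: mpoly.span_mono)
  have late: "\<exists>F. finite F \<and> F \<subseteq> {i..} \<and> (\<Prod>j\<in>F. ?l (c j)) * f N \<in> H" if i: "N \<le> i" for i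
  proof -
    have "f N \<in> mpoly.span (f ` {i..})" unfolding N[OF i] by (rule mpoly.span_base) simp
    then obtain t r where t: "finite t" "t \<subseteq> f ` {i..}" "f N = (\<Sum>a\<in>t. mscale (r a) a)"
      by (auto simp: mpoly.span_explicit)
    obtain F where F: "F \<subseteq> {i..}" "finite F" "t = f ` F" using finite_subset_image[OF t(1,2)] by blast
    have "(\<Prod>j\<in>F. ?l (c j)) * f k \<in> H" if "k \<in> F" for k
    proof -
      have "(\<Prod>j\<in>F. ?l (c j)) = (\<Prod>j\<in>F - {k}. ?l (c j)) * ?l (c k)"
        using F(2) that by (simp add: prod.remove mult.commute)
      then have "(\<Prod>j\<in>F. ?l (c j)) * f k = (\<Prod>j\<in>F - {k}. ?l (c j)) * (?l (c k) * f k)"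
        by (simp only: mult.assoc)
      moreover have "(\<Prod>j\<in>F - {k}. ?l (c j)) * (?l (c k) * f k) \<in> H"
        by (rule mideal.subspace_scale[OF H(1) f(2)])
      ultimately show ?thesis by (simp only:)
    qed
    then have "(\<Prod>j\<in>F. ?l (c j)) * (\<Sum>a\<in>t. mscale (r a) a) \<in> H"
      unfolding sum_distrib_left mscale_mult_right F(3)
      by (intro mpoly.subspace_sum[OF sH] mpoly.subspace_scale[OF sH]) auto
    then show ?thesis using F t(3) by auto
  qed
  \<comment> \<open>The factors are multiplied onto h one at a time. The first factor that brings
    the product into H kills the product formed before it.\<close>
  have peel: "\<exists>j\<in>F. \<exists>g. h * g \<notin> H \<and> ?l (c j) * (h * g) \<in> H"
    if "finite F" "h \<notin> H" "(\<Prod>j\<in>F. ?l (c j)) * h \<in> H" for F h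
    using that
  proof (induction F arbitrary: h)
    case (insert x F)
    show ?case
    proof (cases "?l (c x) * h \<in> H")
      case True
      then show ?thesis using insert.prems(1) by (intro bexI[of _ x] exI[of _ 1]) auto
    next
      case False
      have "(\<Prod>j\<in>F. ?l (c j)) * (?l (c x) * h) \<in> H"
        using insert.prems(2) insert.hyps by (simp add: mult.assoc mult.left_commute)
      from insert.IH[OF False this] obtain j g where jg: "j \<in> F" "?l (c x) * h * g \<notin> H" "?l (c j) * (?l (c x) * h * g) \<in> H"
        by blast
      have eq: "?l (c x) * h * g = h * (?l (c x) * g)" by (simp add: mult.assoc mult.left_commute)
      show ?thesis
        by (rule bexI[of _ j], rule exI[of _ "?l (c x) * g"]) (use jg(2,3) in \<open>unfold eq, blast\<close>, simp add: jg(1))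
    qed
  qed simp
  have "\<exists>S g. finite S \<and> S \<subseteq> {N..} \<and> card S = k \<and> f N * g \<notin> H \<and> (\<forall>j\<in>S. ?l (c j) * (f N * g) \<in> H)" for k
  proof (induction k)
    case 0
    then show ?case using f(3) by (intro exI[of _ "{}"] exI[of _ 1]) auto
  next
    case (Suc k)
    then obtain S g where S: "finite S" "S \<subseteq> {N..}" "card S = k" "f N * g \<notin> H"
      "\<And>j. j \<in> S \<Longrightarrow> ?l (c j) * (f N * g) \<in> H" by blast
    \<comment> \<open>Every member of S is at most the sum over S, so an index from
      \<open>?i\<close> on is new.\<close>
    let ?i = "N + Suc (\<Sum>S)"
    obtain F where F: "finite F" "F \<subseteq> {?i..}" "(\<Prod>j\<in>F. ?l (c j)) * f N \<in> H" using late[of ?i] by auto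
    have "g * ((\<Prod>j\<in>F. ?l (c j)) * f N) \<in> H" by (rule mideal.subspace_scale[OF H(1) F(3)])
    moreover have "g * ((\<Prod>j\<in>F. ?l (c j)) * f N) = (\<Prod>j\<in>F. ?l (c j)) * (f N * g)"
      by (simp add: mult.commute mult.left_commute)
    ultimately have "(\<Prod>j\<in>F. ?l (c j)) * (f N * g) \<in> H" by simp
    from peel[OF F(1) S(4) this] obtain j g' where j: "j \<in> F" "f N * g * g' \<notin> H" "?l (c j) * (f N * g * g') \<in> H" by blast
    have "j \<notin> S"
    proof
      assume "j \<in> S"
      then have "j \<le> \<Sum>S" using S(1) by (intro member_le_sum) auto
      then show False using F(2) j(1) by auto
    qed
    moreover have "?l (c i) * (f N * g * g') \<in> H" if "i \<in> S" for i
    proof -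
      have "g' * (?l (c i) * (f N * g)) \<in> H" by (rule mideal.subspace_scale[OF H(1) S(5)[OF that]])
      moreover have "g' * (?l (c i) * (f N * g)) = ?l (c i) * (f N * g * g')"
        by (simp add: mult.commute mult.left_commute)
      ultimately show ?thesis by simp
    qed
    ultimately show ?case
      using S(1-3) F(2) j
      by (intro exI[of _ "insert j S"] exI[of _ "g * g'"]) (auto simp: mult.assoc)
  qed
  from this[of "CARD('n)"] obtain S g where S: "finite S" "card S = CARD('n)" "f N * g \<notin> H"
      "\<And>j. j \<in> S \<Longrightarrow> ?l (c j) * (f N * g) \<in> H" by blast
  have "f N * g * Var j \<in> H" for j
  proof (rule moment_vandermonde[OF sH])
    show "CARD('n) \<le> card (c ` S)" using S(2) c(1) by (simp add: card_image inj_on_subset)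
  qed (use S in auto)
  then show False using socle_of_saturated[OF H] S(3) by blast
qed

lemma divide_by_power_x0:
  fixes f :: "('n::{finite,linorder}, 'a::field) mpoly"
  assumes "f \<in> forms (s + t)" "f \<in> supported {u. s \<le> lookup u i}"
  obtains g where "g \<in> forms t" "f = Var i ^ s * g"
proof -
  let ?e = "single i s"
  let ?g = "\<Sum>u\<in>keys f. mscale (lookup f u) (monomial (u - ?e))"
  have e: "?e + (u - ?e) = u" if "u \<in> keys f" for u
    by (rule pterm_eq_add_minus[symmetric])
      (use assms(2) that in \<open>auto simp: supported_def lookup_single when_def\<close>)
  have "Var i ^ s * ?g = (\<Sum>u\<in>keys f. mscale (lookup f u) (monomial (?e + (u - ?e))))"
    by (simp add: sum_distrib_left mscale_mult_right monomial_mult Var_power)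
  also have "\<dots> = (\<Sum>u\<in>keys f. mscale (lookup f u) (monomial u))"
    by (rule sum.cong) (simp_all only: e)
  also have "\<dots> = f" by (simp add: sum_mscale_monomial)
  finally have eq: "f = Var i ^ s * ?g" by simp
  have "?g \<in> forms t"
  proof (intro mpoly.subspace_sum[OF subspace_forms] mpoly.subspace_scale[OF subspace_forms])
    fix u assume u: "u \<in> keys f"
    then have "tdeg u = s + t" using assms(1) by (simp add: forms_def)
    moreover have "tdeg u = s + tdeg (u - ?e)" using e[OF u] by (metis tdeg_add tdeg_single)
    ultimately show "monomial (u - ?e) \<in> forms t" by (simp add: forms_def monomial_def)
  qed
  then show ?thesis using eq that by blast
qed

lemma lts_Int_x0:
  fixes U :: "('n::{finite,linorder}, 'a::field) mpoly set"
  shows "lts (U \<inter> supported {u. s \<le> lookup u x0}) = {u \<in> lts U. s \<le> lookup u x0}"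
proof (rule equalityI; rule subsetI)
  fix u assume "u \<in> lts (U \<inter> supported {u. s \<le> lookup u x0})"
  then show "u \<in> {u \<in> lts U. s \<le> lookup u x0}"
    by (auto simp: lts_def is_lt_def supported_def)
next
  fix u assume "u \<in> {u \<in> lts U. s \<le> lookup u x0}"
  then obtain f where f: "f \<in> U" "is_lt f u" "s \<le> lookup u x0" by (auto simp: lts_def)
  have "f \<in> supported {u. s \<le> lookup u x0}"
    using f(2,3) drl_le_lookup_x0 by (fastforce simp: is_lt_def supported_def)
  then show "u \<in> lts (U \<inter> supported {u. s \<le> lookup u x0})" using f by (auto simp: lts_def)
qed

lemma field_embedding_power: "field_embedding \<iota> \<Longrightarrow> \<iota> (x ^ k) = \<iota> x ^ k"
  by (induction k) (simp_all add: field_embedding_simps)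

lemma field_embedding_inj: "field_embedding \<iota> \<Longrightarrow> inj \<iota>"
  by (rule injI) (metis eq_iff_diff_eq_0 field_embedding_simps(6,7))

text \<open>After the shear, the forms of degree s + t divisible by the s-th power of
  \<open>x0\<close> correspond to g of degree t with \<open>?l ^ s * g\<close> in \<open>H\<close>.
  As \<open>?l\<close> is a nonzerodivisor in the degrees concerned, each such g lies in
  \<open>H\<close>, which bounds their number by the dimension in degree t.\<close>

lemma shear_dim_bound:
  fixes \<iota> :: "'a::field \<Rightarrow> 'k::field" and H :: "('n::{finite,linorder}, 'k) mpoly set"
  assumes \<iota>: "field_embedding \<iota>" and inf: "infinite (UNIV :: 'a set)"
    and H: "mideal.subspace H" "saturation H = H"
  obtains v :: "'n \<Rightarrow> 'a" where "v x0 = 0"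
    "card {u \<in> lts (shear (\<lambda>j. \<iota> (v j)) ` (H \<inter> forms (s + t))). s \<le> lookup u x0}
       \<le> mpoly.dim (H \<inter> forms t)"
proof -
  let ?m = "s + t"
  have "infinite (range \<iota>)" using inf field_embedding_inj[OF \<iota>] finite_imageD by blast
  then obtain a where a: "\<And>f. (\<forall>u\<in>keys f. tdeg u < ?m) \<Longrightarrow>
      shear_form (moment_coeffs (\<iota> a)) * f \<in> H \<Longrightarrow> f \<in> H"
    using nonzerodivisor_exists[OF H, of "range \<iota>" ?m] by blast
  \<comment> \<open>The sign gives the inverse shear, which carries the nonzerodivisor
    \<open>shear_form w\<close> to \<open>x0\<close>.\<close>
  define v :: "'n \<Rightarrow> 'a" where "v j = - moment_coeffs a j" for j
  define w :: "'n \<Rightarrow> 'k" where "w = moment_coeffs (\<iota> a)"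
  have vw: "(\<lambda>j. \<iota> (v j)) = (\<lambda>j. - w j)"
    by (auto simp: v_def w_def moment_coeffs_def field_embedding_simps[OF \<iota>] field_embedding_power[OF \<iota>])
  have w0: "w x0 = 0" by (simp add: w_def moment_coeffs_def)
  let ?l = "shear_form w"
  let ?U = "shear (\<lambda>j. - w j) ` (H \<inter> forms ?m)"
  let ?Phi = "\<lambda>g. shear (\<lambda>j. - w j) (?l ^ s * g)"
  \<comment> \<open>One factor is cancelled at a time. What remains has degree i + t with i < s,
    which is below the bound \<open>?m\<close> on the degrees treated by
    \<open>nonzerodivisor_exists\<close>.\<close>
  have cancel: "g \<in> H" if "g \<in> forms t" "?l ^ i * g \<in> H" "i \<le> s" for g i
    using that(2,3)
  proof (induction i)
    case (Suc i)
    have "?l ^ i * g \<in> forms (i + t)"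
      using forms_mult[OF forms_power[OF shear_form_forms] that(1), of w i] by simp
    then have "\<forall>u\<in>keys (?l ^ i * g). tdeg u < ?m" using Suc.prems(2) by (auto simp: forms_def)
    moreover have "shear_form (moment_coeffs (\<iota> a)) * (?l ^ i * g) \<in> H"
      using Suc.prems(1) by (simp add: w_def mult.assoc)
    ultimately have "?l ^ i * g \<in> H" by (rule a)
    then show ?case using Suc.IH Suc.prems(2) by simp
  qed simp
  have sub: "?U \<inter> supported {u. s \<le> lookup u x0} \<subseteq> ?Phi ` (H \<inter> forms t)"
  proof
    fix f assume f: "f \<in> ?U \<inter> supported {u. s \<le> lookup u x0}"
    then obtain h where h: "h \<in> H" "h \<in> forms ?m" "f = shear (\<lambda>j. - w j) h" by blast
    then have "f \<in> forms ?m" by (simp add: shear_forms)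
    then obtain f' where f': "f' \<in> forms t" "f = Var x0 ^ s * f'"
      using divide_by_power_x0[of f s t x0] f by blast
    have "h = shear w f" using h(3) shear_inverse'[of w h] w0 by simp
    then have h': "h = ?l ^ s * shear w f'" by (simp add: f'(2) shear_mult shear_power shear_Var_x0)
    have "shear w f' \<in> H" by (rule cancel[of _ s]) (use h' h(1) f'(1) shear_forms in auto)
    then show "f \<in> ?Phi ` (H \<inter> forms t)" using h' h(3) f'(1) shear_forms by blast
  qed
  have lin: "Vector_Spaces.linear mscale mscale ?Phi"
    by (rule linear_mscaleI)
      (simp_all add: shear_def distrib_left psubst_add mscale_mult_right psubst_mscale)
  have fin: "finite (monomial ` {u :: 'n pterm. tdeg u = t} :: ('n, 'k) mpoly set)" by simp
  have "mpoly.dim (?Phi ` (H \<inter> forms t)) \<le> mpoly.dim (H \<inter> forms t)"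
    using vector_space_pair.rank_nullity[OF vector_space_pair_mscale lin fin _ subspace_Int_forms[OF H(1)]]
    by (simp add: span_monomials forms_eq_supported)
  moreover have "?Phi ` (H \<inter> forms t) \<subseteq> forms ?m"
    using forms_mult[OF forms_power[OF shear_form_forms], of _ t w s] by (auto intro!: shear_forms)
  ultimately have "mpoly.dim (?U \<inter> supported {u. s \<le> lookup u x0}) \<le> mpoly.dim (H \<inter> forms t)"
    using dim_mono_forms[OF sub] by (meson order_trans)
  moreover have "mpoly.dim (?U \<inter> supported {u. s \<le> lookup u x0}) =
      card {u \<in> lts ?U. s \<le> lookup u x0}"
  proof (subst dim_eq_card_lts)
    have "mpoly.subspace ?U"
      by (rule subspace_shear_image[OF subspace_Int_forms[OF H(1)]])
    then show "mpoly.subspace (?U \<inter> supported {u. s \<le> lookup u x0})"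
      by (rule mpoly.subspace_inter[OF _ subspace_supported])
    show "?U \<inter> supported {u. s \<le> lookup u x0} \<subseteq> forms ?m" using shear_forms by blast
  qed (simp add: lts_Int_x0)
  ultimately have "card {u \<in> lts (shear (\<lambda>j. \<iota> (v j)) ` (H \<inter> forms ?m)). s \<le> lookup u x0}
       \<le> mpoly.dim (H \<inter> forms t)" by (simp add: vw)
  moreover have "v x0 = 0" by (simp add: v_def moment_coeffs_def)
  ultimately show ?thesis using that by blast
qed

section \<open>Comparison of points over different fields\<close>

definition cmap :: "('a::field \<Rightarrow> 'k::field) \<Rightarrow> ('v, 'a) mpoly \<Rightarrow> ('v, 'k) mpoly" where
  "cmap \<iota> f = Poly_Mapping.map \<iota> f"

lemma lookup_cmap:
  "field_embedding \<iota> \<Longrightarrow> lookup (cmap \<iota> f) u = \<iota> (lookup f u)"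
  by (simp add: cmap_def map.rep_eq when_def field_embedding_simps)

context
  fixes \<iota> :: "'a::field \<Rightarrow> 'k::field"
  assumes \<iota>: "field_embedding \<iota>"
begin

lemmas \<iota>_simps = field_embedding_simps[OF \<iota>]

lemma embedding_sum: "\<iota> (sum f A) = (\<Sum>i\<in>A. \<iota> (f i))"
  by (induction A rule: infinite_finite_induct) (simp_all add: \<iota>_simps)

lemma embedding_prod: "\<iota> (prod f A) = (\<Prod>i\<in>A. \<iota> (f i))"
  by (induction A rule: infinite_finite_induct) (simp_all add: \<iota>_simps)

lemma embedding_of_int: "\<iota> (of_int k) = of_int k"
proof -
  have "\<iota> (of_nat n) = of_nat n" for n by (induction n) (simp_all add: \<iota>_simps)
  then show ?thesis by (cases k) (simp_all add: \<iota>_simps)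
qed

lemma cmap_add: "cmap \<iota> (f + g) = cmap \<iota> f + cmap \<iota> g"
  by (rule poly_mapping_eqI) (simp add: lookup_cmap[OF \<iota>] lookup_add \<iota>_simps)

lemma cmap_sum: "cmap \<iota> (sum f A) = (\<Sum>i\<in>A. cmap \<iota> (f i))"
  by (rule poly_mapping_eqI) (simp add: lookup_cmap[OF \<iota>] lookup_sum embedding_sum)

lemma cmap_mscale: "cmap \<iota> (mscale c f) = mscale (\<iota> c) (cmap \<iota> f)"
  by (rule poly_mapping_eqI) (simp add: lookup_cmap[OF \<iota>] \<iota>_simps)

lemma cmap_monomial_mult: "cmap \<iota> (monomial w * f) = monomial w * cmap \<iota> f"
  by (rule poly_mapping_eqI) (simp add: lookup_cmap[OF \<iota>] lookup_monomial_mult \<iota>_simps)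

lemma cmap_monomial: "cmap \<iota> (monomial w) = monomial w"
  by (rule poly_mapping_eqI) (simp add: lookup_cmap[OF \<iota>] lookup_monomial \<iota>_simps)

lemma cmap_1: "cmap \<iota> 1 = 1"
  using cmap_monomial[of 0] by simp

lemma cmap_mult: "cmap \<iota> (f * g) = cmap \<iota> f * cmap \<iota> g"
proof -
  let ?f = "\<Sum>u\<in>keys f. mscale (lookup f u) (monomial u)"
  have "cmap \<iota> (?f * g) = cmap \<iota> ?f * cmap \<iota> g"
    by (simp add: sum_distrib_right cmap_sum mscale_mult_left cmap_mscale cmap_monomial_mult cmap_monomial)
  then show ?thesis by (simp add: sum_mscale_monomial)
qed

lemma cmap_power: "cmap \<iota> (f ^ k) = cmap \<iota> f ^ k"
  by (induction k) (simp_all add: cmap_1 cmap_mult)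

lemma cmap_prod: "cmap \<iota> (prod f A) = (\<Prod>i\<in>A. cmap \<iota> (f i))"
  by (induction A rule: infinite_finite_induct) (simp_all add: cmap_1 cmap_mult)

lemma cmap_shear_monomial:
  "cmap \<iota> (shear v (monomial u)) = shear (\<lambda>j. \<iota> (v j)) (monomial u)"
proof -
  have "cmap \<iota> (if i = x0 then shear_form v else Var i) = (if i = x0 then shear_form (\<lambda>j. \<iota> (v j)) else Var i)" for i
    by (simp add: shear_form_def cmap_add cmap_sum cmap_mscale Var_def cmap_monomial)
  then show ?thesis by (simp add: shear_def psubst_monomial tprod_def cmap_prod cmap_power)
qed

text \<open>The coefficients of the sheared form are linear in those of \<open>f\<close>, with
  constants coming from the ground field; this is the source of linear forms over K in Pluecker
  coordinates.\<close>

lemma lookup_shear: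
  fixes f :: "('n::{finite,linorder}, 'k) mpoly" and v :: "'n \<Rightarrow> 'a"
  assumes f: "f \<in> forms m"
  shows "lookup (shear (\<lambda>j. \<iota> (v j)) f) w =
    (\<Sum>u\<in>{u. tdeg u = m}. lookup f u * \<iota> (lookup (shear v (monomial u)) w))"
proof -
  have "keys f \<subseteq> {u. tdeg u = m}" using f by (auto simp: forms_def)
  note f_eq = sum_mscale_monomial[OF finite_tdeg this]
  have "shear (\<lambda>j. \<iota> (v j)) (\<Sum>u\<in>{u. tdeg u = m}. mscale (lookup f u) (monomial u)) =
      (\<Sum>u\<in>{u. tdeg u = m}. mscale (lookup f u) (shear (\<lambda>j. \<iota> (v j)) (monomial u)))"
    by (simp add: shear_def psubst_sum psubst_mscale)
  then have "shear (\<lambda>j. \<iota> (v j)) f =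
      (\<Sum>u\<in>{u. tdeg u = m}. mscale (lookup f u) (shear (\<lambda>j. \<iota> (v j)) (monomial u)))"
    by (simp only: f_eq)
  then show ?thesis
    by (simp add: lookup_sum lookup_cmap[OF \<iota>] flip: cmap_shear_monomial)
qed

lemma meval_eq_sum:
  assumes "finite A" "keys f \<subseteq> A"
  shows "meval \<iota> c f = (\<Sum>u\<in>A. \<iota> (lookup f u) * (\<Prod>v\<in>keys u. c v ^ lookup u v))"
  unfolding meval_def
  by (rule sum.mono_neutral_left) (use assms in \<open>auto simp: in_keys_iff \<iota>_simps\<close>)

lemma meval_add: "meval \<iota> c (f + g) = meval \<iota> c f + meval \<iota> c g"
proof -
  let ?A = "keys f \<union> keys g"
  have "finite ?A" by simp
  note * = meval_eq_sum[OF this, of _ c]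
  show ?thesis
    using keys_add[of f g] by (simp add: * lookup_add \<iota>_simps distrib_right sum.distrib)
qed

lemma meval_mscale: "meval \<iota> c (mscale a f) = \<iota> a * meval \<iota> c f"
  using meval_eq_sum[OF finite_keys keys_mscale[of a f], of c] meval_eq_sum[OF finite_keys subset_refl, of c f]
  by (simp add: \<iota>_simps sum_distrib_left mult.assoc)

lemma meval_sum: "meval \<iota> c (sum f A) = (\<Sum>i\<in>A. meval \<iota> c (f i))"
  by (induction A rule: infinite_finite_induct) (simp_all add: meval_add)

end

section \<open>Pluecker coordinates after a shear\<close>

lemma permutes_less: "p permutes {0..<q} \<Longrightarrow> j < q \<Longrightarrow> p j < (q :: nat)"
  using permutes_in_image[of p "{0..<q}" j] by simp

text \<open>Multilinearity in the columns, the first half of the Cauchy-Binet formula. The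
  selections \<open>\<phi>\<close> may still be unsorted or have repetitions.\<close>

lemma det_sum_columns:
  fixes B :: "nat \<Rightarrow> 'u \<Rightarrow> 'k::comm_ring_1"
  assumes "finite S"
  shows "Determinant.det (Matrix.mat q q (\<lambda>(i, j). \<Sum>u\<in>S. B i u * c u j)) =
    (\<Sum>\<phi>\<in>PiE {..<q} (\<lambda>_. S). (\<Prod>j<q. c (\<phi> j) j) * Determinant.det (Matrix.mat q q (\<lambda>(i, j). B i (\<phi> j))))"
proof -
  have det: "Determinant.det (Matrix.mat q q (\<lambda>(i, j). M i j)) =
      (\<Sum>p\<in>{p. p permutes {0..<q}}. signof p * (\<Prod>j<q. M (p j) j))" for M :: "nat \<Rightarrow> nat \<Rightarrow> 'k"
  proof -
    have "Determinant.det (Matrix.mat q q (\<lambda>(i, j). M i j)) = Determinant.det (Matrix.mat q q (\<lambda>(i, j). M j i))"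
      by (subst det_transpose[symmetric, of _ q]) (auto intro!: arg_cong[of _ _ Determinant.det])
    also have "\<dots> = (\<Sum>p\<in>{p. p permutes {0..<q}}. signof p * (\<Prod>j<q. M (p j) j))"
      by (subst det_def'[of _ q]) (auto intro!: sum.cong prod.cong simp: atLeast0LessThan permutes_less)
    finally show ?thesis .
  qed
  have "(\<Prod>j<q. \<Sum>u\<in>S. B (p j) u * c u j) =
      (\<Sum>\<phi>\<in>PiE {..<q} (\<lambda>_. S). (\<Prod>j<q. c (\<phi> j) j) * (\<Prod>j<q. B (p j) (\<phi> j)))" for p
    using assms by (subst prod_sum_PiE) (auto simp: prod.distrib mult.commute)
  then show ?thesis
    unfolding det
    by (simp add: sum_distrib_left mult.left_commute) (rule sum.swap)
qed

lemma det_select_columns: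
  fixes B :: "nat \<Rightarrow> 'u \<Rightarrow> 'k::comm_ring_1" and N :: "'u list"
  assumes p: "p permutes {0..<q}" and \<phi>: "\<And>j. j < q \<Longrightarrow> \<phi> j = N ! p j"
  shows "Determinant.det (Matrix.mat q q (\<lambda>(i, j). B i (\<phi> j))) =
    of_int (sign p) * Determinant.det (Matrix.mat q q (\<lambda>(i, j). B i (N ! j)))"
proof -
  let ?A = "Matrix.mat q q (\<lambda>(i, j). B j (N ! i))"
  have "Determinant.det (Matrix.mat q q (\<lambda>(i, j). B i (\<phi> j))) =
      Determinant.det (Matrix.mat q q (\<lambda>(i, j). ?A $$ (p i, j)))"
    by (subst det_transpose[symmetric, of _ q])
      (use p in \<open>auto intro!: arg_cong[of _ _ Determinant.det] eq_matI simp: \<phi> permutes_less\<close>)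
  also have "\<dots> = of_int (sign p) * Determinant.det ?A"
    by (rule det_permute_rows[OF _ p]) simp
  also have "Determinant.det ?A = Determinant.det (Matrix.mat q q (\<lambda>(i, j). B i (N ! j)))"
    by (subst det_transpose[symmetric, of _ q]) (auto intro!: arg_cong[of _ _ Determinant.det])
  finally show ?thesis .
qed

lemma det_repeated_columns:
  fixes B :: "nat \<Rightarrow> 'u \<Rightarrow> 'k::comm_ring_1"
  assumes "\<not> inj_on \<phi> {..<q}"
  shows "Determinant.det (Matrix.mat q q (\<lambda>(i, j). B i (\<phi> j))) = 0"
proof -
  obtain i j where ij: "i < q" "j < q" "i \<noteq> j" "\<phi> i = \<phi> j" using assms by (auto simp: inj_on_def)
  show ?thesis
    by (rule det_identical_columns[OF _ ij(3,1,2)]) (use ij in \<open>auto intro!: eq_vecI\<close>)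
qed

text \<open>Quantifying over all \<open>B\<close> makes \<open>N\<close> and \<open>e\<close>
  independent of the chosen basis. The coefficient ring is passed as a type so that one pair can be
  required to work for two fields.\<close>

definition column_relation :: "'k::comm_ring_1 itself \<Rightarrow> nat \<Rightarrow> (nat \<Rightarrow> 'u) \<Rightarrow> 'u list \<Rightarrow> int \<Rightarrow> bool" where
  "column_relation _ q \<phi> N e \<longleftrightarrow> (\<forall>B :: nat \<Rightarrow> 'u \<Rightarrow> 'k.
     Determinant.det (Matrix.mat q q (\<lambda>(i, j). B i (\<phi> j))) =
       of_int e * Determinant.det (Matrix.mat q q (\<lambda>(i, j). B i (N ! j))))"

text \<open>
  The sign \<open>e\<close> and the sorted list \<open>N\<close> depend only on \<open>\<phi>\<close>, and not on the field.
\<close>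

lemma column_selection:
  fixes M :: "'n::{finite,linorder} eterm" and \<phi> :: "nat \<Rightarrow> 'n pterm"
  assumes M: "M \<in> eterms q m" and \<phi>: "\<phi> \<in> {..<q} \<rightarrow> {u. tdeg u = m}"
  shows "\<exists>N\<in>eterms q m. \<exists>e. column_relation TYPE('k::comm_ring_1) q \<phi> N e \<and>
    column_relation TYPE('l::comm_ring_1) q \<phi> N e"
proof (cases "inj_on \<phi> {..<q}")
  case False
  \<comment> \<open>A selection with repetition contributes the minor 0, so any admissible list with
    factor 0 represents it, and \<open>M\<close> is at hand.\<close>
  have "column_relation TYPE('k) q \<phi> M 0" "column_relation TYPE('l) q \<phi> M 0"
    by (simp_all add: column_relation_def det_repeated_columns[OF False])
  then show ?thesis using M by blast
next
  case True
  have "\<exists>N. set N = \<phi> ` {..<q} \<and> length N = card (\<phi> ` {..<q}) \<and> sorted_wrt (\<lambda>a b. drl_less b a) N"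
    by (rule drl_sorted_list_exists[of _ m]) (use \<phi> in auto)
  then obtain N where N: "set N = \<phi> ` {..<q}" "length N = q" "sorted_wrt (\<lambda>a b. drl_less b a) N"
    using True by (auto simp: card_image)
  have NE: "N \<in> eterms q m" using N \<phi> by (auto simp: eterms_def)
  have dist: "distinct N" by (rule eterms_distinct[OF NE])
  define p where "p j = (if j < q then (THE k. k < q \<and> N ! k = \<phi> j) else j)" for j
  have p: "p j < q \<and> N ! p j = \<phi> j" if j: "j < q" for j
  proof -
    have "\<phi> j \<in> set N" using N(1) j by auto
    then obtain k where k: "k < q" "N ! k = \<phi> j" using N(2) by (auto simp: in_set_conv_nth)
    have "(THE k. k < q \<and> N ! k = \<phi> j) = k"
      using k N(2) nth_eq_iff_index_eq[OF dist] by (intro the_equality) (simp, metis)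
    then show ?thesis using k j by (simp add: p_def)
  qed
  have "inj_on p {0..<q}"
  proof (rule inj_onI)
    fix i j assume ij: "i \<in> {0..<q}" "j \<in> {0..<q}" "p i = p j"
    then have "\<phi> i = \<phi> j" using p[of i] p[of j] by simp
    then show "i = j" using True ij by (auto simp: inj_on_def)
  qed
  moreover have "p ` {0..<q} \<subseteq> {0..<q}" using p by auto
  ultimately have "bij_betw p {0..<q} {0..<q}"
    by (simp add: bij_betw_def endo_inj_surj)
  then have perm: "p permutes {0..<q}" by (rule bij_imp_permutes) (simp add: p_def)
  have "column_relation TYPE('k) q \<phi> N (sign p)" "column_relation TYPE('l) q \<phi> N (sign p)"
    unfolding column_relation_def by (intro allI det_select_columns[OF perm]; use p in simp)+
  then show ?thesis using NE by blast
qed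

lemma pluecker_shear:
  fixes \<iota> :: "'a::field \<Rightarrow> 'k::field" and b :: "nat \<Rightarrow> ('n::{finite,linorder}, 'k) mpoly"
  assumes "field_embedding \<iota>" "\<And>i. i < q \<Longrightarrow> b i \<in> forms m"
  shows "pluecker q (\<lambda>i. shear (\<lambda>j. \<iota> (v j)) (b i)) M =
    (\<Sum>\<phi>\<in>PiE {..<q} (\<lambda>_. {u. tdeg u = m}).
       \<iota> (\<Prod>j<q. lookup (shear v (monomial (\<phi> j))) (M ! j)) *
       Determinant.det (Matrix.mat q q (\<lambda>(i, j). lookup (b i) (\<phi> j))))"
proof -
  have "pluecker q (\<lambda>i. shear (\<lambda>j. \<iota> (v j)) (b i)) M =
    Determinant.det (Matrix.mat q q (\<lambda>(i, j). \<Sum>u\<in>{u. tdeg u = m}.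
      lookup (b i) u * \<iota> (lookup (shear v (monomial u)) (M ! j))))"
    unfolding pluecker_def
    by (rule arg_cong[of _ _ Determinant.det], rule eq_matI) (use assms in \<open>simp_all add: lookup_shear\<close>)
  then show ?thesis
    by (simp add: det_sum_columns embedding_prod[OF assms(1)])
qed

lemma pluecker_ring_subspace: "mpoly.subspace (pluecker_ring q m :: ('n::linorder eterm, 'a::field) mpoly set)"
  using subspace_supported[of "{u. keys u \<subseteq> eterms q m}"]
  by (simp add: supported_def pluecker_ring_def subset_iff Ball_def)

lemma meval_pluecker_sum:
  fixes \<iota> :: "'a::field \<Rightarrow> 'k::field" and b :: "nat \<Rightarrow> ('n::{finite,linorder}, 'k) mpoly"
  assumes \<iota>: "field_embedding \<iota>" and b: "\<And>i. i < q \<Longrightarrow> b i \<in> forms m"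
    and N: "\<And>\<phi>. \<phi> \<in> PiE {..<q} (\<lambda>_. {u. tdeg u = m}) \<Longrightarrow> column_relation TYPE('k) q \<phi> (N \<phi>) (e \<phi>)"
  shows "meval \<iota> (pluecker q b) (\<Sum>\<phi>\<in>PiE {..<q} (\<lambda>_. {u. tdeg u = m}).
      mscale ((\<Prod>j<q. lookup (shear v (monomial (\<phi> j))) (M ! j)) * of_int (e \<phi>)) (Var (N \<phi>))) =
    pluecker q (\<lambda>i. shear (\<lambda>j. \<iota> (v j)) (b i)) M"
  (is "meval _ _ (\<Sum>\<phi>\<in>?P. mscale (?a \<phi> * _) _) = _")
proof -
  have "pluecker q (\<lambda>i. shear (\<lambda>j. \<iota> (v j)) (b i)) M = (\<Sum>\<phi>\<in>?P.
     \<iota> (?a \<phi>) * Determinant.det (Matrix.mat q q (\<lambda>(i, j). lookup (b i) (\<phi> j))))"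
    by (rule pluecker_shear[OF \<iota> b])
  also have "\<dots> = (\<Sum>\<phi>\<in>?P. \<iota> (?a \<phi> * of_int (e \<phi>)) * pluecker q b (N \<phi>))"
  proof (rule sum.cong[OF refl])
    fix \<phi> assume \<phi>: "\<phi> \<in> ?P"
    from N[OF \<phi>, unfolded column_relation_def, rule_format, of "\<lambda>i. lookup (b i)"]
    have "Determinant.det (Matrix.mat q q (\<lambda>(i, j). lookup (b i) (\<phi> j))) =
        of_int (e \<phi>) * pluecker q b (N \<phi>)" unfolding pluecker_def .
    then show "\<iota> (?a \<phi>) * Determinant.det (Matrix.mat q q (\<lambda>(i, j). lookup (b i) (\<phi> j))) =
        \<iota> (?a \<phi> * of_int (e \<phi>)) * pluecker q b (N \<phi>)"
      by (simp only: field_embedding_simps(4)[OF \<iota>] embedding_of_int[OF \<iota>] mult.assoc)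
  qed
  finally show ?thesis
    by (simp only: meval_sum[OF \<iota>] meval_mscale[OF \<iota>] meval_Var[OF \<iota>])
qed

text \<open>Whether the coordinate \<open>M\<close> vanishes after the shear can thus be read from
  the prime ideal of the original point. One form \<open>F\<close> serves both fields because the
  lists and signs are common to them and all other constants lie in the ground field.\<close>

lemma pluecker_linear_form:
  fixes \<iota>1 :: "'a::field \<Rightarrow> 'k::field" and \<iota>2 :: "'a \<Rightarrow> 'l::field" and v :: "'n::{finite,linorder} \<Rightarrow> 'a"
  assumes \<iota>: "field_embedding \<iota>1" "field_embedding \<iota>2" and M: "M \<in> eterms q m"
  obtains F :: "('n eterm, 'a) mpoly" where "F \<in> pluecker_ring q m" "F \<in> forms 1"
    "\<And>b. (\<And>i. i < q \<Longrightarrow> b i \<in> forms m) \<Longrightarrow>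
       meval \<iota>1 (pluecker q b) F = pluecker q (\<lambda>i. shear (\<lambda>j. \<iota>1 (v j)) (b i)) M"
    "\<And>b. (\<And>i. i < q \<Longrightarrow> b i \<in> forms m) \<Longrightarrow>
       meval \<iota>2 (pluecker q b) F = pluecker q (\<lambda>i. shear (\<lambda>j. \<iota>2 (v j)) (b i)) M"
proof -
  let ?P = "PiE {..<q} (\<lambda>_. {u :: 'n pterm. tdeg u = m})"
  have "\<exists>N e. N \<in> eterms q m \<and> column_relation TYPE('k) q \<phi> N e \<and> column_relation TYPE('l) q \<phi> N e"
    if "\<phi> \<in> ?P" for \<phi>
    using column_selection[OF M, of \<phi>] that by (auto simp: PiE_def)
  then obtain N e where N: "\<And>\<phi>. \<phi> \<in> ?P \<Longrightarrow> N \<phi> \<in> eterms q m"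
    "\<And>\<phi>. \<phi> \<in> ?P \<Longrightarrow> column_relation TYPE('k) q \<phi> (N \<phi>) (e \<phi>)"
    "\<And>\<phi>. \<phi> \<in> ?P \<Longrightarrow> column_relation TYPE('l) q \<phi> (N \<phi>) (e \<phi>)" by metis
  let ?F = "\<Sum>\<phi>\<in>?P. mscale ((\<Prod>j<q. lookup (shear v (monomial (\<phi> j))) (M ! j)) * of_int (e \<phi>))
    (Var (N \<phi>)) :: ('n eterm, 'a) mpoly"
  have ring: "?F \<in> pluecker_ring q m"
    using N(1) by (intro mpoly.subspace_sum[OF pluecker_ring_subspace] mpoly.subspace_scale[OF pluecker_ring_subspace]
        Var_in_pluecker_ring) blast
  have form: "?F \<in> forms 1"
    by (intro mpoly.subspace_sum[OF subspace_forms] mpoly.subspace_scale[OF subspace_forms] Var_in_forms)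
  show ?thesis
    by (rule that[OF ring form meval_pluecker_sum[OF \<iota>(1) _ N(2)] meval_pluecker_sum[OF \<iota>(2) _ N(3)]])
qed

lemma family_basis_shear:
  fixes V :: "('n::{finite,linorder}, 'k::field) mpoly set"
  assumes b: "family_basis q b V" and v: "v x0 = 0"
  shows "family_basis q (\<lambda>i. shear v (b i)) (shear v ` V)"
proof (rule family_basisI)
  have lin: "shear v (\<Sum>i<q. mscale (c i) (b i)) = (\<Sum>i<q. mscale (c i) (shear v (b i)))" for c
    by (simp add: shear_def psubst_sum psubst_mscale)
  show "f \<in> shear v ` V \<longleftrightarrow> (\<exists>c. f = (\<Sum>i<q. mscale (c i) (shear v (b i))))" for f
    unfolding lin[symmetric] image_iff Bex_def family_basis_span[OF b] by blast
  fix c assume "(\<Sum>i<q. mscale (c i) (shear v (b i))) = 0"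
  then have "shear v (\<Sum>i<q. mscale (c i) (b i)) = 0" by (simp only: lin)
  then have "(\<Sum>i<q. mscale (c i) (b i)) = shear (\<lambda>j. - v j) 0"
    using shear_inverse[of v "\<Sum>i<q. mscale (c i) (b i)"] v by simp
  then have "(\<Sum>i<q. mscale (c i) (b i)) = 0" by (simp add: shear_def)
  then show "\<forall>i\<in>{..<q}. c i = 0" using family_basis_independent[OF b] by auto
qed

lemma family_basis_forms:
  fixes V :: "('n::finite, 'k::field) mpoly set"
  assumes "family_basis q b V" "V \<in> grassmannian q m" "i < q"
  shows "b i \<in> forms m"
  using assms mpoly.span_base[of "b i" "b ` {..<q}"] by (auto simp: family_basis_def grassmannian_def)

text \<open>With no map between the two extension fields available, the nonvanishing travels through
  \<open>F\<close>: it lies outside the prime ideal that the two points share.\<close>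

lemma coordinates_of_transfer:
  fixes \<iota>1 :: "'a::field \<Rightarrow> 'k::field" and \<iota>2 :: "'a \<Rightarrow> 'l::field"
    and V1 :: "('n::{finite,linorder}, 'k) mpoly set" and V2 :: "('n, 'l) mpoly set"
  assumes \<iota>: "field_embedding \<iota>1" "field_embedding \<iota>2" and v: "v x0 = 0"
    and M: "M \<in> eterms q m" and V: "V1 \<in> grassmannian q m" "V2 \<in> grassmannian q m"
    and eq: "pluecker_point \<iota>1 q m V1 = pluecker_point \<iota>2 q m V2"
    and coord: "coordinates_of (shear (\<lambda>j. \<iota>1 (v j)) ` V1) M"
  shows "coordinates_of (shear (\<lambda>j. \<iota>2 (v j)) ` V2) M"
proof -
  have len: "length M = q" using M by (simp add: eterms_def)
  have v12: "\<iota>1 (v x0) = 0" "\<iota>2 (v x0) = 0" using v \<iota> by (simp_all add: field_embedding_simps)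
  obtain F :: "('n eterm, 'a) mpoly" where F: "F \<in> pluecker_ring q m" "F \<in> forms 1"
    "\<And>b. (\<And>i. i < q \<Longrightarrow> b i \<in> forms m) \<Longrightarrow>
       meval \<iota>1 (pluecker q b) F = pluecker q (\<lambda>i. shear (\<lambda>j. \<iota>1 (v j)) (b i)) M"
    "\<And>b. (\<And>i. i < q \<Longrightarrow> b i \<in> forms m) \<Longrightarrow>
       meval \<iota>2 (pluecker q b) F = pluecker q (\<lambda>i. shear (\<lambda>j. \<iota>2 (v j)) (b i)) M"
    using pluecker_linear_form[OF \<iota> M, of v] by blast
  obtain b where b: "family_basis q b V1" using family_basis_exists[OF V(1)] .
  have "meval \<iota>1 (pluecker q b) F \<noteq> 0"
    using F(3)[of b] family_basis_forms[OF b V(1)] coord v12(1)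
      pluecker_nonzero_iff[OF family_basis_shear[OF b, of "\<lambda>j. \<iota>1 (v j)"] len] by simp
  then have "F \<notin> pluecker_point \<iota>1 q m V1" using linear_form_in_pluecker_point_iff[OF F(1,2)] b by blast
  then have "F \<notin> pluecker_point \<iota>2 q m V2" using eq by simp
  then obtain b' where b': "family_basis q b' V2" "meval \<iota>2 (pluecker q b') F \<noteq> 0"
    using linear_form_in_pluecker_point_iff[OF F(1,2)] by blast
  then show ?thesis
    using F(4)[of b'] family_basis_forms[OF b'(1) V(2)] v12(2)
      pluecker_nonzero_iff[OF family_basis_shear[OF b'(1), of "\<lambda>j. \<iota>2 (v j)"] len] by simp
qed

section \<open>Borel-fixed ideals and GL-stable subsets\<close>

lemma univ_embed_embedding: "field_embedding (univ_embed :: 'a::field \<Rightarrow> 'a univ_domain)"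
  unfolding field_embedding_def univ_embed_def Const_def
  by (simp add: single_add mult_single One_fract_def flip: to_ac_add to_ac_mult)

text \<open>The extreme coefficient is 1 in every characteristic, whereas a mixed binomial
  coefficient may vanish. Hence only full powers are exchanged below.\<close>

lemma lookup_power_Var_add:
  assumes "i \<noteq> j"
  shows "lookup ((Var i + Var j :: ('n, 'a::comm_ring_1) mpoly) ^ k) (single j k) = 1"
proof (induction k)
  case (Suc k)
  let ?P = "(Var i + Var j :: ('n, 'a) mpoly) ^ k"
  have "lookup (Var i * ?P) (single j (Suc k)) = 0"
  proof -
    have "single j (Suc k) \<noteq> single i 1 + u" for u
    proof
      assume "single j (Suc k) = single i 1 + u"
      from arg_cong[OF this, of "\<lambda>w. lookup w i"] show False
        using assms by (simp add: lookup_add lookup_single)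
    qed
    then show ?thesis by (simp add: Var_def lookup_monomial_mult)
  qed
  moreover have "lookup (Var j * ?P) (single j (Suc k)) = 1"
    using lookup_monomial_mult_add[of "single j 1" ?P "single j k"] Suc
    by (simp add: Var_def flip: single_add)
  ultimately show ?case by (simp add: distrib_right lookup_add)
qed simp

lemma upclosed_generated: "upclosed {a + w | a w. a \<in> A}"
  by (force simp: upclosed_def add.assoc)

text \<open>The substitution of x0 + x_j for x0 is upper triangular and fixes the
  \<open>x0\<close>-free factor f. The term f * x_j^k occurs in the image, and a monomial ideal
  contains every term of its elements.\<close>

lemma borel_fixed_power:
  fixes A :: "'n::{finite,linorder} pterm set"
  assumes borel: "borel_fixed (supported U :: ('n, 'a::field) mpoly set)"
    and a: "f + single x0 k \<in> U" and f: "lookup f x0 = 0"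
  shows "f + single j k \<in> U"
proof (cases "j = x0")
  case False
  define v :: "'n \<Rightarrow> 'a" where "v i = (if i = j then 1 else 0)" for i
  have v0: "v x0 = 0" using False by (simp add: v_def)
  have emb: "field_embedding (id :: 'a \<Rightarrow> 'a)" by (simp add: field_embedding_def)
  have act: "gl_act id (shear_mat v) = (shear v :: ('n, 'a) mpoly \<Rightarrow> _)"
    using gl_act_shear_mat[of id v, OF emb v0] by simp
  have "gl_act id (shear_mat v) ` supported U = (supported U :: ('n, 'a) mpoly set)"
    using borel invertible_shear_mat[of v, OF v0] unfolding borel_fixed_def
    by (auto simp: shear_mat_def dest: leD)
  moreover have "(monomial (f + single x0 k) :: ('n, 'a) mpoly) \<in> supported U" using a by simp
  ultimately have "shear v (monomial (f + single x0 k)) \<in> (supported U :: ('n, 'a) mpoly set)"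
    unfolding act by blast
  moreover have "shear v (monomial (f + single x0 k)) = monomial f * (Var x0 + Var j) ^ k"
  proof -
    have "shear_form v = (\<Sum>i\<in>UNIV. if i = j then Var i else 0) + Var x0"
      unfolding shear_form_def by (subst add.commute, intro arg_cong2[of _ _ _ _ "(+)"] sum.cong)
        (auto simp: v_def mscale_def Const_def)
    then have sf: "shear_form v = Var x0 + Var j" by (simp add: add.commute)
    have "shear v (monomial f) = psubst Var (monomial f)"
      unfolding shear_def psubst_monomial tprod_def by (rule prod.cong) (use f in auto)
    then have "shear v (monomial f) = monomial f" by (simp add: psubst_Var_id)
    then show ?thesis
      by (simp add: shear_mult shear_power shear_Var_x0 sf flip: monomial_mult Var_power)
  qed
  ultimately have "f + w \<in> U" if "lookup ((Var x0 + Var j :: ('n, 'a) mpoly) ^ k) w \<noteq> 0" for w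
    using that by (auto simp: supported_def keys_monomial_mult in_keys_iff)
  then show ?thesis using lookup_power_Var_add[of x0 j k, where 'a='a] False by fastforce
qed (use a in simp)

text \<open>This makes \<open>x0\<close> a nonzerodivisor modulo the saturation. Write u as the
  \<open>?k\<close>-th power of \<open>x0\<close> times f and put N = \<open>?k + s\<close>; by
  \<open>borel_fixed_power\<close> the ideal contains f * x_j^N for every j. A term of degree
  \<open>CARD('n)\<close> times N has some exponent at least N, so its product with u is a multiple
  of one of these.\<close>

lemma borel_fixed_satT:
  fixes U :: "'n::{finite,linorder} pterm set"
  assumes borel: "borel_fixed (supported U :: ('n, 'a::field) mpoly set)" and up: "upclosed U"
    and u: "u + single x0 s \<in> U"
  shows "u \<in> satT U"
proof -
  let ?e = "\<lambda>j :: 'n. single j :: nat \<Rightarrow> 'n pterm"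
  let ?k = "lookup u x0"
  define f where "f = u - ?e x0 ?k"
  have uf: "u = ?e x0 ?k + f"
    unfolding f_def by (rule pterm_eq_add_minus) (auto simp: lookup_single when_def)
  have f0: "lookup f x0 = 0" by (simp add: f_def lookup_minus)
  let ?N = "?k + s"
  have "f + ?e x0 ?N \<in> U"
    using u by (subst (asm) uf) (simp add: single_add add.assoc add.left_commute add.commute)
  then have pow: "f + ?e j ?N \<in> U" for j by (rule borel_fixed_power[OF borel _ f0])
  have "u + w \<in> U" if w: "tdeg w = CARD('n) * ?N" for w
  proof -
    have "\<exists>j. ?N \<le> lookup w j"
    proof (rule ccontr)
      assume "\<not> ?thesis"
      then have "(\<Sum>j\<in>UNIV. lookup w j) < (\<Sum>j\<in>(UNIV :: 'n set). ?N)"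
        by (intro sum_strict_mono) (auto simp: not_le)
      then show False using w by (simp add: tdeg_eq_sum)
    qed
    then obtain j where j: "?N \<le> lookup w j" by blast
    have wj: "w = ?e j ?N + (w - ?e j ?N)"
      by (rule pterm_eq_add_minus) (use j in \<open>auto simp: lookup_single when_def\<close>)
    have "(f + ?e j ?N) + (?e x0 ?k + (w - ?e j ?N)) \<in> U" using pow up by (simp add: upclosed_def)
    moreover have "(f + ?e j ?N) + (?e x0 ?k + (w - ?e j ?N)) = (?e x0 ?k + f) + (?e j ?N + (w - ?e j ?N))"
      by (simp only: ac_simps)
    ultimately show ?thesis using uf wj by simp
  qed
  then show ?thesis by (auto simp: satT_def)
qed

section \<open>Borel-fixed ideals: dimensions of the saturation\<close>

context gotzmann
begin

lemma saturation_hilb: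
  fixes V :: "('n, 'a) mpoly set"
  assumes "V \<in> hilb p q m"
  shows "saturation (mideal.span V) \<in> subscheme_ideals p" "V = saturation (mideal.span V) \<inter> forms m"
proof -
  obtain I where I: "I \<in> subscheme_ideals p" "V = I \<inter> forms m" using assms by (auto simp: hilb_def)
  have "saturation (mideal.span V) = I"
    using regular_saturation_truncation[OF regular[OF I(1)] I(1) r_le] I(2) by simp
  then show "saturation (mideal.span V) \<in> subscheme_ideals p" "V = saturation (mideal.span V) \<inter> forms m"
    using I by auto
qed

lemma dim_of_subscheme:
  fixes I :: "('n, 'a) mpoly set"
  assumes "I \<in> subscheme_ideals p" "m \<le> t"
  shows "rat_of_nat (mpoly.dim (I \<inter> forms t)) =
    rat_of_nat (card {u :: 'n pterm. tdeg u = t}) - poly p (rat_of_nat t)"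
  using hilbert_function_regular[OF regular[OF assms(1)] assms(1), of t] assms(2) r_le
  by (simp add: rat_hilbert_function)

lemma dim_saturation_le:
  fixes A :: "'n pterm set"
  assumes V: "V \<in> hilb p q m" "V = (supported A :: ('n, 'a) mpoly set)" and A: "finite A" and m: "m = s + t"
  shows "mpoly.dim (saturation (mideal.span V) \<inter> forms t) \<le> card {a \<in> A. s \<le> lookup a x0}"
proof -
  let ?I = "saturation (mideal.span V)"
  have I: "?I \<in> subscheme_ideals p" "V = ?I \<inter> forms m" by (fact saturation_hilb[OF V(1)])+
  have idI: "mideal.subspace ?I" using I(1) by (simp add: subscheme_ideals_def homogeneous_ideal_def)
  let ?e = "single x0 s :: 'n pterm"
  let ?phi = "\<lambda>f :: ('n, 'a) mpoly. monomial ?e * f"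
  have lin: "Vector_Spaces.linear mscale mscale ?phi"
    by (rule linear_mscaleI) (simp_all add: distrib_left mscale_mult_right)
  have "mpoly.dim (?phi ` (?I \<inter> forms t)) = mpoly.dim (?I \<inter> forms t)"
    by (rule dim_image_inj_supported[OF lin _ finite_tdeg[of t] subspace_Int_forms[OF idI]])
      (auto simp: forms_eq_supported simp del: mult_eq_0_iff)
  moreover have "?phi ` (?I \<inter> forms t) \<subseteq> supported {a \<in> A. s \<le> lookup a x0}"
  proof
    fix g assume "g \<in> ?phi ` (?I \<inter> forms t)"
    then obtain f where f: "f \<in> ?I" "f \<in> forms t" "g = ?phi f" by blast
    have "g \<in> ?I \<inter> forms m"
      using f m by (auto simp: mideal.subspace_scale[OF idI] forms_def keys_monomial_mult)
    then have "g \<in> V" by (rule ssubst[OF I(2), of "\<lambda>W. g \<in> W"])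
    then have "g \<in> supported A" by (rule subst[OF V(2)])
    then show "g \<in> supported {a \<in> A. s \<le> lookup a x0}"
      using f(3) by (auto simp: supported_def keys_monomial_mult lookup_add)
  qed
  ultimately show ?thesis
    using dim_mono_supported[of "?phi ` (?I \<inter> forms t)" "supported {a \<in> A. s \<le> lookup a x0}", OF _ subset_refl] A
    by simp
qed

text \<open>Dividing a term of \<open>A\<close> by the s-th power of \<open>x0\<close> stays in the
  saturation by \<open>borel_fixed_satT\<close>, and distinct terms have distinct quotients.\<close>

lemma dim_saturation_ge:
  fixes A :: "'n pterm set"
  assumes V: "V = (supported A :: ('n, 'a) mpoly set)" and A: "A \<subseteq> {u. tdeg u = m}" and m: "m = s + t"
    and borel: "borel_fixed (mideal.span V)"
  shows "card {a \<in> A. s \<le> lookup a x0} \<le> mpoly.dim (saturation (mideal.span V) \<inter> forms t)"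
proof -
  let ?U = "{a + w | a w. a \<in> A}"
  let ?e = "single x0 s :: 'n pterm"
  let ?B = "{a \<in> A. s \<le> lookup a x0}"
  have up: "upclosed ?U" by (rule upclosed_generated)
  have span: "mideal.span V = supported ?U" unfolding V by (rule ideal_generated_supported)
  have sat: "saturation (mideal.span V) = supported (satT ?U)" unfolding span by (rule saturation_supported[OF up])
  have bor: "borel_fixed (supported ?U :: ('n, 'a) mpoly set)" using borel by (simp only: span)
  have e: "?e + (a - ?e) = a" if "a \<in> ?B" for a
    by (rule pterm_eq_add_minus[symmetric]) (use that in \<open>auto simp: lookup_single when_def\<close>)
  have "(\<lambda>a. a - ?e) ` ?B \<subseteq> tslice (satT ?U) t"
  proof
    fix u assume "u \<in> (\<lambda>a. a - ?e) ` ?B"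
    then obtain a where a: "a \<in> ?B" "u = a - ?e" by blast
    have ua: "u + ?e = a" using e[OF a(1)] a(2) by (simp add: add.commute)
    have "a + 0 \<in> ?U" using a(1) by blast
    then have "u + ?e \<in> ?U" using ua by simp
    then have "u \<in> satT ?U" by (rule borel_fixed_satT[OF bor up])
    moreover have "tdeg (u + ?e) = m" unfolding ua using a(1) A by blast
    ultimately show "u \<in> tslice (satT ?U) t" using m by (simp add: tslice_def)
  qed
  moreover have "inj_on (\<lambda>a. a - ?e) ?B"
  proof (rule inj_onI)
    fix a b assume ab: "a \<in> ?B" "b \<in> ?B" "a - ?e = b - ?e"
    have "a = ?e + (a - ?e)" using e[OF ab(1)] by simp
    also have "\<dots> = b" unfolding ab(3) by (rule e[OF ab(2)])
    finally show "a = b" .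
  qed
  ultimately have "card ?B \<le> card (tslice (satT ?U) t)" by (intro card_inj_on_le[OF _ _ finite_tslice])
  then show ?thesis by (simp add: sat dim_supported_Int_forms)
qed

lemma dim_saturation_mono:
  fixes V V' :: "('n, 'a) mpoly set"
  assumes V: "V \<in> hilb p q m" and V': "V' \<in> hilb p q m"
    and borel: "borel_fixed (mideal.span V)" and dom: "term_dominated q m V V'"
  shows "mpoly.dim (saturation (mideal.span V') \<inter> forms t) \<le> mpoly.dim (saturation (mideal.span V) \<inter> forms t)"
proof (cases "m \<le> t")
  case True
  then show ?thesis
    using dim_of_subscheme[OF saturation_hilb(1)[OF V] True] dim_of_subscheme[OF saturation_hilb(1)[OF V'] True]
    by simp
next
  case False
  define s where "s = m - t"
  have m: "m = s + t" using False by (simp add: s_def)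
  obtain A B \<omega> where AB: "A \<subseteq> {u. tdeg u = m}" "finite A" "finite B"
    "V = mpoly.span (monomial ` A)" "V' = mpoly.span (monomial ` B)"
    and \<omega>: "bij_betw \<omega> A B" "\<And>a. a \<in> A \<Longrightarrow> drl_le a (\<omega> a)"
    using dom unfolding term_dominated_def by blast
  \<comment> \<open>\<open>\<omega>\<close> raises terms and hence does not raise the exponent of
    \<open>x0\<close>, so a counted b comes only from a counted a.\<close>
  have "{b \<in> B. s \<le> lookup b x0} \<subseteq> \<omega> ` {a \<in> A. s \<le> lookup a x0}"
  proof
    fix b assume b: "b \<in> {b \<in> B. s \<le> lookup b x0}"
    then obtain a where a: "a \<in> A" "b = \<omega> a" using \<omega>(1) by (auto simp: bij_betw_def)
    then have "lookup b x0 \<le> lookup a x0" using \<omega>(2) drl_le_lookup_x0 by blast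
    then show "b \<in> \<omega> ` {a \<in> A. s \<le> lookup a x0}" using a b by auto
  qed
  then have "card {b \<in> B. s \<le> lookup b x0} \<le> card {a \<in> A. s \<le> lookup a x0}"
    using AB(2) by (intro surj_card_le) auto
  then show ?thesis
    using dim_saturation_le[OF V' _ AB(3) m] dim_saturation_ge[OF _ AB(1) m borel] AB(4,5)
    by (simp add: span_monomials)
qed

end

section \<open>GL-stable subsets and the double-generic initial ideal\<close>

lemma gl_orbit_eq:
  fixes Y :: "('n::{finite,linorder} eterm, 'a::field) mpoly set set"
  assumes "gl_stable_subset p q m Y"
  shows "gl_orbit q m Y = Y"
proof
  show "gl_orbit q m Y \<subseteq> Y" using assms by (simp add: gl_stable_subset_def)
  show "Y \<subseteq> gl_orbit q m Y"
  proof
    fix y assume y: "y \<in> Y"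
    then have "y \<in> hilb_points p q m" using assms by (auto simp: gl_stable_subset_def hilb_closed_def)
    then obtain V where V: "V \<in> grassmannian q m" "y = pluecker_point univ_embed q m V"
      by (auto simp: hilb_points_def hilb_def)
    \<comment> \<open>The identity matrix, as the shear with all coefficients 0.\<close>
    let ?g = "shear_mat (\<lambda>_. 0) :: ('a, 'n) sqmat"
    have "shear (\<lambda>_. 0) f = f" for f :: "('n, 'a univ_domain) mpoly"
    proof -
      have "(\<lambda>i. if i = x0 then shear_form (\<lambda>_. 0) else Var i) = (Var :: 'n \<Rightarrow> ('n, 'a univ_domain) mpoly)"
        by (auto simp: shear_form_0)
      then show ?thesis by (simp add: shear_def psubst_Var_id)
    qed
    then have "gl_act univ_embed ?g ` V = V"
      by (simp add: gl_act_shear_mat[OF univ_embed_embedding] field_embedding_simps[OF univ_embed_embedding])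
    moreover have "invertible ?g" by (rule invertible_shear_mat) simp
    ultimately show "y \<in> gl_orbit q m Y" using V y unfolding gl_orbit_def
      by (intro CollectI exI[of _ ?g] exI[of _ V]) simp
  qed
qed

text \<open>Supplies the closed pieces for irreducibility: if two charts met \<open>Y\<close> in
  disjoint sets, the loci where the two coordinates vanish would cover \<open>Y\<close>.\<close>

lemma hilb_closed_hypersurface:
  assumes "hilb_closed p q m Y" "M \<in> eterms q m"
  shows "hilb_closed p q m {y \<in> Y. Var M \<in> y}"
proof -
  obtain E where E: "E \<subseteq> pluecker_ring q m \<inter> (\<Union>d. forms d)" "Y = {y \<in> hilb_points p q m. E \<subseteq> y}"
    using assms(1) by (auto simp: hilb_closed_def)
  have "insert (Var M) E \<subseteq> pluecker_ring q m \<inter> (\<Union>d. forms d)"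
    by (intro insert_subsetI IntI E(1) Var_in_pluecker_ring[OF assms(2)], rule UN_I[of 1])
      (rule UNIV_I, rule Var_in_forms)
  moreover have "{y \<in> Y. Var M \<in> y} = {y \<in> hilb_points p q m. insert (Var M) E \<subseteq> y}" 
    unfolding E(2) by auto
  ultimately show ?thesis unfolding hilb_closed_def by (intro exI[of _ "insert (Var M) E"] conjI)
qed

locale stable_subset = gotzmann p r m q ground vars
  for p r m q and ground :: "'a::field itself" and vars :: "'n::{finite,linorder} itself" +
  fixes Y :: "('n eterm, 'a) mpoly set set"
  assumes stable: "gl_stable_subset p q m Y"
    and infinite_ground: "infinite (UNIV :: 'a set)"
begin

definition charts :: "'n eterm set" where
  "charts = {L \<in> eterms q m. open_chart L \<inter> Y \<noteq> {}}"

lemma point_of: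
  assumes "y \<in> Y"
  obtains H :: "('n, 'a univ_domain) mpoly set"
  where "H \<in> subscheme_ideals p" "H \<inter> forms m \<in> grassmannian q m"
    "y = pluecker_point univ_embed q m (H \<inter> forms m)"
proof -
  have "y \<in> hilb_points p q m" using assms stable by (auto simp: gl_stable_subset_def hilb_closed_def)
  then obtain V :: "('n, 'a univ_domain) mpoly set" where "V \<in> hilb p q m" "y = pluecker_point univ_embed q m V"
    by (auto simp: hilb_points_def)
  then show ?thesis using that by (auto simp: hilb_def)
qed

lemma charts_iff:
  fixes V :: "('n, 'a univ_domain) mpoly set"
  assumes "V \<in> grassmannian q m" "pluecker_point univ_embed q m V \<in> Y" "M \<in> eterms q m" "coordinates_of V M"
  shows "M \<in> charts"
  using assms open_chart_iff[OF univ_embed_embedding assms(3,1)] by (auto simp: charts_def)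

lemma charts_nonempty: "charts \<noteq> {}"
proof -
  obtain y where "y \<in> Y" using stable by (auto simp: gl_stable_subset_def)
  then obtain H :: "('n, 'a univ_domain) mpoly set" where H: "H \<inter> forms m \<in> grassmannian q m"
    "pluecker_point univ_embed q m (H \<inter> forms m) \<in> Y" using point_of by metis
  obtain L where L: "L \<in> eterms q m" "set L = lts (H \<inter> forms m)" by (rule lts_eterm_exists[OF H(1)])
  then have "L \<in> charts" using charts_iff[OF H L(1)] coordinates_of_lts[OF H(1)] by blast
  then show ?thesis by blast
qed

lemma gin_charts: "gin q m Y \<in> charts" and gin_max: "M \<in> charts \<Longrightarrow> M = gin q m Y \<or> eterm_less M (gin q m Y)"
proof -
  have "charts \<subseteq> eterms q m" by (auto simp: charts_def)
  then have "\<exists>L\<in>charts. \<forall>M\<in>charts. M = L \<or> eterm_less M L"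
    using charts_nonempty finite_subset[OF _ finite_eterms] by (intro eterm_max_exists) auto
  then obtain L where L: "L \<in> charts" "\<And>M. M \<in> charts \<Longrightarrow> M = L \<or> eterm_less M L" by blast
  have "gin q m Y = (THE L. L \<in> charts \<and> (\<forall>M\<in>charts. M = L \<or> eterm_less M L))"
    by (simp add: gin_def gl_orbit_eq[OF stable] charts_def)
  also have "\<dots> = L"
  proof (rule the_equality)
    fix L' assume L': "L' \<in> charts \<and> (\<forall>M\<in>charts. M = L' \<or> eterm_less M L')"
    then have "L = L' \<or> eterm_less L L'" "L' = L \<or> eterm_less L' L" using L by blast+
    then show "L' = L" using eterm_less_trans[of L L' L] by auto
  qed (use L in blast)
  finally have "gin q m Y = L" .
  then show "gin q m Y \<in> charts" "M \<in> charts \<Longrightarrow> M = gin q m Y \<or> eterm_less M (gin q m Y)"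
    using L by auto
qed

lemma common_point:
  assumes "M \<in> charts"
  obtains H :: "('n, 'a univ_domain) mpoly set"
  where "H \<in> subscheme_ideals p" "H \<inter> forms m \<in> grassmannian q m"
    "pluecker_point univ_embed q m (H \<inter> forms m) \<in> Y"
    "coordinates_of (H \<inter> forms m) M" "lts (H \<inter> forms m) = set (gin q m Y)"
proof -
  let ?L = "gin q m Y"
  have et: "M \<in> eterms q m" "?L \<in> eterms q m" using assms gin_charts by (auto simp: charts_def)
  have closed: "hilb_closed p q m Y" using stable by (simp add: gl_stable_subset_def)
  have "\<exists>y\<in>Y. y \<in> open_chart M \<and> y \<in> open_chart ?L"
  proof (rule ccontr)
    assume "\<not> ?thesis"
    then have "Y = {y \<in> Y. Var M \<in> y} \<union> {y \<in> Y. Var ?L \<in> y}" by (auto simp: open_chart_def)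
    then have "Y = {y \<in> Y. Var M \<in> y} \<or> Y = {y \<in> Y. Var ?L \<in> y}"
      using stable hilb_closed_hypersurface[OF closed et(1)] hilb_closed_hypersurface[OF closed et(2)]
      unfolding gl_stable_subset_def by blast
    then show False using assms gin_charts by (auto simp: charts_def open_chart_def)
  qed
  then obtain y where y: "y \<in> Y" "y \<in> open_chart M" "y \<in> open_chart ?L" by blast
  obtain H :: "('n, 'a univ_domain) mpoly set" where H: "H \<in> subscheme_ideals p" "H \<inter> forms m \<in> grassmannian q m"
    "y = pluecker_point univ_embed q m (H \<inter> forms m)" using point_of[OF y(1)] .
  let ?V = "H \<inter> forms m"
  have coord: "coordinates_of ?V M" "coordinates_of ?V ?L"
    using open_chart_iff[OF univ_embed_embedding _ H(2)] et y H(3) by auto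
  obtain L where L: "L \<in> eterms q m" "set L = lts ?V" by (rule lts_eterm_exists[OF H(2)])
  \<comment> \<open>The leading terms L of this point give a chart, so L is at most
    \<open>?L\<close>; conversely \<open>?L\<close> is a nonvanishing coordinate of the point and so
    at most L.\<close>
  have "L \<in> charts" using charts_iff[OF H(2) _ L(1)] coordinates_of_lts[OF H(2) L(2)] y(1) H(3) by blast
  then have "L = ?L \<or> eterm_less L ?L" by (rule gin_max)
  moreover have "?L = L \<or> eterm_less ?L L" by (rule coordinates_le_lts[OF H(2) et(2) coord(2) L])
  ultimately have "L = ?L" using eterm_less_trans[of L ?L L] by auto
  then show ?thesis using that[of H] H y(1) coord(1) L(2) by simp
qed

lemma card_gin_le_dim:
  fixes \<iota> :: "'a \<Rightarrow> 'k::field" and H :: "('n, 'k) mpoly set"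
  assumes \<iota>: "field_embedding \<iota>" and H: "defines_point \<iota> p q m H y" "y \<in> Y" and m: "m = s + t"
  shows "card {u \<in> set (gin q m Y). s \<le> lookup u x0} \<le> mpoly.dim (H \<inter> forms t)"
proof -
  let ?L = "gin q m Y"
  let ?V = "H \<inter> forms m"
  have H': "H \<in> subscheme_ideals p" "?V \<in> grassmannian q m" "pluecker_point \<iota> q m ?V = y"
    using H(1) by (auto simp: defines_point_def)
  have sat: "mideal.subspace H" "saturation H = H"
    using H'(1) by (auto simp: subscheme_ideals_def homogeneous_ideal_def)
  obtain v :: "'n \<Rightarrow> 'a" where v: "v x0 = 0"
    "card {u \<in> lts (shear (\<lambda>j. \<iota> (v j)) ` ?V). s \<le> lookup u x0} \<le> mpoly.dim (H \<inter> forms t)"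
    using shear_dim_bound[OF \<iota> infinite_ground sat, of s t] m by blast
  let ?gV = "shear (\<lambda>j. \<iota> (v j)) ` ?V"
  have gV: "?gV \<in> grassmannian q m"
    by (rule shear_grassmannian[OF H'(2)]) (simp add: v(1) field_embedding_simps[OF \<iota>])
  obtain M where M: "M \<in> eterms q m" "set M = lts ?gV" by (rule lts_eterm_exists[OF gV])
  \<comment> \<open>The same point y over the universal domain, where \<open>gl_orbit\<close> is
    formed.\<close>
  obtain H2 :: "('n, 'a univ_domain) mpoly set" where H2: "H2 \<inter> forms m \<in> grassmannian q m"
    "y = pluecker_point univ_embed q m (H2 \<inter> forms m)" using point_of[OF H(2)] by blast
  let ?V2 = "H2 \<inter> forms m"
  let ?gV2 = "shear (\<lambda>j. univ_embed (v j)) ` ?V2"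
  have gV2: "?gV2 \<in> grassmannian q m"
    by (rule shear_grassmannian[OF H2(1)]) (simp add: v(1) field_embedding_simps[OF univ_embed_embedding])
  have "coordinates_of ?gV2 M"
    by (rule coordinates_of_transfer[where v = v, OF \<iota> univ_embed_embedding v(1) M(1) H'(2) H2(1)])
      (use H'(3) H2(2) coordinates_of_lts[OF gV M(2)] in auto)
  moreover have "pluecker_point univ_embed q m ?gV2 \<in> gl_orbit q m Y"
    unfolding gl_orbit_def using H(2) H2 invertible_shear_mat[of v, OF v(1)] gl_act_shear_mat[of univ_embed v, OF univ_embed_embedding v(1)]
    by (intro CollectI exI[of _ "shear_mat v"] exI[of _ ?V2]) simp
  ultimately have "M \<in> charts" using charts_iff[OF gV2 _ M(1)] gl_orbit_eq[OF stable] by blast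
  then obtain H3 :: "('n, 'a univ_domain) mpoly set" where H3: "H3 \<inter> forms m \<in> grassmannian q m"
    "coordinates_of (H3 \<inter> forms m) M" "lts (H3 \<inter> forms m) = set ?L" using common_point by metis
  \<comment> \<open>An up-set by \<open>drl_le_lookup_x0\<close>. As both lists have q entries, the
    inequality for the entries in \<open>?D\<close> reverses for the entries outside, which are the
    ones to be counted.\<close>
  let ?D = "{u :: 'n pterm. lookup u x0 < s}"
  have "card (set M \<inter> ?D) \<le> card (lts (H3 \<inter> forms m) \<inter> ?D)"
    by (rule card_coordinates_Int_upset[OF H3(1) M(1) H3(2)]) (use drl_le_lookup_x0 le_less_trans in blast)
  then have "card (set M \<inter> ?D) \<le> card (set ?L \<inter> ?D)" by (simp add: H3(3))
  moreover have split: "card (set N) = card {u \<in> set N. s \<le> lookup u x0} + card (set N \<inter> ?D)" for N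
  proof -
    have "set N = {u \<in> set N. s \<le> lookup u x0} \<union> (set N \<inter> ?D)" by auto
    moreover have "card ({u \<in> set N. s \<le> lookup u x0} \<union> (set N \<inter> ?D)) =
        card {u \<in> set N. s \<le> lookup u x0} + card (set N \<inter> ?D)"
      by (rule card_Un_disjoint) auto
    ultimately show ?thesis by (simp only:)
  qed
  moreover have "card (set M) = q" "card (set ?L) = q"
    using card_lts_grassmannian[OF gV] M(2) card_lts_grassmannian[OF H3(1)] H3(3) by simp_all
  ultimately have "card {u \<in> set ?L. s \<le> lookup u x0} \<le> card {u \<in> set M. s \<le> lookup u x0}"
    using split[of M] split[of ?L] by linarith
  then show ?thesis using v(2) M(2) by simp
qed

text \<open>\<open>common_point\<close> for the chart of \<open>gin q m Y\<close> itself; by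
  \<open>initial_ideal\<close> the leading terms in degree m already determine the saturated initial
  ideal.\<close>

lemma generic_ideal:
  obtains H :: "('n, 'a univ_domain) mpoly set" where "H \<in> subscheme_ideals p"
    "defines_point univ_embed p q m H (pluecker_point univ_embed q m (H \<inter> forms m))"
    "pluecker_point univ_embed q m (H \<inter> forms m) \<in> Y"
    "lts (H \<inter> forms m) = set (gin q m Y)"
    "double_gin q m Y = supported (satT (lts H))"
proof -
  obtain H :: "('n, 'a univ_domain) mpoly set" where H: "H \<in> subscheme_ideals p" "H \<inter> forms m \<in> grassmannian q m"
    "pluecker_point univ_embed q m (H \<inter> forms m) \<in> Y" "lts (H \<inter> forms m) = set (gin q m Y)"
    using common_point[OF gin_charts] .
  have "mpoly.dim (H \<inter> forms m) = q" using H(2) by (simp add: grassmannian_def)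
  from initial_ideal(3)[OF H(1) this] have "double_gin q m Y = supported (satT (lts H))"
    by (simp add: double_gin_def vs_def tslice_lts H(4))
  then show ?thesis using that[of H] H by (simp add: defines_point_def)
qed

text \<open>Regularity is assumed for ideals over the ground field and \<open>H\<close> lives over
  an extension. The value is therefore taken from the saturated initial ideal, which has the same
  terms as the initial ideal from degree m on.\<close>

lemma hilbert_function_high_degree:
  fixes H :: "('n, 'k::field) mpoly set"
  assumes H: "H \<in> subscheme_ideals p" "H \<inter> forms m \<in> grassmannian q m" and t: "m \<le> t"
  shows "rat_of_nat (hilbert_function H t) = poly p (rat_of_nat t)"
proof -
  have dim: "mpoly.dim (H \<inter> forms m) = q" using H(2) by (simp add: grassmannian_def)
  note G = initial_ideal[OF H(1) dim]
  have idH: "mideal.subspace H" using H(1) by (simp add: subscheme_ideals_def homogeneous_ideal_def)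
  have "rat_of_nat (hilbert_function (supported (satT (lts H)) :: ('n, 'a) mpoly set) t) = poly p (rat_of_nat t)"
    using hilbert_function_regular[OF regular[OF G(1)] G(1)] t r_le by simp
  moreover have "hilbert_function H t = card {u :: 'n pterm. tdeg u = t} - card (tslice (lts H) t)"
    by (simp add: hilbert_function_def dim_forms card_tslice_lts[OF idH])
  ultimately show ?thesis by (simp add: hilbert_function_supported G(2)[OF t])
qed

text \<open>Multiplication by the s-th power of \<open>x0\<close> embeds degree t into degree m,
  where saturation has added nothing to the terms of \<open>gin q m Y\<close>.\<close>

lemma card_double_gin_le:
  fixes H :: "('n, 'a univ_domain) mpoly set"
  assumes H: "H \<in> subscheme_ideals p" "mpoly.dim (H \<inter> forms m) = q" "lts (H \<inter> forms m) = set (gin q m Y)"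
    and m: "m = s + t"
  shows "card (tslice (satT (lts H)) t) \<le> card {u \<in> set (gin q m Y). s \<le> lookup u x0}"
proof (rule card_inj_on_le)
  let ?e = "single x0 s :: 'n pterm"
  have idH: "mideal.subspace H" using H(1) by (simp add: subscheme_ideals_def homogeneous_ideal_def)
  show "inj_on (\<lambda>u. u + ?e) (tslice (satT (lts H)) t)" by (rule inj_onI) simp
  show "(\<lambda>u. u + ?e) ` tslice (satT (lts H)) t \<subseteq> {u \<in> set (gin q m Y). s \<le> lookup u x0}"
  proof
    fix w assume "w \<in> (\<lambda>u. u + ?e) ` tslice (satT (lts H)) t"
    then obtain u where u: "u \<in> satT (lts H)" "tdeg u = t" "w = u + ?e" by (auto simp: tslice_def)
    have "w \<in> satT (lts H)" using upclosed_satT[OF upclosed_lts[OF idH]] u(1,3) by (auto simp: upclosed_def)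
    then have "w \<in> tslice (satT (lts H)) m" using u m by (simp add: tslice_def)
    then have "w \<in> set (gin q m Y)" using initial_ideal(2)[OF H(1,2) order_refl] H(3) by (simp add: tslice_lts)
    then show "w \<in> {u \<in> set (gin q m Y). s \<le> lookup u x0}" using u(3) by (simp add: lookup_add)
  qed
qed simp

lemma hilbert_function_double_gin_ge:
  fixes \<iota> :: "'a \<Rightarrow> 'k::field" and H :: "('n, 'k) mpoly set"
  assumes \<iota>: "field_embedding \<iota>" and H: "defines_point \<iota> p q m H y" "y \<in> Y"
  shows "hilbert_function H t \<le> hilbert_function (double_gin q m Y) t"
proof -
  obtain H0 :: "('n, 'a univ_domain) mpoly set" where H0: "H0 \<in> subscheme_ideals p"
    "defines_point univ_embed p q m H0 (pluecker_point univ_embed q m (H0 \<inter> forms m))"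
    "lts (H0 \<inter> forms m) = set (gin q m Y)"
    "double_gin q m Y = supported (satT (lts H0))" using generic_ideal by metis
  have dim0: "mpoly.dim (H0 \<inter> forms m) = q" using H0(2) by (simp add: defines_point_def grassmannian_def)
  note G = initial_ideal(1)[OF H0(1) dim0, folded H0(4)]
  show ?thesis
  proof (cases "m \<le> t")
    case True
    have "rat_of_nat (hilbert_function H t) = rat_of_nat (hilbert_function (double_gin q m Y) t)"
      using hilbert_function_high_degree[of H t] H(1) True hilbert_function_regular[OF regular[OF G] G, of t] r_le
      by (simp add: defines_point_def)
    then show ?thesis by simp
  next
    case False
    then have m: "m = (m - t) + t" by simp
    have "card (tslice (satT (lts H0)) t) \<le> mpoly.dim (H \<inter> forms t)"
      using card_double_gin_le[OF H0(1) dim0 H0(3) m] card_gin_le_dim[OF \<iota> H m] by (rule order_trans)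
    then show ?thesis
      by (simp add: hilbert_function_supported H0(4)) (simp add: hilbert_function_def dim_forms diff_le_mono2)
  qed
qed

text \<open>An initial ideal lies in its saturation, which gives one inequality between the Hilbert
  functions; the other is \<open>hilbert_function_double_gin_ge\<close> applied to the generic point
  itself.\<close>

lemma hilbert_function_double_gin_attained:
  "\<exists>y\<in>Y. \<exists>H :: ('n, 'a univ_domain) mpoly set.
     defines_point univ_embed p q m H y \<and> hilbert_function (double_gin q m Y) = hilbert_function H"
proof -
  obtain H :: "('n, 'a univ_domain) mpoly set" where H: "H \<in> subscheme_ideals p"
    "defines_point univ_embed p q m H (pluecker_point univ_embed q m (H \<inter> forms m))"
    "pluecker_point univ_embed q m (H \<inter> forms m) \<in> Y"
    "double_gin q m Y = supported (satT (lts H))" using generic_ideal by metis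
  have idH: "mideal.subspace H" using H(1) by (simp add: subscheme_ideals_def homogeneous_ideal_def)
  have "hilbert_function (double_gin q m Y) t \<le> hilbert_function H t" for t
  proof -
    have "card (tslice (lts H) t) \<le> card (tslice (satT (lts H)) t)"
      using subset_satT[OF upclosed_lts[OF idH]] by (intro card_mono) (auto simp: tslice_def)
    then show ?thesis using card_tslice_lts[OF idH, of t]
      by (simp add: hilbert_function_supported H(4)) (simp add: hilbert_function_def dim_forms diff_le_mono2)
  qed
  then have "hilbert_function (double_gin q m Y) = hilbert_function H"
    using hilbert_function_double_gin_ge[OF univ_embed_embedding H(2,3)] by (auto intro: antisym)
  then show ?thesis using H(2,3) by blast
qed

end

theorem theorem6p6:
  fixes p :: "rat poly" and r m q :: nat
    and \<iota> :: "'a::field \<Rightarrow> 'k::field"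
  assumes "infinite (UNIV :: 'a set)"
    and "is_gotzmann_number
           (subscheme_ideals p :: ('n::{finite,linorder}, 'a) mpoly set set) r"
    and "r \<le> m"
    and "rat_of_nat q =
           rat_of_nat ((CARD('n) - 1 + m) choose (CARD('n) - 1)) - poly p (rat_of_nat m)"
    and "field_embedding \<iota>"
  shows
    "(\<forall>V V' :: ('n, 'a) mpoly set.
        V \<in> hilb p q m \<and> V' \<in> hilb p q m \<and>
        borel_fixed (mideal.span V) \<and> borel_fixed (mideal.span V') \<and>
        term_dominated q m V V' \<longrightarrow>
        (\<forall>t. mpoly.dim (saturation (mideal.span V) \<inter> forms t)
             \<ge> mpoly.dim (saturation (mideal.span V') \<inter> forms t)))
     \<and>
     (\<forall>Y :: ('n eterm, 'a) mpoly set set. gl_stable_subset p q m Y \<longrightarrow>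
        (\<exists>y\<in>Y. \<exists>H :: ('n, 'a univ_domain) mpoly set.
           defines_point univ_embed p q m H y \<and>
           hilbert_function (double_gin q m Y) = hilbert_function H) \<and>
        (\<forall>y\<in>Y. \<forall>H :: ('n, 'k) mpoly set.
           defines_point \<iota> p q m H y \<longrightarrow>
           (\<forall>t. hilbert_function (double_gin q m Y) t \<ge> hilbert_function H t)))"
proof -
  interpret gotzmann p r m q "TYPE('a)" "TYPE('n)"
    by unfold_locales (use assms(2-4) in \<open>auto simp: is_gotzmann_number_def\<close>)
  have "(\<exists>y\<in>Y. \<exists>H :: ('n, 'a univ_domain) mpoly set.
           defines_point univ_embed p q m H y \<and>
           hilbert_function (double_gin q m Y) = hilbert_function H) \<and>
        (\<forall>y\<in>Y. \<forall>H :: ('n, 'k) mpoly set.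
           defines_point \<iota> p q m H y \<longrightarrow>
           (\<forall>t. hilbert_function (double_gin q m Y) t \<ge> hilbert_function H t))"
    if "gl_stable_subset p q m Y" for Y :: "('n eterm, 'a) mpoly set set"
  proof -
    interpret stable_subset p r m q "TYPE('a)" "TYPE('n)" Y
      by unfold_locales (use that assms(1) in auto)
    show ?thesis
      using hilbert_function_double_gin_attained hilbert_function_double_gin_ge[OF assms(5)] by blast
  qed
  then show ?thesis using dim_saturation_mono by blast
qed

end
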